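(* Let $\alpha\in\mathbb{R}\setminus\mathbb{Q}$ with $\beta(\alpha)=0$ and let $\lambda=(\lambda_1,\lambda_2,\lambda_3)$ belong to region II. Then the family $\{H_{\hat\lambda,\alpha,\theta}\}_{\theta}$ is almost localized: there exist constants $C_0,C_3,\epsilon_0,\tilde\epsilon_0>0$ such that for every $\theta\in\mathbb{R}$, every $E\in\mathbb{R}$, and every solution $\phi:\mathbb{Z}\to\mathbb{C}$ of $H_{\hat\lambda,\alpha,\theta}\phi=E\phi$ with $\phi(0)=1$ and $|\phi(m)|\le 1+|m|$ for all $m\in\mathbb{Z}$, one has $$|\phi(k)|\le C_3e^{-\tilde\epsilon_0|k|}$$ for every $j$ and every $k\in\mathbb{Z}$ with $C_0(1+|n_j|)<|k|<C_0^{-1}|n_{j+1}|$, where $\{n_j\}$ are the $\epsilon_0$-resonances of $\theta$.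
   Context: Notation: $\mathbb{T}=\mathbb{R}/\mathbb{Z}$, $\|x\|$ is the distance from $x$ to $\mathbb{Z}$. For irrational $\alpha$ with continued fraction approximants $p_n/q_n$, $\beta(\alpha)=\limsup_{n}\frac{\ln q_{n+1}}{q_n}$. Extended Harper's model: for real couplings $\lambda=(\lambda_1,\lambda_2,\lambda_3)$, $$(H_{\lambda,\alpha,\theta}u)_n=c_\lambda(\theta+n\alpha)u_{n+1}+\tilde c_\lambda(\theta+(n-1)\alpha)u_{n-1}+2\cos 2\pi(\theta+n\alpha)\,u_n,$$ with $c_\lambda(\theta)=\lambda_1e^{-2\pi i(\theta+\alpha/2)}+\lambda_2+\lambda_3e^{2\pi i(\theta+\alpha/2)}$, $\tilde c_\lambda(\theta)=\lambda_1e^{2\pi i(\theta+\alpha/2)}+\lambda_2+\lambda_3e^{-2\pi i(\theta+\alpha/2)}$. Solutions of $H\phi=E\phi$ are formal solutions (sequences, not necessarily in $\ell^2$). Region II: $\lambda_1+\lambda_3\ge0$ and $\max(\lambda_1+\lambda_3,1)<\lambda_2$. Dual couplings: $\hat\lambda=(\lambda_3/\lambda_2,\,1/\lambda_2,\,\lambda_1/\lambda_2)$. Resonances: for $\epsilon_0>0$, $k\in\mathbb{Z}$ is an $\epsilon_0$-resonance of $\theta$ if $\|2\theta-k\alpha\|\le e^{-\epsilon_0|k|}$ and $\|2\theta-k\alpha\|=\min_{|l|\le|k|}\|2\theta-l\alpha\|$. The $\epsilon_0$-resonances of $\theta$ are listed as $0=|n_0|<|n_1|<\cdots$; if the list is finite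 with last element $n_j$, one puts $|n_{j+1}|=\infty$. *)

theory Defs
  imports "HOL-Analysis.Analysis" "HOL-Library.Infinite_Set"
begin

section \<open>Continued fractions and the exponent \<open>\<beta>(\<alpha>)\<close>\<close>

text \<open>
  Complete quotients \<open>x\<^sub>0 = \<alpha>\<close>, \<open>x\<^bsub>n+1\<^esub> = 1 / {x\<^sub>n}\<close> (Gauss map), partial quotients
  \<open>a\<^sub>n = \<lfloor>x\<^sub>n\<rfloor>\<close>, and the denominators \<open>q\<^sub>n\<close> of the convergents of \<open>[a\<^sub>0; a\<^sub>1, a\<^sub>2, \<dots>]\<close>.
  For irrational \<open>\<alpha>\<close> no division by zero occurs and \<open>q\<^sub>n \<ge> 1\<close>.
\<close>

primrec cf_remainder :: "real \<Rightarrow> nat \<Rightarrow> real" where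
  "cf_remainder \<alpha> 0 = \<alpha>"
| "cf_remainder \<alpha> (Suc n) = 1 / frac (cf_remainder \<alpha> n)"

definition cf_digit :: "real \<Rightarrow> nat \<Rightarrow> int" where
  "cf_digit \<alpha> n = \<lfloor>cf_remainder \<alpha> n\<rfloor>"

fun cf_denom :: "real \<Rightarrow> nat \<Rightarrow> int" where
  "cf_denom \<alpha> 0 = 1"
| "cf_denom \<alpha> (Suc 0) = cf_digit \<alpha> 1"
| "cf_denom \<alpha> (Suc (Suc n)) = cf_digit \<alpha> (Suc (Suc n)) * cf_denom \<alpha> (Suc n) + cf_denom \<alpha> n"

definition beta_exponent :: "real \<Rightarrow> ereal" where
  "beta_exponent \<alpha> =
     limsup (\<lambda>n. ereal (ln (real_of_int (cf_denom \<alpha> (Suc n))) / real_of_int (cf_denom \<alpha> n)))"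


section \<open>Extended Harper's model\<close>

type_synonym coupling = "real \<times> real \<times> real"

fun c_fun :: "coupling \<Rightarrow> real \<Rightarrow> real \<Rightarrow> complex" where
  "c_fun (l1, l2, l3) \<alpha> \<theta> =
     of_real l1 * cis (- 2 * pi * (\<theta> + \<alpha> / 2)) + of_real l2
       + of_real l3 * cis (2 * pi * (\<theta> + \<alpha> / 2))"

fun c_tilde :: "coupling \<Rightarrow> real \<Rightarrow> real \<Rightarrow> complex" where
  "c_tilde (l1, l2, l3) \<alpha> \<theta> =
     of_real l1 * cis (2 * pi * (\<theta> + \<alpha> / 2)) + of_real l2
       + of_real l3 * cis (- 2 * pi * (\<theta> + \<alpha> / 2))"

text \<open>The difference expression acts on arbitrary sequences, not only on square-summable ones.\<close>

definition harper ::
  "coupling \<Rightarrow> real \<Rightarrow> real \<Rightarrow> (int \<Rightarrow> complex) \<Rightarrow> int \<Rightarrow> complex" where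
  "harper l \<alpha> \<theta> u n =
     c_fun l \<alpha> (\<theta> + of_int n * \<alpha>) * u (n + 1)
     + c_tilde l \<alpha> (\<theta> + of_int (n - 1) * \<alpha>) * u (n - 1)
     + of_real (2 * cos (2 * pi * (\<theta> + of_int n * \<alpha>))) * u n"

fun region_II :: "coupling \<Rightarrow> bool" where
  "region_II (l1, l2, l3) \<longleftrightarrow> l1 + l3 \<ge> 0 \<and> max (l1 + l3) 1 < l2"

fun dual_coupling :: "coupling \<Rightarrow> coupling" where
  "dual_coupling (l1, l2, l3) = (l3 / l2, 1 / l2, l1 / l2)"


section \<open>Resonances\<close>

definition dist_int :: "real \<Rightarrow> real" where
  "dist_int x = infdist x \<int>"

definition resonance :: "real \<Rightarrow> real \<Rightarrow> real \<Rightarrow> int \<Rightarrow> bool" where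
  "resonance \<epsilon> \<alpha> \<theta> k \<longleftrightarrow>
     dist_int (2 * \<theta> - of_int k * \<alpha>) \<le> exp (- \<epsilon> * of_int \<bar>k\<bar>) \<and>
     dist_int (2 * \<theta> - of_int k * \<alpha>)
       = Min ((\<lambda>l. dist_int (2 * \<theta> - of_int l * \<alpha>)) ` {l. \<bar>l\<bar> \<le> \<bar>k\<bar>})"

definition resonance_moduli :: "real \<Rightarrow> real \<Rightarrow> real \<Rightarrow> nat set" where
  "resonance_moduli \<epsilon> \<alpha> \<theta> = (\<lambda>k. nat \<bar>k\<bar>) ` {k. resonance \<epsilon> \<alpha> \<theta> k}"

text \<open>
  \<open>resonance_abs \<epsilon> \<alpha> \<theta> j\<close> is \<open>|n\<^sub>j|\<close>, where \<open>0 = |n\<^sub>0| < |n\<^sub>1| < \<dots>\<close> lists the resonances; past the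
  end of a finite list it is \<open>\<infinity>\<close>. Enumerating the moduli rather than the resonances makes the list
  strictly increasing also when \<open>k\<close> and \<open>-k\<close> are both resonances, which for irrational \<open>\<alpha>\<close> and
  \<open>k \<noteq> 0\<close> can happen only if \<open>2\<theta> - 1/2\<close> is an integer.
\<close>

definition resonance_abs :: "real \<Rightarrow> real \<Rightarrow> real \<Rightarrow> nat \<Rightarrow> ereal" where
  "resonance_abs \<epsilon> \<alpha> \<theta> j =
     (let R = resonance_moduli \<epsilon> \<alpha> \<theta> in
      if infinite R \<or> j < card R then ereal (real (enumerate R j)) else \<infinity>)"


section \<open>Almost localization\<close>

text \<open>
  If the list of resonances has no \<open>j\<close>-th entry then \<open>resonance_abs \<epsilon>0 \<alpha> \<theta> j = \<infinity>\<close> and the lower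
  bound on \<open>|k|\<close> is unsatisfiable, so that only indices of actual resonances matter.
\<close>

definition almost_localized ::
  "real \<Rightarrow> (real \<Rightarrow> (int \<Rightarrow> complex) \<Rightarrow> int \<Rightarrow> complex) \<Rightarrow> bool" where
  "almost_localized \<alpha> H \<longleftrightarrow>
     (\<exists>C0 C3 \<epsilon>0 \<epsilon>1 :: real. C0 > 0 \<and> C3 > 0 \<and> \<epsilon>0 > 0 \<and> \<epsilon>1 > 0 \<and>
       (\<forall>(\<theta>::real) (E::real) (\<phi> :: int \<Rightarrow> complex).
          (\<forall>n. H \<theta> \<phi> n = of_real E * \<phi> n) \<longrightarrow>
          \<phi> 0 = 1 \<longrightarrow>
          (\<forall>m. cmod (\<phi> m) \<le> 1 + of_int \<bar>m\<bar>) \<longrightarrow>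
          (\<forall>(j::nat) (k::int).
             ereal C0 * (1 + resonance_abs \<epsilon>0 \<alpha> \<theta> j) < ereal (of_int \<bar>k\<bar>) \<longrightarrow>
             ereal (of_int \<bar>k\<bar>) < ereal (1 / C0) * resonance_abs \<epsilon>0 \<alpha> \<theta> (Suc j) \<longrightarrow>
             cmod (\<phi> k) \<le> C3 * exp (- \<epsilon>1 * of_int \<bar>k\<bar>))))"

end

theory Submission
  imports Defs
begin

text \<open>
  Write \<open>P\<^sub>n(\<theta>)\<close> for the determinant of \<open>E - H\<close> restricted to \<open>n\<close> consecutive sites. Recentred, it is a
  polynomial of degree \<open>n\<close> in a cosine, so by Lagrange interpolation it cannot be much smaller than
  \<open>M\<^sub>n = sup |P\<^sub>n|\<close> at all of \<open>n + 1\<close> nonresonant points of an orbit of the rotation; here \<open>\<beta>(\<alpha>) = 0\<close> controls the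
  small divisors. Its leading coefficient gives \<open>M\<^sub>n \<ge> const \<cdot> \<kappa>\<^sup>n\<close> (Herman's bound) with
  \<open>\<kappa> = (1 + sqrt (1 - 4a\<^sub>1a\<^sub>3))/2\<close> for the dual coupling \<open>(a\<^sub>1, a\<^sub>2, a\<^sub>3)\<close>, whereas products of \<open>n\<close>
  consecutive off-diagonal coefficients are at most \<open>const \<cdot> e\<^bsup>b\<^sub>0n\<^esup>\<close> with \<open>b\<^sub>0 < ln \<kappa>\<close>.

  Usually one now needs the exact Lyapunov exponent, uniformly in the energy. This is avoided by the
  choice of scale: fix \<open>b\<^sub>0 < b < ln \<kappa>\<close> and let \<open>N\<close> maximize \<open>M\<^sub>n e\<^bsup>-bn\<^esup>\<close> over \<open>n \<le> |k|/10\<close>. The two bounds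
  on \<open>M\<^sub>n\<close> force \<open>N\<close> to be comparable to \<open>|k|\<close>, and \<open>M\<^sub>l \<le> M\<^sub>N e\<^bsup>-b(N-l)\<^esup>\<close> for \<open>l \<le> N\<close>, so every interval of
  length \<open>N\<close> on which \<open>P\<^sub>N\<close> is not much smaller than \<open>M\<^sub>N\<close> has an exponentially decaying Green's function.
  Take \<open>N + 1\<close> such intervals, about a quarter of them around \<open>0\<close> and the others around \<open>k\<close>. An interval
  around \<open>0\<close> with this property would contradict \<open>\<phi>(0) = 1\<close>; hence there is one around \<open>k\<close>, and \<open>\<phi>(k)\<close> is
  exponentially small. The resonance \<open>n\<^sub>j\<close> itself is avoided by placing the centres of the intervals around
  \<open>0\<close> on the appropriate side of \<open>0\<close>.
\<close>

section \<open>Distance to the integers and continued fractions\<close>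

lemma dist_int_le: "dist_int x \<le> \<bar>x - of_int m\<bar>"
  unfolding dist_int_def using infdist_le[of "of_int m :: real" \<int> x] by (simp add: dist_real_def)

lemma dist_int_attained:
  obtains m :: int where "dist_int x = \<bar>x - of_int m\<bar>"
proof -
  have "closed (\<int> :: real set)" by (rule closed_Ints)
  moreover have "(\<int> :: real set) \<noteq> {}" by auto
  ultimately obtain y where "y \<in> \<int>" "infdist x \<int> = dist x y"
    using infdist_attains_inf by metis
  then show thesis using that by (auto simp: dist_int_def dist_real_def elim!: Ints_cases)
qed

lemma dist_int_add_le: "dist_int (x + y) \<le> dist_int x + dist_int y"
proof -
  obtain m n where "dist_int x = \<bar>x - of_int m\<bar>" "dist_int y = \<bar>y - of_int n\<bar>"
    using dist_int_attained by metis
  then show ?thesis using dist_int_le[of "x + y" "m + n"] by simp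
qed

lemma dist_int_minus: "dist_int (- x) = dist_int x"
proof -
  have "dist_int (- x) \<le> dist_int x" for x
  proof -
    obtain m where "dist_int x = \<bar>x - of_int m\<bar>" using dist_int_attained by metis
    then show ?thesis using dist_int_le[of "-x" "-m"] by simp
  qed
  from this[of x] this[of "-x"] show ?thesis by simp
qed

lemma dist_int_half: "dist_int x \<le> 1 / 2"
  using dist_int_le[of x "round x"] of_int_round_abs_le[of x] by linarith

lemma dist_int_diff_le: "dist_int (x - y) \<le> dist_int x + dist_int y"
  using dist_int_add_le[of x "-y"] by (simp add: dist_int_minus)

lemma cis_2pi_int [simp]: "cis (2 * pi * of_int m) = 1"
  by (metis cis_multiple_2pi Ints_of_int mult.commute mult.assoc)

lemma norm_1_minus_cis: "cmod (1 - cis (2 * pi * x)) = 2 * \<bar>sin (pi * x)\<bar>"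
proof -
  have "(cmod (1 - cis t))\<^sup>2 = 2 - 2 * cos t" for t
  proof -
    have "(cmod (1 - cis t))\<^sup>2 = (1 - cos t)\<^sup>2 + (sin t)\<^sup>2" by (simp add: cmod_power2)
    then show ?thesis by (simp add: sin_squared_eq power2_eq_square algebra_simps)
  qed
  from this[of "2 * pi * x"] have "(cmod (1 - cis (2 * pi * x)))\<^sup>2 = 2 - 2 * cos (2 * (pi * x))"
    by (simp add: mult.assoc)
  also have "\<dots> = (2 * \<bar>sin (pi * x)\<bar>)\<^sup>2"
    by (simp only: cos_double_sin) (simp add: power_mult_distrib)
  finally show ?thesis by (rule power2_eq_imp_eq) auto
qed

text \<open>Jordan's inequality: sine is concave on [0, pi], hence lies above its chord over
  [0, pi/2], which gives sin (pi * y) \<ge> 2 * y for y in [0, 1/2].\<close>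

lemma norm_1_minus_cis_ge: "4 * dist_int x \<le> cmod (1 - cis (2 * pi * x))"
proof -
  obtain m where m: "dist_int x = \<bar>x - of_int m\<bar>" using dist_int_attained by metis
  define y where "y = \<bar>x - of_int m\<bar>"
  have y: "0 \<le> y" "y \<le> 1 / 2" using dist_int_half[of x] m by (auto simp: y_def)
  have "cis (2 * pi * x) = cis (2 * pi * (x - of_int m))"
    by (subst right_diff_distrib, subst cis_divide[symmetric]) simp
  then have "cmod (1 - cis (2 * pi * x)) = 2 * \<bar>sin (pi * (x - of_int m))\<bar>"
    by (metis norm_1_minus_cis)
  also have "\<bar>sin (pi * (x - of_int m))\<bar> = \<bar>sin (pi * y)\<bar>"
  proof (cases "x - of_int m \<ge> 0")
    case False
    then have "pi * y = - (pi * (x - of_int m))" by (simp add: y_def algebra_simps)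
    then show ?thesis by (metis abs_minus_cancel sin_minus)
  qed (simp add: y_def)
  finally have *: "cmod (1 - cis (2 * pi * x)) = 2 * \<bar>sin (pi * y)\<bar>" .
  have "convex_on {0..pi} (\<lambda>x. - sin x)"
    by (rule f''_ge0_imp_convex[where f' = "\<lambda>x. - cos x" and f'' = sin])
       (auto intro!: derivative_eq_intros sin_ge_zero)
  then have "- sin ((1 - 2 * y) *\<^sub>R 0 + (2 * y) *\<^sub>R (pi / 2)) \<le> (1 - 2 * y) * (- sin 0) + (2 * y) * (- sin (pi / 2))"
    by (rule convex_onD) (use y in auto)
  then have "2 * y \<le> sin (pi * y)" by (simp add: mult.commute)
  then show ?thesis using * m by (simp add: y_def)
qed

section \<open>Convergents of the continued fraction and best approximation\<close>

locale irrational =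
  fixes \<alpha> :: real
  assumes irrat: "\<alpha> \<notin> \<rat>"
begin

lemma cf_remainder_irrational: "cf_remainder \<alpha> n \<notin> \<rat>"
proof (induction n)
  case (Suc n)
  have "frac (cf_remainder \<alpha> n) \<notin> \<rat>"
    using Suc unfolding frac_def by (metis Rats_add Rats_of_int diff_add_cancel)
  then show ?case
    by (metis Rats_divide Rats_1 cf_remainder.simps(2) div_by_1 divide_divide_eq_right mult_1)
qed (use irrat in auto)

lemma frac_cf_remainder: "0 < frac (cf_remainder \<alpha> n)" "frac (cf_remainder \<alpha> n) < 1"
  using cf_remainder_irrational[of n] by (auto simp: frac_gt_0_iff frac_lt_1 Ints_subset_Rats[THEN subsetD])

lemma cf_digit_ge_1: "1 \<le> cf_digit \<alpha> (Suc n)"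
  using frac_cf_remainder[of n] by (simp add: cf_digit_def le_floor_iff)

lemma cf_denom_pos: "1 \<le> cf_denom \<alpha> n"
proof (induction n rule: induct_nat_012)
  case (ge2 n)
  then have "0 \<le> cf_digit \<alpha> (Suc (Suc n)) * cf_denom \<alpha> (Suc n)"
    using cf_digit_ge_1[of "Suc n"] by (intro mult_nonneg_nonneg) linarith+
  then show ?case using ge2 by simp
qed (use cf_digit_ge_1 in auto)

lemma cf_denom_Suc_Suc_ge: "cf_denom \<alpha> (Suc n) + cf_denom \<alpha> n \<le> cf_denom \<alpha> (Suc (Suc n))"
  using cf_digit_ge_1[of "Suc n"] cf_denom_pos[of "Suc n"]
  by (simp add: mult_le_cancel_right1)

lemma cf_denom_mono: "cf_denom \<alpha> n \<le> cf_denom \<alpha> (Suc n)"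
  by (cases n) (use cf_denom_pos cf_denom_Suc_Suc_ge cf_digit_ge_1 in \<open>auto simp: order.trans, smt (verit)\<close>)

lemma cf_denom_ge: "int n \<le> cf_denom \<alpha> n"
proof (induction n rule: induct_nat_012)
  case (ge2 n)
  then show ?case using cf_denom_Suc_Suc_ge[of n] cf_denom_pos[of n] by linarith
qed (use cf_digit_ge_1 in auto)

fun cf_numer :: "nat \<Rightarrow> int" where
  "cf_numer 0 = cf_digit \<alpha> 0"
| "cf_numer (Suc 0) = cf_digit \<alpha> 1 * cf_digit \<alpha> 0 + 1"
| "cf_numer (Suc (Suc n)) = cf_digit \<alpha> (Suc (Suc n)) * cf_numer (Suc n) + cf_numer n"

definition cf_error :: "nat \<Rightarrow> real" where
  "cf_error n = of_int (cf_denom \<alpha> n) * \<alpha> - of_int (cf_numer n)"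

text \<open>The errors inherit the recursion of numerators and denominators, and each complete
  quotient is, up to sign, a ratio of two consecutive errors. Alternation of signs and decrease in
  modulus are read off from this identity.\<close>

lemma cf_error_Suc: "cf_error (Suc n) = - frac (cf_remainder \<alpha> (Suc n)) * cf_error n"
proof (induction n)
  case 0
  show ?case using frac_cf_remainder[of 0]
    by (simp add: cf_error_def cf_digit_def frac_def field_simps)
next
  case (Suc n)
  have "cf_error n = - cf_remainder \<alpha> (Suc (Suc n)) * cf_error (Suc n)"
    using Suc frac_cf_remainder[of "Suc n"] by (simp add: field_simps)
  moreover have "cf_error (Suc (Suc n)) = of_int (cf_digit \<alpha> (Suc (Suc n))) * cf_error (Suc n) + cf_error n"
    by (simp add: cf_error_def algebra_simps)
  ultimately show ?case
    by (simp add: cf_digit_def frac_def algebra_simps)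
qed

lemma abs_cf_error_mono: "\<bar>cf_error (Suc n)\<bar> \<le> \<bar>cf_error n\<bar>"
  using frac_cf_remainder[of "Suc n"] by (simp add: cf_error_Suc abs_mult mult_left_le_one_le)

lemma cf_error_alternating: "cf_error n * cf_error (Suc n) \<le> 0"
  using frac_cf_remainder[of "Suc n"] zero_le_square[of "cf_error n"]
  by (simp add: cf_error_Suc mult.left_commute[of "cf_error n"] mult_nonneg_nonneg)

lemma cf_determinant:
  "cf_denom \<alpha> (Suc n) * cf_numer n - cf_denom \<alpha> n * cf_numer (Suc n) = (- 1) ^ Suc n"
proof (induction n)
  case (Suc n)
  have "cf_denom \<alpha> (Suc (Suc n)) * cf_numer (Suc n) - cf_denom \<alpha> (Suc n) * cf_numer (Suc (Suc n))
     = - (cf_denom \<alpha> (Suc n) * cf_numer n - cf_denom \<alpha> n * cf_numer (Suc n))"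
    by (simp add: algebra_simps)
  then show ?case using Suc by simp
qed (simp add: algebra_simps)

text \<open>By the determinant identity, q_n e_(n+1) - q_(n+1) e_n is 1 or -1, where e denotes the
  errors. Since denominators increase and errors decrease in modulus, the second product carries at
  least half of this.\<close>

lemma cf_error_ge: "1 / (2 * of_int (cf_denom \<alpha> (Suc n))) \<le> \<bar>cf_error n\<bar>"
proof -
  let ?q = "\<lambda>n. real_of_int (cf_denom \<alpha> n)"
  have "?q n * cf_error (Suc n) - ?q (Suc n) * cf_error n
      = of_int (cf_denom \<alpha> (Suc n) * cf_numer n - cf_denom \<alpha> n * cf_numer (Suc n))"
    by (simp add: cf_error_def algebra_simps)
  then have "1 = \<bar>?q n * cf_error (Suc n) - ?q (Suc n) * cf_error n\<bar>"
    by (simp add: cf_determinant)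
  also have "\<dots> \<le> ?q n * \<bar>cf_error (Suc n)\<bar> + ?q (Suc n) * \<bar>cf_error n\<bar>"
    using cf_denom_pos[of n] cf_denom_pos[of "Suc n"]
    by (intro order.trans[OF abs_triangle_ineq4]) (simp add: abs_mult)
  also have "\<dots> \<le> ?q (Suc n) * \<bar>cf_error n\<bar> + ?q (Suc n) * \<bar>cf_error n\<bar>"
    using cf_denom_pos[of n] cf_denom_mono[of n] abs_cf_error_mono[of n]
    by (intro add_mono mult_mono) auto
  finally show ?thesis using cf_denom_pos[of "Suc n"] by (simp add: field_simps)
qed

text \<open>Best approximation: in the basis of two consecutive convergents the coordinates of an index
  below \<open>q\<^bsub>n+1\<^esub>\<close> have opposite signs, so the two alternating errors add up in modulus.\<close>

lemma dist_int_ge_cf_error: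
  fixes i :: int
  assumes i: "0 < i" "i < cf_denom \<alpha> (Suc n)"
  shows "\<bar>cf_error n\<bar> \<le> dist_int (of_int i * \<alpha>)"
proof -
  obtain j where j: "dist_int (of_int i * \<alpha>) = \<bar>of_int i * \<alpha> - of_int j\<bar>"
    using dist_int_attained by metis
  let ?q = "cf_denom \<alpha>" and ?p = cf_numer
  define s :: int where "s = (- 1) ^ Suc n"
  have s: "s * s = 1" by (simp add: s_def flip: power_mult_distrib)
  define u where "u = s * (?q (Suc n) * j - ?p (Suc n) * i)"
  define v where "v = s * (?p n * i - ?q n * j)"
  have det: "?q (Suc n) * ?p n - ?q n * ?p (Suc n) = s" by (simp add: cf_determinant s_def)
  have "u * ?q n + v * ?q (Suc n) = s * (?q (Suc n) * ?p n - ?q n * ?p (Suc n)) * i"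
    by (simp add: u_def v_def algebra_simps)
  then have iq: "i = u * ?q n + v * ?q (Suc n)" using s det by simp
  have "u * ?p n + v * ?p (Suc n) = s * (?q (Suc n) * ?p n - ?q n * ?p (Suc n)) * j"
    by (simp add: u_def v_def algebra_simps)
  then have jp: "j = u * ?p n + v * ?p (Suc n)" using s det by simp
  have q1: "1 \<le> ?q n" "1 \<le> ?q (Suc n)" using cf_denom_pos by auto
  have u0: "u \<noteq> 0"
  proof
    assume "u = 0"
    then have "i = v * ?q (Suc n)" using iq by simp
    moreover from this have "0 < v" using i q1 by (simp add: zero_less_mult_iff)
    then have "?q (Suc n) \<le> v * ?q (Suc n)" using q1 by (simp add: mult_le_cancel_right1)
    ultimately show False using i by simp
  qed
  have uv: "u * v \<le> 0"
  proof (rule ccontr)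
    assume "\<not> u * v \<le> 0"
    then consider "u > 0" "v > 0" | "u < 0" "v < 0" by (auto simp: not_le zero_less_mult_iff)
    then show False
    proof cases
      case 1
      then have "?q (Suc n) \<le> v * ?q (Suc n)" "0 \<le> u * ?q n" using q1
        by (simp_all add: mult_le_cancel_right1)
      then show False using iq i by linarith
    next
      case 2
      then have "u * ?q n \<le> 0" "v * ?q (Suc n) \<le> 0" using q1 by (simp_all add: mult_le_0_iff)
      then show False using iq i by linarith
    qed
  qed
  let ?X = "of_int u * cf_error n" and ?Y = "of_int v * cf_error (Suc n)"
  have eq: "of_int i * \<alpha> - of_int j = ?X + ?Y"
    by (subst iq, subst jp) (simp add: cf_error_def algebra_simps)
  have "?X * ?Y = of_int (u * v) * (cf_error n * cf_error (Suc n))" by simp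
  also have "\<dots> \<ge> 0" using uv cf_error_alternating[of n]
    by (intro mult_nonpos_nonpos) (auto simp del: of_int_mult)
  finally have "\<bar>?X + ?Y\<bar> \<ge> \<bar>?X\<bar>" by (auto simp: zero_le_mult_iff)
  moreover have "1 \<le> \<bar>real_of_int u\<bar>" using u0 by linarith
  then have "\<bar>cf_error n\<bar> \<le> \<bar>?X\<bar>"
    by (simp add: abs_mult mult_le_cancel_right1)
  ultimately show ?thesis using j eq by simp
qed

lemma dist_int_ge:
  fixes i :: int
  assumes "0 < i" "i < cf_denom \<alpha> (Suc n)"
  shows "1 / (2 * of_int (cf_denom \<alpha> (Suc n))) \<le> dist_int (of_int i * \<alpha>)"
  using dist_int_ge_cf_error[OF assms] cf_error_ge[of n] by linarith

end

section \<open>Small divisors when the exponent vanishes\<close>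

locale zero_beta = irrational +
  assumes beta0: "beta_exponent \<alpha> = 0"
begin

lemma cf_denom_growth:
  assumes "0 < \<epsilon>"
  shows "\<forall>\<^sub>F n in sequentially. real_of_int (cf_denom \<alpha> (Suc n)) < exp (\<epsilon> * real_of_int (cf_denom \<alpha> n))"
proof -
  have "limsup (\<lambda>n. ereal (ln (real_of_int (cf_denom \<alpha> (Suc n))) / real_of_int (cf_denom \<alpha> n))) < ereal \<epsilon>"
    using beta0 assms by (simp add: beta_exponent_def)
  then have "\<forall>\<^sub>F n in sequentially. ereal (ln (real_of_int (cf_denom \<alpha> (Suc n))) / real_of_int (cf_denom \<alpha> n)) < ereal \<epsilon>"
    by (rule Limsup_lessD)
  then show ?thesis
  proof eventually_elim
    case (elim n)
    have q: "0 < real_of_int (cf_denom \<alpha> n)" "0 < real_of_int (cf_denom \<alpha> (Suc n))"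
      using cf_denom_pos[of n] cf_denom_pos[of "Suc n"] by linarith+
    then have "ln (real_of_int (cf_denom \<alpha> (Suc n))) < \<epsilon> * real_of_int (cf_denom \<alpha> n)"
      using elim by (simp add: field_simps)
    then show ?case using q by (metis exp_less_mono exp_ln)
  qed
qed

text \<open>Take for \<open>q\<close> the largest denominator not exceeding \<open>n\<close>. Best
  approximation below it gives the separation 1/(2q). The next denominator exceeds \<open>n\<close>
  but is smaller than exp (\<epsilon> q / 2), which bounds all divisors up to \<open>n\<close> from
  below. \<open>Q\<close> allows \<open>q\<close> to be forced large.\<close>

lemma separated_scale:
  assumes "0 < \<epsilon>"
  obtains N :: nat where
    "\<And>n. N \<le> n \<Longrightarrow> \<exists>q. Q \<le> q \<and> 1 \<le> q \<and> q \<le> n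
       \<and> (\<forall>i. 0 < i \<and> i < q \<longrightarrow> 1 / (2 * real q) \<le> dist_int (real i * \<alpha>))
       \<and> (\<forall>i. 0 < i \<and> i \<le> n \<longrightarrow> exp (- \<epsilon> * real q) \<le> dist_int (real i * \<alpha>))"
proof -
  let ?q = "cf_denom \<alpha>"
  have "\<forall>\<^sub>F n in sequentially. real_of_int (?q (Suc n)) < exp ((\<epsilon> / 2) * real_of_int (?q n))"
    using assms by (intro cf_denom_growth) auto
  then obtain m0 where m0: "\<And>m. m0 \<le> m \<Longrightarrow> real_of_int (?q (Suc m)) < exp ((\<epsilon> / 2) * real_of_int (?q m))"
    by (auto simp: eventually_sequentially)
  \<comment> \<open>From \<open>m1\<close> on, the half of \<epsilon> held back in \<open>m0\<close>
    pays for the factor 2 in 1/(2q).\<close>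
  obtain m1 where m1: "real m1 \<ge> 2 * ln 2 / \<epsilon>" using real_arch_simple by blast
  define M where "M = Suc (m0 + m1 + Q)"
  show thesis
  proof (rule that[of "nat (?q M)"])
    fix n assume n: "nat (?q M) \<le> n"
    define m where "m = (GREATEST m. ?q m \<le> int n)"
    have bound: "\<forall>m. ?q m \<le> int n \<longrightarrow> m \<le> n" using cf_denom_ge by (meson of_nat_le_iff order_trans)
    have qM: "?q M \<le> int n" using n by simp
    have qm: "?q m \<le> int n" unfolding m_def by (rule GreatestI_nat[where P = "\<lambda>m. ?q m \<le> int n"]) (use qM bound in auto)
    have Mm: "M \<le> m" unfolding m_def by (rule Greatest_le_nat[where P = "\<lambda>m. ?q m \<le> int n"]) (use qM bound in auto)
    have "\<not> ?q (Suc m) \<le> int n"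
    proof
      assume "?q (Suc m) \<le> int n"
      then have "Suc m \<le> m" unfolding m_def
        by (rule Greatest_le_nat[where P = "\<lambda>m. ?q m \<le> int n"]) (use bound in auto)
      then show False by simp
    qed
    then have qSm: "int n < ?q (Suc m)" by simp
    \<comment> \<open>The separation below \<open>?q m\<close> comes from the convergent of index m
      - 1, so \<open>m\<close> has to be positive; this is why \<open>M\<close> is a
      successor.\<close>
    obtain m' where m': "m = Suc m'" using Mm M_def by (cases m) auto
    define q where "q = nat (?q m)"
    have qq: "int q = ?q m" using cf_denom_pos[of m] by (simp add: q_def)
    then have qr: "real_of_int (?q m) = real q" by (metis of_int_of_nat_eq)
    have "int M \<le> int q" using Mm cf_denom_ge[of m] qq by linarith
    then have Mq: "M \<le> q" by simp
    have big: "2 * exp ((\<epsilon> / 2) * real q) \<le> exp (\<epsilon> * real q)"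
    proof -
      have "2 * ln 2 / \<epsilon> \<le> real q" using Mq m1 by (simp add: M_def)
      then have "ln 2 \<le> \<epsilon> / 2 * real q" using assms by (simp add: field_simps)
      then have "2 \<le> exp (\<epsilon> / 2 * real q)" by (metis exp_le_cancel_iff exp_ln zero_less_numeral)
      then have "2 * exp ((\<epsilon> / 2) * real q) \<le> exp (\<epsilon> / 2 * real q) * exp (\<epsilon> / 2 * real q)" by simp
      then show ?thesis by (simp flip: exp_add)
    qed
    show "\<exists>q. Q \<le> q \<and> 1 \<le> q \<and> q \<le> n
       \<and> (\<forall>i. 0 < i \<and> i < q \<longrightarrow> 1 / (2 * real q) \<le> dist_int (real i * \<alpha>))
       \<and> (\<forall>i. 0 < i \<and> i \<le> n \<longrightarrow> exp (- \<epsilon> * real q) \<le> dist_int (real i * \<alpha>))"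
    proof (intro exI[of _ q] conjI allI impI; (elim conjE)?)
      show "Q \<le> q" "1 \<le> q" "q \<le> n" using Mq qq qm by (auto simp: M_def)
      show "1 / (2 * real q) \<le> dist_int (real i * \<alpha>)" if "0 < i" "i < q" for i
        using dist_int_ge[of "int i" m'] that qq qr unfolding m' by simp
      show "exp (- \<epsilon> * real q) \<le> dist_int (real i * \<alpha>)" if "0 < i" "i \<le> n" for i
      proof -
        have "1 / (2 * real_of_int (?q (Suc m))) \<le> dist_int (real i * \<alpha>)"
          using dist_int_ge[of "int i" m] that qSm by simp
        moreover have "2 * real_of_int (?q (Suc m)) \<le> exp (\<epsilon> * real q)"
          using m0[of m] Mm big qr by (simp add: M_def)
        then have "exp (- \<epsilon> * real q) \<le> 1 / (2 * real_of_int (?q (Suc m)))"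
          using cf_denom_pos[of "Suc m"] by (simp add: exp_minus field_simps)
        ultimately show ?thesis by linarith
      qed
    qed
  qed
qed

text \<open>At the scale \<open>max N i\<close> one has q \<le> N + i; the part due to
  \<open>N\<close> goes into the constant.\<close>

lemma subexponential_diophantine:
  assumes "0 < \<epsilon>"
  obtains c where "0 < c" "c \<le> 1" "\<And>i :: int. i \<noteq> 0 \<Longrightarrow> c * exp (- \<epsilon> * \<bar>of_int i\<bar>) \<le> dist_int (of_int i * \<alpha>)"
proof -
  obtain N where N: "\<And>n. N \<le> n \<Longrightarrow> \<exists>q. 0 \<le> q \<and> 1 \<le> q \<and> q \<le> n
       \<and> (\<forall>i. 0 < i \<and> i < q \<longrightarrow> 1 / (2 * real q) \<le> dist_int (real i * \<alpha>))
       \<and> (\<forall>i. 0 < i \<and> i \<le> n \<longrightarrow> exp (- \<epsilon> * real q) \<le> dist_int (real i * \<alpha>))"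
    using separated_scale[OF assms, of 0] by metis
  have nat: "exp (- \<epsilon> * real N) * exp (- \<epsilon> * real i) \<le> dist_int (real i * \<alpha>)" if i: "0 < i" for i :: nat
  proof -
    obtain q where q: "q \<le> max N i" "exp (- \<epsilon> * real q) \<le> dist_int (real i * \<alpha>)"
      using N[of "max N i"] i by (meson max.cobounded1 max.cobounded2)
    have "exp (- \<epsilon> * real N) * exp (- \<epsilon> * real i) \<le> exp (- \<epsilon> * real q)"
    proof -
      have "real q \<le> real N + real i" using q(1) by (simp add: max_def split: if_splits)
      then have "\<epsilon> * real q \<le> \<epsilon> * (real N + real i)" using assms by (intro mult_left_mono) auto
      then show ?thesis by (simp add: algebra_simps flip: exp_add)
    qed
    then show ?thesis using q by linarith
  qed
  show thesis
  proof (rule that[of "exp (- \<epsilon> * real N)"])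
    show "exp (- \<epsilon> * real N) * exp (- \<epsilon> * \<bar>of_int i\<bar>) \<le> dist_int (of_int i * \<alpha>)" if "i \<noteq> 0" for i :: int
    proof (cases "i > 0")
      case True
      then show ?thesis using nat[of "nat i"] by simp
    next
      case False
      then have "dist_int (of_int i * \<alpha>) = dist_int (real (nat (- i)) * \<alpha>)"
        using dist_int_minus[of "of_int i * \<alpha>"] by simp
      then show ?thesis using nat[of "nat (- i)"] that False by simp
    qed
  qed (use assms in auto)
qed

end

section \<open>Products over orbits of the rotation\<close>

lemma norm_1_minus_sq: "(cmod (1 - u))\<^sup>2 = 1 - 2 * Re u + (cmod u)\<^sup>2"
  by (simp only: cmod_power2) (simp add: power2_eq_square algebra_simps)

text \<open>The difference of the two sides is (1 - r) (1 - r |u|^2). A factor 1 - u with |u| = 1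
  can thus be replaced by one bounded away from 0, at the cost of 1 / sqrt r.\<close>

lemma norm_1_minus_le_scaled:
  assumes "cmod u \<le> 1" "0 < r" "r \<le> 1"
  shows "r * (cmod (1 - u))\<^sup>2 \<le> (cmod (1 - of_real r * u))\<^sup>2"
proof -
  have "(cmod u)\<^sup>2 \<le> 1" using assms by (simp add: power_le_one)
  then have "r * (cmod u)\<^sup>2 \<le> 1" using assms by (simp add: mult_le_one)
  then have "0 \<le> (1 - r) * (1 - r * (cmod u)\<^sup>2)" using assms by (intro mult_nonneg_nonneg) auto
  also have "\<dots> = (cmod (1 - of_real r * u))\<^sup>2 - r * (cmod (1 - u))\<^sup>2"
    by (simp add: norm_1_minus_sq norm_mult power_mult_distrib) (simp add: power2_eq_square algebra_simps)
  finally show ?thesis by simp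
qed

lemma norm_1_minus_scaled_cis_sq:
  "(cmod (1 - of_real r * cis t))\<^sup>2 = (1 - r)\<^sup>2 + r * (cmod (1 - cis t))\<^sup>2"
  by (simp add: norm_1_minus_sq norm_mult) (simp add: power2_eq_square algebra_simps)

context irrational
begin

lemma dist_int_multiple_pos:
  assumes "k \<noteq> 0"
  shows "0 < dist_int (of_int k * \<alpha>)"
proof -
  obtain m where m: "dist_int (of_int k * \<alpha>) = \<bar>of_int k * \<alpha> - of_int m\<bar>"
    using dist_int_attained by metis
  have "of_int k * \<alpha> - of_int m \<noteq> 0"
  proof
    assume "of_int k * \<alpha> - of_int m = 0"
    then have "\<alpha> = of_int m / of_int k" using assms by (simp add: field_simps)
    then show False using irrat by (metis Rats_divide Rats_of_int)
  qed
  then show ?thesis using m by simp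
qed

text \<open>Expand ln |1 - u| in powers of u; there is no constant term. Each mode k > 0 sums along
  the orbit to a geometric sum, bounded uniformly in \<open>n\<close> and \<open>x\<close> because k
  * \<alpha> is not an integer. The modes from \<open>K\<close> on contribute at most \<eta> per
  point.\<close>

lemma sum_ln_norm_1_minus_bound:
  fixes w :: complex
  assumes w: "cmod w < 1" and "0 < \<eta>"
  obtains C where "0 \<le> C"
    "\<And>n x. \<bar>\<Sum>j<n. ln (cmod (1 - w * cis (2 * pi * (x + real j * \<alpha>))))\<bar> \<le> \<eta> * real n + C"
proof -
  define \<rho> where "\<rho> = cmod w"
  have \<rho>: "0 \<le> \<rho>" "\<rho> < 1" using w by (auto simp: \<rho>_def)
  define z where "z k = cis (2 * pi * (real k * \<alpha>))" for k
  have "(\<lambda>K. \<rho> ^ K / (1 - \<rho>)) \<longlonglongrightarrow> 0 / (1 - \<rho>)"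
    by (intro tendsto_intros LIMSEQ_realpow_zero) (use \<rho> in auto)
  then have "\<forall>\<^sub>F K in sequentially. \<rho> ^ K / (1 - \<rho>) < \<eta>"
    using assms by (intro order_tendstoD) auto
  then obtain K where K: "\<rho> ^ K / (1 - \<rho>) < \<eta>" by (auto simp: eventually_sequentially)
  define B where "B k = (if k = 0 then 0 else 2 / cmod (1 - z k))" for k
  show thesis
  proof (rule that[of "\<Sum>k<K. B k"])
    show "0 \<le> (\<Sum>k<K. B k)" by (intro sum_nonneg) (auto simp: B_def)
    fix n x
    define u where "u j = w * cis (2 * pi * (x + real j * \<alpha>))" for j :: nat
    have nu: "cmod (u j) = \<rho>" for j by (simp add: u_def norm_mult \<rho>_def)
    \<comment> \<open>The term k = 0 is 0, as division by zero yields 0; this agrees with the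
      convention in \<open>Ln_series'\<close>.\<close>
    define a where "a k = (\<Sum>j<n. - Re (u j ^ k) / real k)" for k
    have "(\<lambda>k. Re (- ((- (- u j)) ^ k) / of_nat k)) sums Re (ln (1 + - u j))" for j
      by (intro sums_Re Ln_series') (use nu \<rho> in simp)
    then have "(\<lambda>k. - Re (u j ^ k) / real k) sums ln (cmod (1 - u j))" for j
    proof -
      have "1 - u j \<noteq> 0" using nu[of j] \<rho> by (metis eq_iff_diff_eq_0 norm_one less_irrefl)
      then show ?thesis using \<open>\<And>j. (\<lambda>k. Re (- ((- (- u j)) ^ k) / of_nat k)) sums Re (ln (1 + - u j))\<close>[of j]
        by (simp add: Re_divide_of_nat)
    qed
    then have sums: "a sums (\<Sum>j<n. ln (cmod (1 - u j)))"
      unfolding a_def by (intro sums_sum)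
    have a_le: "\<bar>a k\<bar> \<le> real n * \<rho> ^ k" for k
    proof -
      have "\<bar>a k\<bar> \<le> (\<Sum>j<n. \<bar>- Re (u j ^ k) / real k\<bar>)" unfolding a_def by (rule sum_abs)
      also have "\<dots> \<le> (\<Sum>j<n. \<rho> ^ k)"
      proof (intro sum_mono)
        fix j
        have "\<bar>Re (u j ^ k)\<bar> \<le> \<rho> ^ k" using abs_Re_le_cmod[of "u j ^ k"] nu by (simp add: norm_power)
        then show "\<bar>- Re (u j ^ k) / real k\<bar> \<le> \<rho> ^ k"
        proof (cases "k = 0")
          case False
          then have "\<bar>Re (u j ^ k)\<bar> / real k \<le> \<bar>Re (u j ^ k)\<bar> / 1" by (intro divide_left_mono) auto
          then show ?thesis using \<open>\<bar>Re (u j ^ k)\<bar> \<le> \<rho> ^ k\<close> by simp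
        qed (use \<rho> in simp)
      qed
      finally show ?thesis by simp
    qed
    have a_B: "\<bar>a k\<bar> \<le> B k" for k
    proof (cases "k = 0")
      case False
      have "0 < dist_int (of_int (int k) * \<alpha>)" using False by (intro dist_int_multiple_pos) auto
      then have pos: "0 < cmod (1 - z k)"
        using norm_1_minus_cis_ge[of "real k * \<alpha>"] unfolding z_def of_int_of_nat_eq by linarith
      have "cis (2 * pi * (x + real j * \<alpha>)) ^ k = cis (2 * pi * (real k * x)) * z k ^ j" for j
      proof -
        have "real k * (2 * pi * (x + real j * \<alpha>)) = 2 * pi * (real k * x) + real j * (2 * pi * (real k * \<alpha>))"
          by (simp add: algebra_simps)
        then show ?thesis by (simp only: z_def Complex.DeMoivre cis_mult)
      qed
      then have "u j ^ k = w ^ k * cis (2 * pi * (real k * x)) * z k ^ j" for j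
        by (simp only: u_def power_mult_distrib mult.assoc)
      then have "(\<Sum>j<n. u j ^ k) = w ^ k * cis (2 * pi * (real k * x)) * (\<Sum>j<n. z k ^ j)"
        by (simp add: sum_distrib_left)
      then have "cmod (\<Sum>j<n. u j ^ k) = \<rho> ^ k * cmod (\<Sum>j<n. z k ^ j)"
        by (simp add: norm_mult norm_power \<rho>_def)
      also have "\<dots> \<le> 1 * cmod (\<Sum>j<n. z k ^ j)"
        using \<rho> by (intro mult_right_mono power_le_one) auto
      also have "(\<Sum>j<n. z k ^ j) = (1 - z k ^ n) / (1 - z k)"
        using pos by (subst sum_gp_strict) auto
      also have "1 * cmod \<dots> \<le> 2 / cmod (1 - z k)"
      proof -
        have "cmod (1 - z k ^ n) \<le> 2"
          using norm_triangle_ineq4[of 1 "z k ^ n"] by (simp add: norm_power z_def)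
        then show ?thesis using pos by (simp add: norm_divide divide_right_mono)
      qed
      finally have le: "cmod (\<Sum>j<n. u j ^ k) \<le> B k" using False by (simp add: B_def)
      have "a k = - Re (\<Sum>j<n. u j ^ k) / real k"
        by (simp add: a_def sum_negf sum_divide_distrib)
      then have "\<bar>a k\<bar> = \<bar>Re (\<Sum>j<n. u j ^ k)\<bar> / real k" by simp
      also have "\<dots> \<le> \<bar>Re (\<Sum>j<n. u j ^ k)\<bar> / 1" using False by (intro divide_left_mono) auto
      also have "\<dots> \<le> B k" using le abs_Re_le_cmod[of "\<Sum>j<n. u j ^ k"] by simp
      finally show ?thesis .
    qed (simp add: a_def B_def)
    have geo: "summable (\<lambda>k. real n * \<rho> ^ k)" using \<rho> by (intro summable_mult summable_geometric) auto
    have summ: "summable (\<lambda>k. \<bar>a k\<bar>)"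
      by (rule summable_comparison_test'[OF geo, of 0]) (use a_le in auto)
    have "\<bar>\<Sum>j<n. ln (cmod (1 - u j))\<bar> = \<bar>\<Sum>k. a k\<bar>" using sums by (simp add: sums_iff)
    also have "\<dots> \<le> (\<Sum>k. \<bar>a k\<bar>)" using summ by (rule summable_rabs)
    also have "\<dots> = (\<Sum>k. \<bar>a (k + K)\<bar>) + (\<Sum>k<K. \<bar>a k\<bar>)" using summ by (rule suminf_split_initial_segment)
    also have "\<dots> \<le> real n * \<eta> + (\<Sum>k<K. B k)"
    proof (intro add_mono sum_mono a_B)
      have "(\<Sum>k. \<bar>a (k + K)\<bar>) \<le> (\<Sum>k. real n * \<rho> ^ K * \<rho> ^ k)"
        using a_le summ \<rho> by (intro suminf_le summable_mult summable_geometric)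
          (auto simp: power_add mult_ac summable_iff_shift[of "\<lambda>k. \<bar>a k\<bar>"] simp flip: power_add)
      also have "\<dots> = real n * (\<rho> ^ K / (1 - \<rho>))"
        using \<rho> by (simp add: suminf_mult suminf_geometric)
      also have "\<dots> \<le> real n * \<eta>" using K by (intro mult_left_mono) auto
      finally show "(\<Sum>k. \<bar>a (k + K)\<bar>) \<le> real n * \<eta>" .
    qed
    finally show "\<bar>\<Sum>j<n. ln (cmod (1 - w * cis (2 * pi * (x + real j * \<alpha>))))\<bar> \<le> \<eta> * real n + (\<Sum>k<K. B k)"
      by (simp add: u_def mult.commute)
  qed
qed

text \<open>If |w| = 1 the logarithm is singular. Shrinking \<open>w\<close> by r = exp (- \<eta>)
  costs exp (\<eta> / 2) per factor, and the other half of \<eta> is spent on the shrunken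
  product.\<close>

lemma prod_norm_1_minus_le:
  fixes w :: complex
  assumes w: "cmod w \<le> 1" and "0 < \<eta>"
  obtains C where "1 \<le> C"
    "\<And>n x. (\<Prod>j<n. cmod (1 - w * cis (2 * pi * (x + real j * \<alpha>)))) \<le> C * exp (\<eta> * real n)"
proof -
  define r where "r = exp (- \<eta>)"
  have r: "0 < r" "r < 1" using assms by (auto simp: r_def)
  have "cmod (of_real r * w) < 1"
    using r w by (simp add: norm_mult) (smt (verit) mult_left_le norm_ge_zero)
  then obtain C where C: "0 \<le> C"
    "\<And>n x. \<bar>\<Sum>j<n. ln (cmod (1 - of_real r * w * cis (2 * pi * (x + real j * \<alpha>))))\<bar> \<le> \<eta> / 2 * real n + C"
    by (rule sum_ln_norm_1_minus_bound[of "of_real r * w" "\<eta> / 2"]) (use assms in auto)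
  show thesis
  proof (rule that[of "exp C"])
    show "1 \<le> exp C" using C by simp
    fix n x
    define u where "u j = w * cis (2 * pi * (x + real j * \<alpha>))" for j :: nat
    have nu: "cmod (u j) \<le> 1" for j using w by (simp add: u_def norm_mult)
    have pos: "0 < cmod (1 - of_real r * u j)" for j
    proof -
      have "cmod (of_real r * u j) < 1"
        using r nu[of j] by (simp add: norm_mult) (smt (verit) mult_left_le norm_ge_zero)
      then show ?thesis by auto
    qed
    have le: "cmod (1 - u j) \<le> exp (\<eta> / 2) * cmod (1 - of_real r * u j)" for j
    proof (rule power2_le_imp_le)
      have "(cmod (1 - u j))\<^sup>2 = exp \<eta> * (r * (cmod (1 - u j))\<^sup>2)" by (simp add: r_def flip: exp_add)
      also have "\<dots> \<le> exp \<eta> * (cmod (1 - of_real r * u j))\<^sup>2"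
        using norm_1_minus_le_scaled[OF nu, of r] r by (intro mult_left_mono) auto
      also have "\<dots> = (exp (\<eta> / 2) * cmod (1 - of_real r * u j))\<^sup>2"
        by (simp add: power_mult_distrib flip: exp_double)
      finally show "(cmod (1 - u j))\<^sup>2 \<le> (exp (\<eta> / 2) * cmod (1 - of_real r * u j))\<^sup>2" .
    qed auto
    have "(\<Prod>j<n. cmod (1 - u j)) \<le> (\<Prod>j<n. exp (\<eta> / 2) * cmod (1 - of_real r * u j))"
      by (intro prod_mono) (use le in auto)
    also have "\<dots> = exp (\<eta> / 2 * real n) * exp (\<Sum>j<n. ln (cmod (1 - of_real r * u j)))"
      using pos by (simp add: prod.distrib exp_sum mult.commute flip: exp_of_nat_mult)
    also have "\<dots> \<le> exp (\<eta> / 2 * real n) * exp (\<eta> / 2 * real n + C)"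
    proof -
      have "(\<Sum>j<n. ln (cmod (1 - of_real r * u j))) \<le> \<eta> / 2 * real n + C"
        using C(2)[of x n] by (simp add: u_def mult.assoc)
      then show ?thesis by simp
    qed
    also have "\<dots> = exp C * exp (\<eta> * real n)" by (simp flip: exp_add)
    finally show "(\<Prod>j<n. cmod (1 - w * cis (2 * pi * (x + real j * \<alpha>)))) \<le> exp C * exp (\<eta> * real n)"
      by (simp add: u_def)
  qed
qed

end

section \<open>Lower bounds for products over the orbit\<close>

lemma sum_inverse_sqrt_le: "(\<Sum>k=1..n. 1 / sqrt (real k)) \<le> 2 * sqrt (real n)"
proof (induction n)
  case (Suc n)
  have "1 \<le> sqrt (real (Suc n)) * (2 * sqrt (real (Suc n)) - 2 * sqrt (real n))"
  proof -
    have "2 * (sqrt (real (Suc n)) * sqrt (real n)) \<le> (sqrt (real (Suc n)))\<^sup>2 + (sqrt (real n))\<^sup>2"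
      using sum_squares_bound[of "sqrt (real (Suc n))" "sqrt (real n)"] by (simp add: mult.assoc)
    then show ?thesis by (simp add: algebra_simps)
  qed
  then have "1 / sqrt (real (Suc n)) \<le> 2 * sqrt (real (Suc n)) - 2 * sqrt (real n)"
    by (simp add: divide_le_eq mult.commute)
  then show ?case using Suc by simp
qed simp

text \<open>The square root is chosen for summation: for v of size \<tau> q / k, the sum of sqrt v
  over k \<le> q is of order sqrt \<tau> * q, whereas a bound linear in v would lose a
  logarithm.\<close>

lemma ln_1_plus_sq_le:
  assumes "0 \<le> v"
  shows "ln (1 + v\<^sup>2) \<le> 4 * sqrt (v::real)"
proof -
  have "v = sqrt v ^ 2" using assms by simp
  then have "v\<^sup>2 = sqrt v ^ 4" by (metis mult_2 numeral_Bit0 power_add power2_eq_square)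
  moreover have "1 + sqrt v ^ 4 \<le> (1 + sqrt v) ^ 4" using assms
    by (simp add: power_numeral_reduce algebra_simps)
  ultimately have "1 + v\<^sup>2 \<le> (1 + sqrt v) ^ 4" by simp
  also have "\<dots> \<le> exp (sqrt v) ^ 4" using assms by (intro power_mono exp_ge_add_one_self) auto
  also have "\<dots> = exp (4 * sqrt v)" by (simp flip: exp_of_nat_mult)
  finally have "ln (1 + v\<^sup>2) \<le> ln (exp (4 * sqrt v))"
    by (subst ln_le_cancel_iff) (auto intro: add_pos_nonneg)
  then show ?thesis by simp
qed

text \<open>Points at mutual distance at least \<open>1/(2q)\<close> occupy different cells of length \<open>1/(2q)\<close>;
  the two cells adjacent to \<open>0\<close> contain the points for which the summand may be large.\<close>

lemma separated_points:
  fixes x :: "'a \<Rightarrow> real"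
  assumes "finite T" "1 \<le> q" "0 \<le> \<tau>"
    and sep: "\<And>s t. s \<in> T \<Longrightarrow> t \<in> T \<Longrightarrow> s \<noteq> t \<Longrightarrow> 1 / (2 * real q) \<le> dist_int (x s - x t)"
  shows "card {t \<in> T. dist_int (x t) < 1 / (2 * real q)} \<le> 2"
    and "(\<Sum>t\<in>{t \<in> T. 1 / (2 * real q) \<le> dist_int (x t)}. 2 * sqrt (\<tau> / dist_int (x t))) \<le> 16 * sqrt \<tau> * real q"
proof -
  define y where "y t = x t - of_int (round (x t))" for t
  have q: "0 < real q" using assms by simp
  have y_half: "\<bar>y t\<bar> \<le> 1 / 2" for t
    using of_int_round_abs_le[of "x t"] by (simp add: y_def abs_minus_commute)
  have dy: "dist_int (x t) = \<bar>y t\<bar>" for t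
  proof -
    obtain m where m: "dist_int (x t) = \<bar>x t - of_int m\<bar>" using dist_int_attained by metis
    moreover have "\<bar>x t - of_int (round (x t))\<bar> \<le> \<bar>x t - of_int m\<bar>"
      using round_diff_minimal[of "x t" m] by simp
    ultimately show ?thesis using dist_int_le[of "x t" "round (x t)"] by (simp add: y_def)
  qed
  have ysep: "1 / (2 * real q) \<le> \<bar>y s - y t\<bar>" if "s \<in> T" "t \<in> T" "s \<noteq> t" for s t
    using sep[OF that] dist_int_le[of "x s - x t" "round (x s) - round (x t)"]
    by (simp add: y_def algebra_simps)
  define k where "k t = \<lfloor>2 * real q * y t\<rfloor>" for t
  have k_bounds: "of_int (k t) \<le> 2 * real q * y t" "2 * real q * y t < of_int (k t) + 1" for t
    by (auto simp: k_def)
  have inj: "inj_on k T"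
  proof (rule inj_onI, rule ccontr)
    fix s t assume st: "s \<in> T" "t \<in> T" "k s = k t" "s \<noteq> t"
    then have "\<bar>2 * real q * y s - 2 * real q * y t\<bar> < 1" using k_bounds[of s] k_bounds[of t] by linarith
    then have "2 * real q * \<bar>y s - y t\<bar> < 1" using q by (simp add: abs_mult flip: right_diff_distrib)
    then show False using ysep[of s t] st q by (simp add: field_simps)
  qed
  have k_range: "\<bar>k t\<bar> \<le> int q" for t
  proof -
    have "\<bar>2 * real q * y t\<bar> \<le> real q" using y_half[of t] q by (simp add: abs_mult)
    then show ?thesis using k_bounds[of t] by linarith
  qed
  let ?near = "{t \<in> T. dist_int (x t) < 1 / (2 * real q)}"
  let ?far = "{t \<in> T. 1 / (2 * real q) \<le> dist_int (x t)}"
  have "k t \<in> {-1, 0}" if "t \<in> ?near" for t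
  proof -
    have "\<bar>2 * real q * y t\<bar> < 1" using that q by (simp add: dy abs_mult field_simps)
    then show ?thesis using k_bounds[of t] by auto
  qed
  then have "card ?near \<le> card {-1, 0 :: int}"
    by (intro card_inj_on_le[of k]) (use inj in \<open>auto intro: inj_on_subset\<close>)
  then show "card ?near \<le> 2" by simp
  \<comment> \<open>Rounding down at most doubles a modulus that is at least 1; hence 4 instead of
    2.\<close>
  have k_far: "k t \<noteq> 0 \<and> of_int \<bar>k t\<bar> \<le> 4 * real q * dist_int (x t)" if "t \<in> ?far" for t
  proof -
    have "1 \<le> \<bar>2 * real q * y t\<bar>" using that q by (simp add: dy abs_mult field_simps)
    moreover have "4 * real q * dist_int (x t) = 2 * \<bar>2 * real q * y t\<bar>" using q by (simp add: dy abs_mult)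
    ultimately show ?thesis using k_bounds[of t] by linarith
  qed
  define g where "g i = 4 * sqrt (\<tau> * real q) * (1 / sqrt (of_int \<bar>i\<bar>))" for i :: int
  have "(\<Sum>t\<in>?far. 2 * sqrt (\<tau> / dist_int (x t))) \<le> (\<Sum>t\<in>?far. g (k t))"
  proof (rule sum_mono)
    fix t assume t: "t \<in> ?far"
    then have d: "0 < dist_int (x t)" using q by (auto intro: less_le_trans[rotated])
    have kp: "0 < real_of_int \<bar>k t\<bar>" using k_far[OF t] by simp
    have "\<tau> / dist_int (x t) \<le> 4 * (\<tau> * real q) / of_int \<bar>k t\<bar>"
    proof -
      have "\<tau> * of_int \<bar>k t\<bar> \<le> \<tau> * (4 * real q * dist_int (x t))"
        using k_far[OF t] assms by (intro mult_left_mono) auto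
      then show ?thesis using d kp by (simp add: field_simps)
    qed
    then have "sqrt (\<tau> / dist_int (x t)) \<le> sqrt (4 * (\<tau> * real q) / of_int \<bar>k t\<bar>)"
      by (rule real_sqrt_le_mono)
    then show "2 * sqrt (\<tau> / dist_int (x t)) \<le> g (k t)"
      by (simp add: g_def real_sqrt_mult real_sqrt_divide)
  qed
  also have "\<dots> = (\<Sum>i\<in>k ` ?far. g i)"
    by (rule sum.reindex[symmetric, unfolded o_def]) (use inj in \<open>auto intro: inj_on_subset\<close>)
  also have "\<dots> \<le> (\<Sum>i\<in>int ` {1..q} \<union> (\<lambda>j. - int j) ` {1..q}. g i)"
  proof (rule sum_mono2)
    show "k ` ?far \<subseteq> int ` {1..q} \<union> (\<lambda>j. - int j) ` {1..q}"
    proof (rule image_subsetI)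
      fix t assume t: "t \<in> ?far"
      show "k t \<in> int ` {1..q} \<union> (\<lambda>j. - int j) ` {1..q}"
      proof (cases "k t > 0")
        case True
        then have "k t = int (nat (k t))" "nat (k t) \<in> {1..q}" using k_range[of t] by auto
        then show ?thesis by blast
      next
        case False
        then have "k t = - int (nat (- k t))" "nat (- k t) \<in> {1..q}" using k_range[of t] k_far[OF t] by auto
        then show ?thesis by blast
      qed
    qed
    show "0 \<le> g i" for i using assms by (simp add: g_def)
  qed auto
  also have "\<dots> \<le> (\<Sum>i\<in>int ` {1..q}. g i) + (\<Sum>i\<in>(\<lambda>j. - int j) ` {1..q}. g i)"
    by (subst sum.union_disjoint) auto
  also have "\<dots> = 2 * (\<Sum>j=1..q. g (int j))"
    by (subst (1 2) sum.reindex) (auto simp: inj_on_def g_def)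
  also have "\<dots> = 8 * sqrt (\<tau> * real q) * (\<Sum>j=1..q. 1 / sqrt (real j))"
    by (simp add: g_def sum_distrib_left)
  also have "\<dots> \<le> 8 * sqrt (\<tau> * real q) * (2 * sqrt (real q))"
    using assms by (intro mult_left_mono sum_inverse_sqrt_le) auto
  also have "\<dots> = 16 * sqrt \<tau> * real q" by (simp add: real_sqrt_mult)
  finally show "(\<Sum>t\<in>?far. 2 * sqrt (\<tau> / dist_int (x t))) \<le> 16 * sqrt \<tau> * real q" .
qed

text \<open>With v = \<tau> / \<open>dist_int x\<close>, one has 1 - r = 4 * v *
  \<open>dist_int x\<close> \<le> v |1 - e^(2 pi i x)|, so the squared ratio of the two moduli is at
  most 1 + v^2. The square root bound is meant for points kept apart from the integers, the
  logarithmic one for the few others.\<close>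

lemma ln_cis_ratio_le:
  assumes r: "0 < r" "r < 1" and d: "0 < dist_int x"
  defines "\<tau> \<equiv> (1 - r) / 4"
  shows "ln (cmod (1 - of_real r * cis (2 * pi * x))) - ln (cmod (1 - cis (2 * pi * x)))
           \<le> min (2 * sqrt (\<tau> / dist_int x)) (- ln (dist_int x))"
proof -
  define A where "A = cmod (1 - of_real r * cis (2 * pi * x))"
  define B where "B = cmod (1 - cis (2 * pi * x))"
  define v where "v = \<tau> / dist_int x"
  have v: "0 \<le> v" using r d by (simp add: v_def \<tau>_def)
  have B: "4 * dist_int x \<le> B" unfolding B_def by (rule norm_1_minus_cis_ge)
  then have B0: "0 < B" using d by linarith
  have Asq: "A\<^sup>2 = (1 - r)\<^sup>2 + r * B\<^sup>2" unfolding A_def B_def by (rule norm_1_minus_scaled_cis_sq)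
  have A0: "0 < A"
  proof -
    have "0 < A\<^sup>2" unfolding Asq using r by (intro add_pos_nonneg) auto
    moreover have "0 \<le> A" by (simp add: A_def)
    ultimately show ?thesis by (simp add: zero_less_power2)
  qed
  have "(1 - r)\<^sup>2 \<le> v\<^sup>2 * B\<^sup>2"
  proof -
    have "1 - r = v * (4 * dist_int x)" using d by (simp add: v_def \<tau>_def)
    also have "\<dots> \<le> v * B" using v B by (intro mult_left_mono) auto
    finally show ?thesis using r by (simp flip: power_mult_distrib)
  qed
  moreover have "r * B\<^sup>2 \<le> B\<^sup>2" using r by (intro mult_left_le_one_le) auto
  ultimately have ratio: "A\<^sup>2 \<le> (1 + v\<^sup>2) * B\<^sup>2" using Asq by (simp add: algebra_simps)
  then have "ln (A\<^sup>2) \<le> ln ((1 + v\<^sup>2) * B\<^sup>2)"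
    using A0 B0 by (subst ln_le_cancel_iff) (auto intro!: mult_pos_pos add_pos_nonneg)
  also have "\<dots> = ln (1 + v\<^sup>2) + ln (B\<^sup>2)"
    using B0 by (intro ln_mult_pos) (auto intro: add_pos_nonneg)
  finally have "2 * ln A \<le> ln (1 + v\<^sup>2) + 2 * ln B" using A0 B0 by (simp add: ln_realpow)
  then have 1: "ln A - ln B \<le> 2 * sqrt v" using ln_1_plus_sq_le[OF v] by linarith
  have "A\<^sup>2 \<le> ((1 + v) * B)\<^sup>2"
  proof -
    have "1 + v\<^sup>2 \<le> (1 + v)\<^sup>2" using v by (simp add: power2_eq_square algebra_simps)
    then show ?thesis using ratio by (smt (verit) mult_right_mono power_mult_distrib zero_le_power2)
  qed
  then have "A \<le> (1 + v) * B" by (rule power2_le_imp_le) (use v B0 in simp)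
  moreover have "1 + v \<le> 1 / dist_int x"
  proof -
    have "1 + v = (dist_int x + \<tau>) / dist_int x" using d by (simp add: v_def add_divide_distrib)
    also have "\<dots> \<le> 1 / dist_int x"
    proof (rule divide_right_mono)
      show "dist_int x + \<tau> \<le> 1" using d r dist_int_half[of x] unfolding \<tau>_def diff_divide_distrib by linarith
    qed (use d in simp)
    finally show ?thesis .
  qed
  then have "(1 + v) * B \<le> 1 / dist_int x * B" by (rule mult_right_mono) (use B0 in simp)
  ultimately have "A \<le> 1 / dist_int x * B" by linarith
  then have "ln A \<le> ln (1 / dist_int x * B)" using A0 B0 d by (subst ln_le_cancel_iff) auto
  also have "\<dots> = ln B - ln (dist_int x)" using B0 d by (subst ln_mult) (auto simp: ln_div)
  finally show ?thesis using 1 unfolding A_def B_def v_def by linarith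
qed

context zero_beta
begin

text \<open>In each block of \<open>q\<close> consecutive indices at most two points are within \<open>1/(2q)\<close> of an integer,
  and over the whole range at most one point is much closer than \<open>exp (- \<epsilon> q)\<close>: only that one
  costs \<open>\<rho>\<close>.\<close>

lemma prod_norm_1_minus_ge:
  assumes "0 < \<eta>"
  obtains C where "0 \<le> C"
    "\<And>n x \<rho>. 0 \<le> \<rho> \<Longrightarrow> (\<And>j. j < n \<Longrightarrow> exp (- \<rho>) \<le> dist_int (x + real j * \<alpha>)) \<Longrightarrow>
       exp (- \<eta> * real n - C - C * \<rho>) \<le> (\<Prod>j<n. cmod (1 - cis (2 * pi * (x + real j * \<alpha>))))"
proof -
  \<comment> \<open>This makes sqrt \<tau> \<le> \<eta> / 128, so that the far points cost at most
    32 n sqrt \<tau> \<le> \<eta> n / 4 in total; the cut at 1 keeps \<open>r\<close>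
    positive.\<close>
  define t where "t = min 1 (\<eta> / 128)"
  define \<tau> where "\<tau> = t\<^sup>2 / 8"
  define r where "r = 1 - 4 * \<tau>"
  have t: "0 < t" "t \<le> 1" "t \<le> \<eta> / 128" using assms by (auto simp: t_def)
  then have t2: "0 < t\<^sup>2" "t\<^sup>2 \<le> 1" by (auto simp: power_le_one)
  have r: "0 < r" "r < 1" and \<tau>r: "(1 - r) / 4 = \<tau>" and \<tau>: "0 \<le> \<tau>" using t2 by (auto simp: r_def \<tau>_def)
  have sqrt\<tau>: "sqrt \<tau> \<le> \<eta> / 128"
  proof -
    have "sqrt \<tau> \<le> sqrt (t\<^sup>2)" using t2 by (intro real_sqrt_le_mono) (simp add: \<tau>_def)
    then show ?thesis using t by simp
  qed
  have "cmod (of_real r) < 1" using r by simp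
  then obtain C where C: "0 \<le> C"
    "\<And>n x. \<bar>\<Sum>j<n. ln (cmod (1 - of_real r * cis (2 * pi * (x + real j * \<alpha>))))\<bar> \<le> \<eta> / 2 * real n + C"
    by (rule sum_ln_norm_1_minus_bound[of "of_real r" "\<eta> / 2"]) (use assms in auto)
  \<comment> \<open>At most two near points per block of length \<open>q\<close> cost \<epsilon> q +
    ln 2 each; with this \<epsilon> and q \<ge> 32 / \<eta> they add up to at most \<eta> n /
    4.\<close>
  define \<epsilon> where "\<epsilon> = \<eta> / 32"
  obtain Q :: nat where Q: "32 / \<eta> \<le> real Q" using real_arch_simple by blast
  obtain N where N: "\<And>n. N \<le> n \<Longrightarrow> \<exists>q. Q \<le> q \<and> 1 \<le> q \<and> q \<le> n
       \<and> (\<forall>i. 0 < i \<and> i < q \<longrightarrow> 1 / (2 * real q) \<le> dist_int (real i * \<alpha>))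
       \<and> (\<forall>i. 0 < i \<and> i \<le> n \<longrightarrow> exp (- \<epsilon> * real q) \<le> dist_int (real i * \<alpha>))"
    using separated_scale[of \<epsilon> Q] assms by (auto simp: \<epsilon>_def)
  show thesis
  \<comment> \<open>For n < N every factor is simply bounded below by exp (- \<rho>), whence
    \<open>N\<close>; for n \<ge> N the 1 pays for the single exceptional point.\<close>
  proof (rule that[of "max C (max 1 (real N))"])
    show "0 \<le> max C (max 1 (real N))" by simp
    fix n x \<rho>
    assume \<rho>: "0 \<le> \<rho>" and sep: "\<And>j. j < n \<Longrightarrow> exp (- \<rho>) \<le> dist_int (x + real j * \<alpha>)"
    define d where "d j = dist_int (x + real j * \<alpha>)" for j :: nat
    define B where "B j = cmod (1 - cis (2 * pi * (x + real j * \<alpha>)))" for j :: nat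
    have d0: "0 < d j" and dB: "d j \<le> B j" if "j < n" for j
      using sep[OF that] norm_1_minus_cis_ge[of "x + real j * \<alpha>"]
        exp_gt_zero[of "- \<rho>"] unfolding d_def B_def by linarith+
    have B0: "0 < B j" if "j < n" for j using d0[OF that] dB[OF that] by linarith
    have lnd: "- \<rho> \<le> ln (d j)" if "j < n" for j
    proof -
      have "ln (exp (- \<rho>)) \<le> ln (d j)" using sep[OF that] d0[OF that] by (simp add: d_def del: ln_exp)
      then show ?thesis by simp
    qed
    have "- \<eta> * real n - max C (max 1 (real N)) - max C (max 1 (real N)) * \<rho> \<le> (\<Sum>j<n. ln (B j))"
    proof (cases "N \<le> n")
      case False
      have "- real n * \<rho> \<le> (\<Sum>j<n. ln (B j))"
      proof -
        have "(\<Sum>j<n. - \<rho>) \<le> (\<Sum>j<n. ln (B j))"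
        proof (rule sum_mono)
          fix j assume "j \<in> {..<n}"
          then have j: "j < n" by simp
          have "ln (d j) \<le> ln (B j)" using d0[OF j] dB[OF j] by simp
          then show "- \<rho> \<le> ln (B j)" using lnd[OF j] by linarith
        qed
        then show ?thesis by simp
      qed
      moreover have "real n * \<rho> \<le> max C (max 1 (real N)) * \<rho>" using False \<rho> by (intro mult_right_mono) auto
      moreover have "0 \<le> \<eta> * real n" using assms by simp
      ultimately show ?thesis by linarith
    next
      case True
      then obtain q where q: "Q \<le> q" "1 \<le> q" "q \<le> n"
        and q1: "\<And>i. 0 < i \<Longrightarrow> i < q \<Longrightarrow> 1 / (2 * real q) \<le> dist_int (real i * \<alpha>)"
        and q2: "\<And>i. 0 < i \<Longrightarrow> i \<le> n \<Longrightarrow> exp (- \<epsilon> * real q) \<le> dist_int (real i * \<alpha>)"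
        using N[OF True] by blast
      have q0: "0 < real q" using q by simp
      have diff: "dist_int ((x + real i * \<alpha>) - (x + real j * \<alpha>)) = dist_int (real (nat \<bar>int i - int j\<bar>) * \<alpha>)" for i j
      proof (cases "j \<le> i")
        case True
        then show ?thesis by (simp add: nat_diff_distrib of_nat_diff algebra_simps)
      next
        case False
        then have "(x + real i * \<alpha>) - (x + real j * \<alpha>) = - (real (nat \<bar>int i - int j\<bar>) * \<alpha>)"
          by (simp add: algebra_simps)
        then show ?thesis by (simp only: dist_int_minus)
      qed
      \<comment> \<open>Three costs: \<open>a\<close> for far points, \<open>b\<close> for near
        points, \<open>c\<close> for a point closer than exp (- \<epsilon> q) / 2. The half makes
        the last one unique, as two such points would differ by less than exp (- \<epsilon>
        q).\<close>
      define far where "far j \<longleftrightarrow> 1 / (2 * real q) \<le> d j" for j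
      define a where "a j = (if far j then 2 * sqrt (\<tau> / d j) else 0)" for j
      define b where "b j = (if far j then 0 else \<epsilon> * real q + ln 2)" for j
      define c where "c j = (if d j < exp (- \<epsilon> * real q) / 2 then \<rho> else 0)" for j
      define L where "L j = ln (cmod (1 - of_real r * cis (2 * pi * (x + real j * \<alpha>))))" for j :: nat
      have b0: "0 \<le> \<epsilon> * real q + ln 2" using assms by (simp add: \<epsilon>_def)
      have "L j - ln (B j) \<le> a j + b j + c j" if j: "j < n" for j
      proof -
        have *: "L j - ln (B j) \<le> min (2 * sqrt (\<tau> / d j)) (- ln (d j))"
          using ln_cis_ratio_le[OF r, of "x + real j * \<alpha>"] d0[OF j] unfolding L_def B_def d_def \<tau>r by simp
        show ?thesis
        proof (cases "far j")
          case True
          then show ?thesis using * \<rho> by (simp add: a_def b_def c_def)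
        next
          case nf: False
          show ?thesis
          proof (cases "d j < exp (- \<epsilon> * real q) / 2")
            case True
            then show ?thesis using nf * lnd[OF j] b0 by (simp add: a_def b_def c_def)
          next
            case False
            then have "ln (exp (- \<epsilon> * real q) / 2) \<le> ln (d j)" using d0[OF j] by (subst ln_le_cancel_iff) auto
            then have "- \<epsilon> * real q - ln 2 \<le> ln (d j)" by (simp add: ln_div)
            then show ?thesis using nf * False by (simp add: a_def b_def c_def)
          qed
        qed
      qed
      then have "(\<Sum>j<n. L j - ln (B j)) \<le> (\<Sum>j<n. a j + b j + c j)" by (intro sum_mono) auto
      then have 1: "(\<Sum>j<n. L j) - (\<Sum>j<n. ln (B j)) \<le> (\<Sum>j<n. a j) + (\<Sum>j<n. b j) + (\<Sum>j<n. c j)"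
        by (simp add: sum.distrib sum_subtractf)
      define m where "m = n div q"
      have mq: "m * q \<le> n" by (simp add: m_def)
      have m1: "1 \<le> m" using q by (simp add: m_def div_greater_zero_iff Suc_le_eq)
      \<comment> \<open>The last block may be incomplete, so m + 1 blocks are counted; as m \<ge> 1,
        their total length is at most 2 n.\<close>
      have mr: "real (Suc m) * real q \<le> 2 * real n"
      proof -
        have "Suc m * q \<le> 2 * (m * q)" using m1 by simp
        also have "\<dots> \<le> 2 * n" using mq by simp
        finally show ?thesis by (metis of_nat_le_iff of_nat_mult of_nat_numeral)
      qed
      define T where "T k = {j. j < n \<and> j div q = k}" for k
      have Tfin: "finite (T k)" for k by (simp add: T_def)
      have Tsep: "1 / (2 * real q) \<le> dist_int ((x + real i * \<alpha>) - (x + real j * \<alpha>))"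
        if "i \<in> T k" "j \<in> T k" "i \<noteq> j" for i j k
      proof -
        have "\<bar>int i - int j\<bar> < int q"
        proof -
          have "i div q = k" "j div q = k" using that by (auto simp: T_def)
          then have "i = k * q + i mod q" "j = k * q + j mod q"
            using div_mult_mod_eq[of i q] div_mult_mod_eq[of j q] by simp_all
          moreover have "i mod q < q" "j mod q < q" using q by auto
          ultimately show ?thesis by linarith
        qed
        then show ?thesis unfolding diff using that by (intro q1) auto
      qed
      have img: "(\<lambda>j. j div q) ` {..<n} \<subseteq> {..m}" by (auto simp: m_def intro: div_le_mono)
      have group: "(\<Sum>j<n. f j) = (\<Sum>k\<le>m. \<Sum>j\<in>T k. f j)" for f :: "nat \<Rightarrow> real"
        using sum.group[OF _ _ img, of f] by (simp add: T_def)
      have A: "(\<Sum>j<n. a j) \<le> \<eta> / 4 * real n"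
      proof -
        have "(\<Sum>j\<in>T k. a j) \<le> 16 * sqrt \<tau> * real q" for k
        proof -
          have "(\<Sum>j\<in>T k. a j) = (\<Sum>j\<in>{j \<in> T k. far j}. 2 * sqrt (\<tau> / d j))"
            unfolding a_def by (simp add: sum.inter_filter[OF Tfin])
          also have "\<dots> \<le> 16 * sqrt \<tau> * real q"
            unfolding far_def d_def by (rule separated_points(2)[OF Tfin q(2) \<tau> Tsep])
          finally show ?thesis .
        qed
        then have "(\<Sum>j<n. a j) \<le> (\<Sum>k\<le>m. 16 * sqrt \<tau> * real q)" unfolding group by (intro sum_mono)
        also have "\<dots> = 16 * sqrt \<tau> * (real (Suc m) * real q)" by simp
        also have "\<dots> \<le> 16 * sqrt \<tau> * (2 * real n)" using mr \<tau> by (intro mult_left_mono) auto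
        also have "\<dots> = 32 * real n * sqrt \<tau>" by simp
        also have "\<dots> \<le> 32 * real n * (\<eta> / 128)" using sqrt\<tau> by (intro mult_left_mono) auto
        finally show ?thesis by simp
      qed
      have Bs: "(\<Sum>j<n. b j) \<le> \<eta> / 4 * real n"
      proof -
        have "(\<Sum>j\<in>T k. b j) \<le> 2 * (\<epsilon> * real q + ln 2)" for k
        proof -
          have "(\<Sum>j\<in>T k. b j) = (\<Sum>j\<in>T k. if \<not> far j then \<epsilon> * real q + ln 2 else 0)"
            by (intro sum.cong) (auto simp: b_def)
          also have "\<dots> = (\<Sum>j\<in>{j \<in> T k. \<not> far j}. \<epsilon> * real q + ln 2)"
            by (rule sum.inter_filter[symmetric, OF Tfin])
          also have "\<dots> = real (card {j \<in> T k. \<not> far j}) * (\<epsilon> * real q + ln 2)" by simp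
          also have "\<dots> \<le> 2 * (\<epsilon> * real q + ln 2)"
            using separated_points(1)[OF Tfin q(2) \<tau> Tsep] b0
            by (intro mult_right_mono) (auto simp: far_def d_def not_le)
          finally show ?thesis .
        qed
        then have "(\<Sum>j<n. b j) \<le> (\<Sum>k\<le>m. 2 * (\<epsilon> * real q + ln 2))" unfolding group by (intro sum_mono)
        also have "\<dots> = 2 * (real (Suc m) * real q) * (\<epsilon> + ln 2 / real q)" using q0 by (simp add: field_simps)
        also have "\<dots> \<le> 2 * (2 * real n) * (\<eta> / 32 + \<eta> / 32)"
        proof (rule mult_mono[OF mult_left_mono[OF mr] add_mono])
          have "32 / \<eta> \<le> real q" using Q q by linarith
          then have "1 / real q \<le> \<eta> / 32" using assms q0 by (simp add: field_simps)
          moreover have "ln 2 / real q \<le> 1 / real q" using q0 ln_le_minus_one[of 2] by (intro divide_right_mono) auto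
          ultimately show "ln 2 / real q \<le> \<eta> / 32" by linarith
        qed (use mr assms q0 in \<open>auto simp: \<epsilon>_def\<close>)
        finally show ?thesis by simp
      qed
      have Cs: "(\<Sum>j<n. c j) \<le> \<rho>"
      proof -
        let ?S = "{j \<in> {..<n}. d j < exp (- \<epsilon> * real q) / 2}"
        have "i = j" if "i \<in> ?S" "j \<in> ?S" for i j
        proof (rule ccontr)
          assume "i \<noteq> j"
          have "dist_int ((x + real i * \<alpha>) - (x + real j * \<alpha>)) \<le> d i + d j"
            unfolding d_def by (rule dist_int_diff_le)
          also have "\<dots> < exp (- \<epsilon> * real q)" using that by simp
          also have "\<dots> \<le> dist_int ((x + real i * \<alpha>) - (x + real j * \<alpha>))"
            unfolding diff using that \<open>i \<noteq> j\<close> by (intro q2) auto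
          finally show False by simp
        qed
        then have "card ?S \<le> 1" by (subst card_le_Suc0_iff_eq[of ?S, folded One_nat_def]) auto
        have "(\<Sum>j<n. c j) = (\<Sum>j\<in>?S. \<rho>)" unfolding c_def by (rule sum.inter_filter[symmetric]) simp
        also have "\<dots> = real (card ?S) * \<rho>" by simp
        also have "\<dots> \<le> 1 * \<rho>" using \<open>card ?S \<le> 1\<close> \<rho> by (intro mult_right_mono) auto
        finally show ?thesis by simp
      qed
      have "- (\<eta> / 2 * real n + C) \<le> (\<Sum>j<n. L j)"
        using C(2)[of x n] by (simp add: L_def)
      then have "- \<eta> * real n - C - \<rho> \<le> (\<Sum>j<n. ln (B j))" using 1 A Bs Cs by simp
      moreover have "1 * \<rho> \<le> max C (max 1 (real N)) * \<rho>" using \<rho> by (intro mult_right_mono) auto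
      ultimately show ?thesis by linarith
    qed
    then have "exp (- \<eta> * real n - max C (max 1 (real N)) - max C (max 1 (real N)) * \<rho>) \<le> exp (\<Sum>j<n. ln (B j))"
      by simp
    also have "\<dots> = (\<Prod>j<n. B j)" using B0 by (simp add: exp_sum)
    finally show "exp (- \<eta> * real n - max C (max 1 (real N)) - max C (max 1 (real N)) * \<rho>)
       \<le> (\<Prod>j<n. cmod (1 - cis (2 * pi * (x + real j * \<alpha>))))" by (simp add: B_def)
  qed
qed

end

section \<open>Determinants of finite restrictions\<close>

text \<open>\<open>hdet d b \<alpha> n t\<close> is the determinant of the \<open>n \<times> n\<close> Jacobi matrix with diagonal entries
  \<open>d (t + j\<alpha>)\<close> and products \<open>b (t + j\<alpha>)\<close> of opposite off-diagonal entries.\<close>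

fun hdet :: "(real \<Rightarrow> real) \<Rightarrow> (real \<Rightarrow> real) \<Rightarrow> real \<Rightarrow> nat \<Rightarrow> real \<Rightarrow> real" where
  "hdet d b \<alpha> 0 t = 1"
| "hdet d b \<alpha> (Suc 0) t = d t"
| "hdet d b \<alpha> (Suc (Suc n)) t =
     d (t + real (Suc n) * \<alpha>) * hdet d b \<alpha> (Suc n) t - b (t + real n * \<alpha>) * hdet d b \<alpha> n t"

text \<open>Expansion along the first row instead of the last one. Both expansions together yield
  the symmetry under reversal of the sites.\<close>

lemma hdet_left:
  "hdet d b \<alpha> (Suc (Suc n)) t = d t * hdet d b \<alpha> (Suc n) (t + \<alpha>) - b t * hdet d b \<alpha> n (t + 2 * \<alpha>)"
proof (induction n rule: induct_nat_012)
  case (ge2 n)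
  have "hdet d b \<alpha> (Suc (Suc (Suc (Suc n)))) t =
     d (t + real (Suc (Suc (Suc n))) * \<alpha>) * hdet d b \<alpha> (Suc (Suc (Suc n))) t
     - b (t + real (Suc (Suc n)) * \<alpha>) * hdet d b \<alpha> (Suc (Suc n)) t" by simp
  also have "\<dots> = d t * (d (t + real (Suc (Suc (Suc n))) * \<alpha>) * hdet d b \<alpha> (Suc (Suc n)) (t + \<alpha>)
        - b (t + real (Suc (Suc n)) * \<alpha>) * hdet d b \<alpha> (Suc n) (t + \<alpha>))
     - b t * (d (t + real (Suc (Suc (Suc n))) * \<alpha>) * hdet d b \<alpha> (Suc n) (t + 2 * \<alpha>)
        - b (t + real (Suc (Suc n)) * \<alpha>) * hdet d b \<alpha> n (t + 2 * \<alpha>))"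
    unfolding ge2 by (simp only: right_diff_distrib mult.left_commute)
  also have "d (t + real (Suc (Suc (Suc n))) * \<alpha>) * hdet d b \<alpha> (Suc (Suc n)) (t + \<alpha>)
        - b (t + real (Suc (Suc n)) * \<alpha>) * hdet d b \<alpha> (Suc n) (t + \<alpha>) = hdet d b \<alpha> (Suc (Suc (Suc n))) (t + \<alpha>)"
  proof -
    have "t + real (Suc (Suc (Suc n))) * \<alpha> = t + \<alpha> + real (Suc (Suc n)) * \<alpha>"
      "t + real (Suc (Suc n)) * \<alpha> = t + \<alpha> + real (Suc n) * \<alpha>" by (simp_all add: algebra_simps)
    then show ?thesis by (simp only: hdet.simps)
  qed
  also have "d (t + real (Suc (Suc (Suc n))) * \<alpha>) * hdet d b \<alpha> (Suc n) (t + 2 * \<alpha>)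
        - b (t + real (Suc (Suc n)) * \<alpha>) * hdet d b \<alpha> n (t + 2 * \<alpha>) = hdet d b \<alpha> (Suc (Suc n)) (t + 2 * \<alpha>)"
  proof -
    have "t + real (Suc (Suc (Suc n))) * \<alpha> = t + 2 * \<alpha> + real (Suc n) * \<alpha>"
      "t + real (Suc (Suc n)) * \<alpha> = t + 2 * \<alpha> + real n * \<alpha>" by (simp_all add: algebra_simps)
    then show ?thesis by (simp only: hdet.simps)
  qed
  finally show ?case .
qed (simp_all add: algebra_simps)

text \<open>The hypotheses say that the reflected phase lists the matrix entries in reverse order,
  so expanding the reflected matrix at its last site is \<open>hdet_left\<close> for the original
  one.\<close>

lemma hdet_reflect:
  assumes d: "\<And>t. d (- t) = d t" and b: "\<And>t. b (- t - \<alpha>) = b t"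
  shows "hdet d b \<alpha> n (- t - (real n - 1) * \<alpha>) = hdet d b \<alpha> n t"
proof (induction n arbitrary: t rule: induct_nat_012)
  case 1
  show ?case by (simp add: d)
next
  case (ge2 n)
  let ?s = "- t - (real (Suc (Suc n)) - 1) * \<alpha>"
  have "?s + real (Suc n) * \<alpha> = - t" "?s + real n * \<alpha> = - t - \<alpha>"
    "?s = - (t + \<alpha>) - (real (Suc n) - 1) * \<alpha>" "?s = - (t + 2 * \<alpha>) - (real n - 1) * \<alpha>"
    by (simp_all add: algebra_simps)
  then have "hdet d b \<alpha> (Suc (Suc n)) ?s = d t * hdet d b \<alpha> (Suc n) (t + \<alpha>) - b t * hdet d b \<alpha> n (t + 2 * \<alpha>)"
    using ge2(1)[of "t + 2 * \<alpha>"] ge2(2)[of "t + \<alpha>"] by (simp only: hdet.simps d b)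
  then show ?case by (simp only: hdet_left)
qed simp

text \<open>The Green's function formula for the sites x, ..., x + i + k, multiplied by the
  determinant. Nothing is divided by, so the determinants and the coefficients \<open>c\<close> may
  vanish.\<close>

lemma hdet_cramer:
  fixes \<phi> :: "int \<Rightarrow> complex" and c ct :: "real \<Rightarrow> complex"
  assumes eq: "\<And>m. c (\<theta> + of_int m * \<alpha>) * \<phi> (m + 1) + ct (\<theta> + of_int (m - 1) * \<alpha>) * \<phi> (m - 1)
      = of_real (d (\<theta> + of_int m * \<alpha>)) * \<phi> m"
    and b: "\<And>t. c t * ct t = of_real (b t)"
  shows "of_real (hdet d b \<alpha> (Suc (i + k)) (\<theta> + of_int x * \<alpha>)) * \<phi> (x + int i)
    = (\<Prod>j<Suc i. ct (\<theta> + of_int (x - 1 + int j) * \<alpha>)) * \<phi> (x - 1)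
        * of_real (hdet d b \<alpha> k (\<theta> + of_int (x + int i + 1) * \<alpha>))
      + (\<Prod>j<Suc k. c (\<theta> + of_int (x + int i + int j) * \<alpha>)) * \<phi> (x + int i + int k + 1)
        * of_real (hdet d b \<alpha> i (\<theta> + of_int x * \<alpha>))"
proof -
  define C where "C m = c (\<theta> + of_int m * \<alpha>)" for m
  define Ct where "Ct m = ct (\<theta> + of_int m * \<alpha>)" for m
  define D where "D m = complex_of_real (d (\<theta> + of_int m * \<alpha>))" for m
  define h where "h y n = complex_of_real (hdet d b \<alpha> n (\<theta> + of_int y * \<alpha>))" for y n
  have h0: "h y 0 = 1" and h1: "h y (Suc 0) = D y" for y by (simp_all add: h_def D_def)
  have h2: "h y (Suc (Suc n)) = D (y + int n + 1) * h y (Suc n) - C (y + int n) * Ct (y + int n) * h y n" for y n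
  proof -
    have "\<theta> + of_int y * \<alpha> + real (Suc n) * \<alpha> = \<theta> + of_int (y + int n + 1) * \<alpha>"
      "\<theta> + of_int y * \<alpha> + real n * \<alpha> = \<theta> + of_int (y + int n) * \<alpha>" by (simp_all add: algebra_simps)
    then show ?thesis by (simp only: h_def D_def C_def Ct_def b hdet.simps of_real_mult of_real_diff)
  qed
  have E: "D m * \<phi> m = C m * \<phi> (m + 1) + Ct (m - 1) * \<phi> (m - 1)" for m
    using eq[of m] by (simp add: D_def C_def Ct_def)
  define P where "P i = (\<Prod>j<Suc i. Ct (x - 1 + int j)) * \<phi> (x - 1)" for i
  have P_Suc: "P (Suc i) = Ct (x + int i) * P i" for i by (simp add: P_def algebra_simps)
  \<comment> \<open>The case k = 0 of the claim, by induction over the right end.\<close>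
  have A: "h x (Suc i) * \<phi> (x + int i) = P i + C (x + int i) * \<phi> (x + int i + 1) * h x i" for i
  proof (induction i)
    case 0
    show ?case using E[of x] by (simp add: h0 h1 P_def algebra_simps)
  next
    case (Suc i)
    have "h x (Suc (Suc i)) * \<phi> (x + int (Suc i))
      = h x (Suc i) * (D (x + int i + 1) * \<phi> (x + int i + 1)) - C (x + int i) * Ct (x + int i) * h x i * \<phi> (x + int i + 1)"
      by (simp add: h2 algebra_simps)
    also have "\<dots> = h x (Suc i) * C (x + int i + 1) * \<phi> (x + int i + 2)
        + Ct (x + int i) * (h x (Suc i) * \<phi> (x + int i) - C (x + int i) * \<phi> (x + int i + 1) * h x i)"
      using E[of "x + int i + 1"] by (simp add: algebra_simps)
    also have "\<dots> = h x (Suc i) * C (x + int i + 1) * \<phi> (x + int i + 2) + P (Suc i)"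
      unfolding Suc P_Suc by simp
    finally show ?case by (simp add: algebra_simps)
  qed
  \<comment> \<open>As functions of \<open>k\<close>, the determinants on both sides and
    \<open>T (Suc k)\<close> obey one and the same three-term recursion, so two initial cases
    suffice.\<close>
  define T where "T k = (\<Prod>j<k. C (x + int i + int j)) * \<phi> (x + int i + int k)" for k
  have T: "T (Suc (Suc k)) = D (x + int i + int k + 1) * T (Suc k)
      - C (x + int i + int k) * Ct (x + int i + int k) * T k" for k
  proof -
    let ?m = "x + int i + int k" and ?p = "\<Prod>j<k. C (x + int i + int j)"
    have "C (?m + 1) * \<phi> (?m + 2) = D (?m + 1) * \<phi> (?m + 1) - Ct ?m * \<phi> ?m"
      using E[of "?m + 1"] by (simp add: algebra_simps)
    moreover have "T (Suc (Suc k)) = ?p * C ?m * (C (?m + 1) * \<phi> (?m + 2))" "T (Suc k) = ?p * C ?m * \<phi> (?m + 1)"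
      by (simp_all add: T_def algebra_simps)
    moreover have "T k = ?p * \<phi> ?m" by (simp add: T_def)
    ultimately show ?thesis by (simp only:) (simp add: algebra_simps)
  qed
  have "h x (Suc (i + k)) * \<phi> (x + int i) = P i * h (x + int i + 1) k + T (Suc k) * h x i"
  proof (induction k rule: induct_nat_012)
    case 0
    show ?case using A[of i] by (simp add: h0 T_def)
  next
    case 1
    have "h x (Suc (i + Suc 0)) * \<phi> (x + int i) = D (x + int i + 1) * (h x (Suc i) * \<phi> (x + int i))
        - C (x + int i) * Ct (x + int i) * h x i * \<phi> (x + int i)"
      by (simp add: h2 algebra_simps)
    also have "\<dots> = D (x + int i + 1) * (P i + T (Suc 0) * h x i) - C (x + int i) * Ct (x + int i) * h x i * T 0"
      unfolding A by (simp add: T_def algebra_simps)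
    also have "\<dots> = P i * h (x + int i + 1) (Suc 0) + T (Suc (Suc 0)) * h x i"
    proof -
      have "T (Suc (Suc 0)) = D (x + int i + 1) * T (Suc 0) - C (x + int i) * Ct (x + int i) * T 0"
        using T[of 0] by simp
      then show ?thesis by (simp only: h1) (simp add: algebra_simps)
    qed
    finally show ?case by simp
  next
    case (ge2 k)
    let ?m = "x + int i + int k + 1"
    have e1: "x + int (Suc (i + k)) = ?m" "x + int i + 1 + int k = ?m" by simp_all
    have "h x (Suc (i + Suc (Suc k))) * \<phi> (x + int i) = D (?m + 1) * (h x (Suc (i + Suc k)) * \<phi> (x + int i))
        - C ?m * Ct ?m * (h x (Suc (i + k)) * \<phi> (x + int i))"
    proof -
      have "h x (Suc (i + Suc (Suc k))) = D (?m + 1) * h x (Suc (i + Suc k)) - C ?m * Ct ?m * h x (Suc (i + k))"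
        using h2[of x "Suc (i + k)"] unfolding e1 by simp
      then show ?thesis by (simp only:) (simp add: algebra_simps)
    qed
    also have "\<dots> = P i * (D (?m + 1) * h (x + int i + 1) (Suc k) - C ?m * Ct ?m * h (x + int i + 1) k)
      + (D (?m + 1) * T (Suc (Suc k)) - C ?m * Ct ?m * T (Suc k)) * h x i"
      unfolding ge2 by (simp add: algebra_simps)
    also have "D (?m + 1) * h (x + int i + 1) (Suc k) - C ?m * Ct ?m * h (x + int i + 1) k = h (x + int i + 1) (Suc (Suc k))"
      using h2[of "x + int i + 1" k] unfolding e1 by simp
    also have "D (?m + 1) * T (Suc (Suc k)) - C ?m * Ct ?m * T (Suc k) = T (Suc (Suc (Suc k)))"
      using T[of "Suc k"] by (simp add: algebra_simps)
    finally show ?case .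
  qed
  then show ?thesis unfolding h_def P_def T_def Ct_def C_def by (simp add: algebra_simps del: prod.lessThan_Suc)
qed

lemma abs_hdet_le:
  assumes d: "\<And>t. \<bar>d t\<bar> \<le> R" and b: "\<And>t. \<bar>b t\<bar> \<le> B"
  shows "\<bar>hdet d b \<alpha> n t\<bar> \<le> (R + B + 1) ^ n"
proof (induction n rule: induct_nat_012)
  case 1
  show ?case using d[of t] b[of t] by simp
next
  case (ge2 n)
  define V where "V = R + B + 1"
  have R: "0 \<le> R" using d[of 0] by linarith
  have B: "0 \<le> B" using b[of 0] by linarith
  have V: "1 \<le> V" using R B by (simp add: V_def)
  have "\<bar>hdet d b \<alpha> (Suc (Suc n)) t\<bar> \<le> \<bar>d (t + real (Suc n) * \<alpha>)\<bar> * \<bar>hdet d b \<alpha> (Suc n) t\<bar>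
      + \<bar>b (t + real n * \<alpha>)\<bar> * \<bar>hdet d b \<alpha> n t\<bar>"
    unfolding hdet.simps abs_mult[symmetric] by (rule abs_triangle_ineq4)
  also have "\<dots> \<le> R * V ^ Suc n + B * V ^ n"
    using ge2 d b R B by (intro add_mono mult_mono) (auto simp: V_def)
  also have "\<dots> \<le> R * V ^ Suc n + B * V ^ Suc n"
    using V B R by (intro add_mono mult_left_mono power_increasing) auto
  also have "\<dots> = (R + B) * V ^ Suc n" by (simp only: distrib_right)
  also have "\<dots> \<le> V * V ^ Suc n" using V by (intro mult_right_mono) (auto simp: V_def)
  finally show ?case by (simp add: V_def)
qed simp

section \<open>Exponentials, trigonometric polynomials and Lagrange interpolation\<close>

definition unit_exp :: "real \<Rightarrow> complex" where
  "unit_exp t = cis (2 * pi * t)"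

lemma unit_exp_add: "unit_exp (s + t) = unit_exp s * unit_exp t"
  by (simp add: unit_exp_def cis_mult algebra_simps)

lemma unit_exp_0 [simp]: "unit_exp 0 = 1"
  by (simp add: unit_exp_def)

lemma norm_unit_exp [simp]: "cmod (unit_exp t) = 1"
  by (simp add: unit_exp_def)

lemma unit_exp_nonzero [simp]: "unit_exp t \<noteq> 0"
  using norm_unit_exp[of t] by (metis norm_zero zero_neq_one)

lemma unit_exp_minus: "unit_exp (- t) * unit_exp t = 1"
  using unit_exp_add[of "-t" t] by simp

lemma unit_exp_of_nat: "unit_exp (real n * t) = unit_exp t ^ n"
  by (simp add: unit_exp_def Complex.DeMoivre algebra_simps)

lemma unit_exp_int [simp]: "unit_exp (of_int m) = 1"
  unfolding unit_exp_def by (rule cis_2pi_int)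

lemma unit_exp_numeral: "unit_exp (2 * t) = unit_exp t ^ 2" "unit_exp (4 * t) = unit_exp t ^ 4"
  using unit_exp_of_nat[of 2 t] unit_exp_of_nat[of 4 t] by simp_all

text \<open>Discrete Fourier inversion over the \<open>K\<close>-th roots of unity: \<open>K\<close>
  exceeds the degree, so no two frequencies are aliased, and a coefficient is an average of numbers
  of modulus at most \<open>M\<close>.\<close>

lemma norm_coeff_le:
  fixes p :: "complex poly"
  assumes M: "\<And>t. cmod (poly p (unit_exp t)) \<le> M"
  shows "cmod (coeff p i) \<le> M"
proof (cases "i \<le> degree p")
  case True
  define K where "K = Suc (degree p)"
  define w where "w j = unit_exp (real j / real K)" for j :: nat
  have orth: "(\<Sum>j<K. w j ^ m * cnj (w j) ^ i) = (if m = i then of_nat K else 0)" if m: "m < K" for m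
  proof -
    define z where "z = unit_exp ((real m - real i) / real K)"
    have "w j ^ m * cnj (w j) ^ i = z ^ j" for j
    proof -
      have "cnj (w j) = unit_exp (- (real j / real K))" by (simp add: w_def unit_exp_def cis_cnj)
      then have "w j ^ m * cnj (w j) ^ i = unit_exp (real m * (real j / real K) + real i * (- (real j / real K)))"
        by (simp only: w_def unit_exp_add unit_exp_of_nat)
      also have "real m * (real j / real K) + real i * (- (real j / real K)) = real j * ((real m - real i) / real K)"
        by (simp add: algebra_simps diff_divide_distrib)
      finally show ?thesis by (simp only: z_def unit_exp_of_nat)
    qed
    then have eq: "(\<Sum>j<K. w j ^ m * cnj (w j) ^ i) = (\<Sum>j<K. z ^ j)" by simp
    show ?thesis
    proof (cases "m = i")
      case True
      then show ?thesis unfolding eq by (simp add: z_def)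
    next
      case False
      have "z ^ K = unit_exp (of_int (int m - int i))"
        unfolding z_def by (subst unit_exp_of_nat[symmetric]) (simp add: K_def)
      then have zK: "z ^ K = 1" by (simp only: unit_exp_int)
      have "z \<noteq> 1"
      proof
        assume "z = 1"
        then have "dist_int ((real m - real i) / real K) \<le> 0"
          using norm_1_minus_cis_ge[of "(real m - real i) / real K"] by (simp add: z_def unit_exp_def)
        moreover obtain r where "dist_int ((real m - real i) / real K) = \<bar>(real m - real i) / real K - of_int r\<bar>"
          using dist_int_attained by metis
        ultimately have "(real m - real i) / real K = of_int r" by simp
        then have "real m - real i = of_int r * real K" by (simp add: K_def field_simps)
        then have "real_of_int (int m - int i) = real_of_int (r * int K)" by simp
        then have r: "int m - int i = r * int K" by (simp only: of_int_eq_iff)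
        have "\<bar>int m - int i\<bar> < int K" using m \<open>i \<le> degree p\<close> by (auto simp: K_def)
        then have "r = 0" unfolding r abs_mult by (simp add: K_def)
        then show False using r False by simp
      qed
      then show ?thesis unfolding eq using zK False by (simp add: sum_gp_strict)
    qed
  qed
  have "(\<Sum>j<K. poly p (w j) * cnj (w j) ^ i) = (\<Sum>m<K. coeff p m * (\<Sum>j<K. w j ^ m * cnj (w j) ^ i))"
    unfolding poly_altdef sum_distrib_left sum_distrib_right
    by (subst sum.swap) (simp add: K_def lessThan_Suc_atMost mult.assoc)
  also have "\<dots> = (\<Sum>m<K. if m = i then coeff p m * of_nat K else 0)"
    by (intro sum.cong) (auto simp: orth)
  also have "\<dots> = coeff p i * of_nat K" using True by (simp add: K_def)
  finally have "cmod (coeff p i) * real K = cmod (\<Sum>j<K. poly p (w j) * cnj (w j) ^ i)"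
    by (simp add: norm_mult)
  also have "\<dots> \<le> (\<Sum>j<K. M)"
    by (rule sum_norm_le) (use M in \<open>simp add: norm_mult norm_power w_def\<close>)
  finally have "cmod (coeff p i) * real K \<le> M * real K" by (simp add: mult.commute)
  then show ?thesis by (rule mult_right_le_imp_le) (simp add: K_def)
next
  case False
  then have "coeff p i = 0" by (simp add: coeff_eq_0)
  moreover have "0 \<le> M" using M[of 0] norm_ge_zero order.trans by blast
  ultimately show ?thesis by simp
qed

text \<open>Chebyshev polynomials; the recursion is the addition formula for cos ((n + 2) t) + cos
  (n t).\<close>

lemma cos_multiple_poly:
  "\<exists>q :: real poly. degree q \<le> n \<and> (\<forall>t. cos (real n * t) = poly q (cos t))"
proof (induction n rule: induct_nat_012)
    case 0
    show ?case by (intro exI[of _ 1]) simp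
  next
    case 1
    show ?case by (intro exI[of _ "[:0, 1:]"]) simp
  next
    case (ge2 n)
    then obtain p q :: "real poly" where p: "degree p \<le> n" "\<And>t. cos (real n * t) = poly p (cos t)"
      and q: "degree q \<le> Suc n" "\<And>t. cos (real (Suc n) * t) = poly q (cos t)" by blast
    show ?case
    proof (intro exI[of _ "[:0, 2:] * q - p"] conjI allI)
      have "degree ([:0, 2:] * q) \<le> degree [:0, 2 :: real:] + degree q" by (rule degree_mult_le)
      also have "\<dots> \<le> Suc (Suc n)" using q by simp
      finally show "degree ([:0, 2:] * q - p) \<le> Suc (Suc n)" using p by (intro degree_diff_le) auto
      fix t
      have "cos (real (Suc n) * t + t) + cos (real (Suc n) * t - t) = 2 * cos t * cos (real (Suc n) * t)"
        by (simp add: cos_add cos_diff)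
      moreover have "real (Suc n) * t + t = real (Suc (Suc n)) * t" "real (Suc n) * t - t = real n * t"
        by (simp_all add: algebra_simps)
      ultimately show "cos (real (Suc (Suc n)) * t) = poly ([:0, 2:] * q - p) (cos t)"
        using p q by simp
    qed
qed

text \<open>Averaging the values at \<open>y\<close> and \<open>- y\<close> turns each exponential into a cosine.\<close>

lemma even_trig_poly_cos:
  fixes f :: "real \<Rightarrow> real" and p :: "complex poly"
  assumes deg: "degree p \<le> 2 * n" and f: "\<And>y. unit_exp (real n * y) * of_real (f y) = poly p (unit_exp y)"
    and even: "\<And>y. f (- y) = f y"
  obtains q :: "real poly" where "degree q \<le> n" "\<And>y. f y = poly q (cos (2 * pi * y))"
proof -
  have f_sum: "f y = (\<Sum>m\<le>2*n. Re (coeff p m * unit_exp ((real m - real n) * y)))" for y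
  proof -
    have "complex_of_real (f y) = unit_exp (- (real n * y)) * (unit_exp (real n * y) * of_real (f y))"
      by (simp add: unit_exp_minus flip: mult.assoc)
    also have "\<dots> = unit_exp (- (real n * y)) * (\<Sum>m\<le>2*n. coeff p m * unit_exp y ^ m)"
      unfolding f poly_altdef using deg
      by (intro arg_cong[where f = "times _"] sum.mono_neutral_left) (auto simp: coeff_eq_0)
    also have "\<dots> = (\<Sum>m\<le>2*n. coeff p m * unit_exp ((real m - real n) * y))"
      unfolding sum_distrib_left
    proof (rule sum.cong)
      fix m
      have "unit_exp (- (real n * y)) * unit_exp (real m * y) = unit_exp ((real m - real n) * y)"
        by (subst unit_exp_add[symmetric]) (simp add: algebra_simps)
      then show "unit_exp (- (real n * y)) * (coeff p m * unit_exp y ^ m) = coeff p m * unit_exp ((real m - real n) * y)"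
        by (simp add: unit_exp_of_nat mult.left_commute)
    qed simp
    finally have "Re (complex_of_real (f y)) = Re (\<Sum>m\<le>2*n. coeff p m * unit_exp ((real m - real n) * y))" by simp
    then show ?thesis by simp
  qed
  have f_cos: "f y = (\<Sum>m\<le>2*n. Re (coeff p m) * cos (real (nat \<bar>int m - int n\<bar>) * (2 * pi * y)))" for y
  proof -
    have cos_abs: "cos (real (nat \<bar>int m - int n\<bar>) * u) = cos ((real m - real n) * u)" for m u
    proof (cases "n \<le> m")
      case True
      then show ?thesis by (simp add: nat_diff_distrib)
    next
      case False
      then have "real (nat \<bar>int m - int n\<bar>) * u = - ((real m - real n) * u)" by (simp add: algebra_simps)
      then show ?thesis by (simp only: cos_minus)
    qed
    have "2 * f y = f y + f (- y)" using even by simp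
    also have "\<dots> = (\<Sum>m\<le>2*n. Re (coeff p m * unit_exp ((real m - real n) * y)) + Re (coeff p m * unit_exp ((real m - real n) * - y)))"
      unfolding f_sum by (rule sum.distrib[symmetric])
    also have "\<dots> = (\<Sum>m\<le>2*n. 2 * (Re (coeff p m) * cos (real (nat \<bar>int m - int n\<bar>) * (2 * pi * y))))"
    proof (rule sum.cong)
      fix m
      have e: "2 * pi * ((real m - real n) * y) = (real m - real n) * (2 * pi * y)"
        "2 * pi * ((real m - real n) * - y) = - ((real m - real n) * (2 * pi * y))" by (simp_all add: algebra_simps)
      show "Re (coeff p m * unit_exp ((real m - real n) * y)) + Re (coeff p m * unit_exp ((real m - real n) * - y))
        = 2 * (Re (coeff p m) * cos (real (nat \<bar>int m - int n\<bar>) * (2 * pi * y)))"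
        unfolding cos_abs unit_exp_def e by simp
    qed simp
    finally show ?thesis by (simp flip: sum_distrib_left)
  qed
  obtain T :: "nat \<Rightarrow> real poly" where T: "\<And>k. degree (T k) \<le> k" "\<And>k t. cos (real k * t) = poly (T k) (cos t)"
  proof -
    have "\<forall>k. \<exists>q :: real poly. degree q \<le> k \<and> (\<forall>t. cos (real k * t) = poly q (cos t))"
      using cos_multiple_poly by blast
    then obtain T :: "nat \<Rightarrow> real poly" where "\<forall>k. degree (T k) \<le> k \<and> (\<forall>t. cos (real k * t) = poly (T k) (cos t))"
      by (rule choice[THEN exE])
    then show thesis using that by blast
  qed
  show thesis
  proof
    show "degree (\<Sum>m\<le>2*n. smult (Re (coeff p m)) (T (nat \<bar>int m - int n\<bar>))) \<le> n"
    proof (rule degree_sum_le)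
      fix m assume "m \<in> {..2 * n}"
      then have "nat \<bar>int m - int n\<bar> \<le> n" by auto
      then show "degree (smult (Re (coeff p m)) (T (nat \<bar>int m - int n\<bar>))) \<le> n"
        using T(1)[of "nat \<bar>int m - int n\<bar>"] by (meson degree_smult_le order.trans)
    qed simp
    show "f y = poly (\<Sum>m\<le>2*n. smult (Re (coeff p m)) (T (nat \<bar>int m - int n\<bar>))) (cos (2 * pi * y))" for y
      unfolding f_cos[of y] T(2) by (simp only: poly_sum poly_smult)
  qed
qed

text \<open>Lagrange interpolation at the nodes \<open>X i\<close>: the hypothesis
  \<open>ratio\<close> bounds each basis polynomial at \<open>x\<close> by \<open>L\<close>.\<close>

lemma poly_lagrange_bound:
  fixes p :: "real poly" and X :: "'a \<Rightarrow> real"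
  assumes fin: "finite A" and inj: "inj_on X A" and deg: "degree p < card A"
    and val: "\<And>i. i \<in> A \<Longrightarrow> \<bar>poly p (X i)\<bar> \<le> M"
    and ratio: "\<And>i. i \<in> A \<Longrightarrow> (\<Prod>j\<in>A - {i}. \<bar>x - X j\<bar>) \<le> L * (\<Prod>j\<in>A - {i}. \<bar>X i - X j\<bar>)"
  shows "\<bar>poly p x\<bar> \<le> real (card A) * M * L"
proof -
  define b where "b i = (\<Prod>j\<in>A - {i}. [:- X j, 1:])" for i
  define D where "D i = (\<Prod>j\<in>A - {i}. X i - X j)" for i
  have D: "D i \<noteq> 0" if "i \<in> A" for i
    using that inj fin by (auto simp: D_def inj_on_def)
  have pb: "poly (b i) y = (\<Prod>j\<in>A - {i}. y - X j)" for i y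
    by (simp add: b_def poly_prod)
  define q where "q = (\<Sum>i\<in>A. smult (poly p (X i) / D i) (b i))"
  have "p = q"
  proof (rule poly_eqI_degree[of "X ` A"])
    fix y assume "y \<in> X ` A"
    then obtain k where k: "k \<in> A" "y = X k" by auto
    have "poly q y = (\<Sum>i\<in>A. if i = k then poly p y else 0)"
      unfolding q_def poly_sum
    proof (rule sum.cong)
      fix i assume i: "i \<in> A"
      show "poly (smult (poly p (X i) / D i) (b i)) y = (if i = k then poly p y else 0)"
      proof (cases "i = k")
        case True
        then show ?thesis using D[OF i] k by (simp add: pb D_def)
      next
        case False
        then have "(\<Prod>j\<in>A - {i}. y - X j) = 0" using k fin by (auto simp: prod_zero_iff)
        then show ?thesis using False by (simp add: pb)
      qed
    qed simp
    then show "poly p y = poly q y" using k fin by simp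
  next
    have card: "card (X ` A) = card A" using inj by (rule card_image)
    show "degree p < card (X ` A)" using deg card by simp
    have "degree q \<le> card A - 1" unfolding q_def
    proof (rule degree_sum_le[OF fin])
      fix i assume i: "i \<in> A"
      have "degree (b i) \<le> (\<Sum>j\<in>A - {i}. degree [:- X j, 1:])"
        unfolding b_def using degree_prod_sum_le[of "A - {i}" "\<lambda>j. [:- X j, 1:]"] fin by (simp add: o_def)
      also have "\<dots> = card A - 1" using fin i by simp
      finally show "degree (smult (poly p (X i) / D i) (b i)) \<le> card A - 1"
        by (meson degree_smult_le order.trans)
    qed
    then show "degree q < card (X ` A)" using card deg by linarith
  qed
  then have "\<bar>poly p x\<bar> = \<bar>poly q x\<bar>" by simp
  also have "\<dots> = \<bar>\<Sum>i\<in>A. poly p (X i) / D i * (\<Prod>j\<in>A - {i}. x - X j)\<bar>"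
    by (simp add: q_def poly_sum pb)
  also have "\<dots> \<le> (\<Sum>i\<in>A. \<bar>poly p (X i) / D i * (\<Prod>j\<in>A - {i}. x - X j)\<bar>)" by (rule sum_abs)
  also have "\<dots> \<le> (\<Sum>i\<in>A. M * L)"
  proof (rule sum_mono)
    fix i assume i: "i \<in> A"
    have M: "0 \<le> M" using val[OF i] by linarith
    have Di: "\<bar>D i\<bar> = (\<Prod>j\<in>A - {i}. \<bar>X i - X j\<bar>)" by (simp add: D_def abs_prod)
    have "\<bar>poly p (X i) / D i * (\<Prod>j\<in>A - {i}. x - X j)\<bar> = \<bar>poly p (X i)\<bar> * ((\<Prod>j\<in>A - {i}. \<bar>x - X j\<bar>) / \<bar>D i\<bar>)"
      by (simp add: abs_mult abs_prod)
    also have "\<dots> \<le> M * L"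
    proof (rule mult_mono[OF val[OF i] _ M])
      show "(\<Prod>j\<in>A - {i}. \<bar>x - X j\<bar>) / \<bar>D i\<bar> \<le> L"
        using ratio[OF i] D[OF i] unfolding Di[symmetric] by (simp add: pos_divide_le_eq)
    qed (simp add: prod_nonneg)
    finally show "\<bar>poly p (X i) / D i * (\<Prod>j\<in>A - {i}. x - X j)\<bar> \<le> M * L" .
  qed
  also have "\<dots> = real (card A) * M * L" by simp
  finally show ?thesis .
qed

section \<open>The determinants of the extended Harper's model\<close>

definition diag :: "real \<Rightarrow> real \<Rightarrow> real" where
  "diag E t = E - 2 * cos (2 * pi * t)"

definition offdiag :: "coupling \<Rightarrow> real \<Rightarrow> real \<Rightarrow> real" where
  "offdiag a \<alpha> t = (cmod (c_fun a \<alpha> t))\<^sup>2"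

lemma c_fun_unit_exp:
  "c_fun (a1, a2, a3) \<alpha> t = of_real a1 * unit_exp (- (t + \<alpha> / 2)) + of_real a2 + of_real a3 * unit_exp (t + \<alpha> / 2)"
  by (simp only: c_fun.simps unit_exp_def mult_minus_right mult_minus_left)

lemma c_tilde_unit_exp:
  "c_tilde (a1, a2, a3) \<alpha> t = of_real a1 * unit_exp (t + \<alpha> / 2) + of_real a2 + of_real a3 * unit_exp (- (t + \<alpha> / 2))"
  by (simp only: c_tilde.simps unit_exp_def mult_minus_right mult_minus_left)

lemma c_tilde_eq_cnj: "c_tilde a \<alpha> t = cnj (c_fun a \<alpha> t)"
  by (cases a) (simp add: cis_cnj)

lemma c_fun_c_tilde: "c_fun a \<alpha> t * c_tilde a \<alpha> t = of_real (offdiag a \<alpha> t)"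
  unfolding offdiag_def c_tilde_eq_cnj by (rule complex_norm_square[symmetric])

lemma norm_c_tilde: "cmod (c_tilde a \<alpha> t) = cmod (c_fun a \<alpha> t)"
  by (simp add: c_tilde_eq_cnj)

lemma diag_even: "diag E (- t) = diag E t"
  by (simp add: diag_def)

lemma offdiag_reflect: "offdiag a \<alpha> (- t - \<alpha>) = offdiag a \<alpha> t"
proof -
  have "c_fun a \<alpha> (- t - \<alpha>) = c_tilde a \<alpha> t"
  proof (cases a)
    case (fields a1 a2 a3)
    have "- t - \<alpha> + \<alpha> / 2 = - (t + \<alpha> / 2)" by simp
    then show ?thesis unfolding fields c_fun_unit_exp c_tilde_unit_exp by (simp only: minus_minus)
  qed
  then show ?thesis by (simp add: offdiag_def norm_c_tilde)
qed

text \<open>A single term of the convolution survives. Degree bounds replace degrees because the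
  coefficients concerned may vanish.\<close>

lemma coeff_mult_top:
  assumes "degree p \<le> m" "degree q \<le> n"
  shows "coeff (p * q) (m + n) = coeff p m * coeff q n"
proof -
  have "coeff (p * q) (m + n) = (\<Sum>i\<le>m + n. coeff p i * coeff q (m + n - i))" by (rule coeff_mult)
  also have "\<dots> = (\<Sum>i\<in>{m}. coeff p i * coeff q (m + n - i))"
  proof (rule sum.mono_neutral_right)
    show "\<forall>i\<in>{..m + n} - {m}. coeff p i * coeff q (m + n - i) = 0"
    proof
      fix i assume i: "i \<in> {..m + n} - {m}"
      show "coeff p i * coeff q (m + n - i) = 0"
      proof (cases "i > m")
        case True
        then show ?thesis using assms by (simp add: coeff_eq_0)
      next
        case False
        then have "degree q < m + n - i" using assms i by auto
        then show ?thesis by (simp add: coeff_eq_0)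
      qed
    qed
  qed auto
  finally show ?thesis by simp
qed

text \<open>Multiplication by \<open>unit_exp t\<close> removes the negative frequency. The top
  coefficient is recorded for the recursion of leading coefficients.\<close>

lemma diag_poly:
  obtains p where "degree p \<le> 2" "coeff p 2 = - unit_exp s"
    "\<And>t. unit_exp t * of_real (diag E (t + s)) = poly p (unit_exp t)"
proof
  let ?p = "[:- unit_exp (- s), of_real E, - unit_exp s:]"
  show "degree ?p \<le> 2" by simp
  show "coeff ?p 2 = - unit_exp s" by (simp add: numeral_2_eq_2)
  fix t
  have "complex_of_real (2 * cos (2 * pi * (t + s))) = unit_exp (t + s) + unit_exp (- (t + s))"
    unfolding unit_exp_def mult_minus_right by (simp add: complex_eq_iff)
  then have "unit_exp t * of_real (diag E (t + s)) = unit_exp t * (of_real E - (unit_exp (t + s) + unit_exp (- t + - s)))"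
    by (simp add: diag_def)
  also have "\<dots> = of_real E * unit_exp t - unit_exp s * (unit_exp t)\<^sup>2 - unit_exp (- s) * (unit_exp (- t) * unit_exp t)"
    by (simp only: unit_exp_add) (simp add: algebra_simps power2_eq_square)
  also have "\<dots> = poly ?p (unit_exp t)"
    by (simp only: unit_exp_minus) (simp add: algebra_simps power2_eq_square)
  finally show "unit_exp t * of_real (diag E (t + s)) = poly ?p (unit_exp t)" .
qed

lemma offdiag_poly:
  obtains p where "degree p \<le> 4" "coeff p 4 = of_real (a1 * a3) * unit_exp (2 * s + \<alpha>)"
    "\<And>t. unit_exp (2 * t) * of_real (offdiag (a1, a2, a3) \<alpha> (t + s)) = poly p (unit_exp t)"
proof
  \<comment> \<open>With Z = \<open>w * unit_exp t\<close>, the polynomials \<open>p1\<close> and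
    \<open>p2\<close> are Z times \<open>c_fun\<close> and Z times \<open>c_tilde\<close>; the
    scalar in \<open>?p\<close> turns Z^2 into \<open>unit_exp (2 * t)\<close>.\<close>
  define w where "w = unit_exp (s + \<alpha> / 2)"
  define p1 where "p1 = [:of_real a1, of_real a2 * w, of_real a3 * w\<^sup>2:]"
  define p2 where "p2 = [:of_real a3, of_real a2 * w, of_real a1 * w\<^sup>2:]"
  let ?p = "smult (unit_exp (- (2 * s + \<alpha>))) (p1 * p2)"
  have w2: "w\<^sup>2 = unit_exp (2 * s + \<alpha>)"
    unfolding w_def by (subst unit_exp_numeral(1)[symmetric]) (simp add: algebra_simps)
  have d: "degree p1 \<le> 2" "degree p2 \<le> 2" by (simp_all add: p1_def p2_def)
  show "degree ?p \<le> 4"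
    using d degree_mult_le[of p1 p2] degree_smult_le[of "unit_exp (- (2 * s + \<alpha>))" "p1 * p2"] by linarith
  have "coeff (p1 * p2) (2 + 2) = of_real a3 * w\<^sup>2 * (of_real a1 * w\<^sup>2)"
    unfolding coeff_mult_top[OF d] by (simp add: p1_def p2_def numeral_2_eq_2)
  then have "coeff ?p 4 = of_real (a1 * a3) * (unit_exp (- (2 * s + \<alpha>)) * w\<^sup>2) * w\<^sup>2"
    by (simp add: algebra_simps)
  then show "coeff ?p 4 = of_real (a1 * a3) * unit_exp (2 * s + \<alpha>)"
    by (simp only: w2 unit_exp_minus) simp
  fix t
  define Z where "Z = unit_exp (t + s + \<alpha> / 2)"
  define Z' where "Z' = unit_exp (- (t + s + \<alpha> / 2))"
  have ZZ: "Z' * Z = 1" unfolding Z_def Z'_def by (rule unit_exp_minus)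
  have Zw: "Z = w * unit_exp t"
    by (simp add: Z_def w_def add_ac flip: unit_exp_add)
  have Z2: "unit_exp (2 * t) = unit_exp (- (2 * s + \<alpha>)) * Z\<^sup>2"
  proof -
    have "unit_exp (- (2 * s + \<alpha>)) * Z\<^sup>2 = (unit_exp (- (2 * s + \<alpha>)) * w\<^sup>2) * (unit_exp t)\<^sup>2"
      by (simp add: Zw power_mult_distrib)
    then show ?thesis by (simp only: w2 unit_exp_minus unit_exp_numeral) simp
  qed
  have cZ: "cnj Z' = Z" "cnj Z = Z'" unfolding Z_def Z'_def unit_exp_def mult_minus_right cis_cnj by simp_all
  have "of_real (offdiag (a1, a2, a3) \<alpha> (t + s)) = (of_real a1 * Z' + of_real a2 + of_real a3 * Z) * (of_real a1 * Z + of_real a2 + of_real a3 * Z')"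
    unfolding c_fun_c_tilde[symmetric] c_tilde_eq_cnj c_fun_unit_exp Z_def[symmetric] Z'_def[symmetric]
    by (simp add: cZ)
  then have "unit_exp (2 * t) * of_real (offdiag (a1, a2, a3) \<alpha> (t + s))
     = unit_exp (- (2 * s + \<alpha>)) * (((of_real a1 * (Z' * Z) + of_real a2 * Z + of_real a3 * Z\<^sup>2)) * (of_real a1 * Z\<^sup>2 + of_real a2 * Z + of_real a3 * (Z' * Z)))"
    unfolding Z2 by (simp add: algebra_simps power2_eq_square)
  also have "\<dots> = poly ?p (unit_exp t)"
    unfolding ZZ by (simp add: p1_def p2_def Zw algebra_simps power2_eq_square)
  finally show "unit_exp (2 * t) * of_real (offdiag (a1, a2, a3) \<alpha> (t + s)) = poly ?p (unit_exp t)" .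
qed

text \<open>The top Fourier coefficient of \<open>hdet\<close> up to sign and phase; equivalently,
  the determinant of the n x n tridiagonal matrix with diagonal 1 and off-diagonal products
  g.\<close>

fun lead :: "real \<Rightarrow> nat \<Rightarrow> real" where
  "lead g 0 = 1"
| "lead g (Suc 0) = 1"
| "lead g (Suc (Suc n)) = lead g (Suc n) - g * lead g n"

text \<open>The energy does not enter the top coefficient, so bounds derived from it are uniform in
  the energy. The phase collects \<alpha> (0 + 1 + ... + (n - 1)) from the diagonal entries.\<close>

lemma hdet_poly:
  "\<exists>p. degree p \<le> 2 * n
     \<and> coeff p (2 * n) = (- 1) ^ n * of_real (lead (a1 * a3) n) * unit_exp (\<alpha> * (real n * (real n - 1) / 2))
     \<and> (\<forall>t. unit_exp (real n * t) * of_real (hdet (diag E) (offdiag (a1, a2, a3) \<alpha>) \<alpha> n t) = poly p (unit_exp t))"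
proof (induction n rule: induct_nat_012)
  case 0
  show ?case by (intro exI[of _ 1]) simp
next
  case 1
  obtain p where "degree p \<le> 2" "coeff p 2 = - unit_exp 0"
    "\<And>t. unit_exp t * of_real (diag E (t + 0)) = poly p (unit_exp t)"
    using diag_poly[of 0 E] by blast
  then show ?case by (intro exI[of _ p]) (simp add: numeral_2_eq_2)
next
  case (ge2 n)
  let ?h = "hdet (diag E) (offdiag (a1, a2, a3) \<alpha>) \<alpha>"
  let ?e = "\<lambda>n. unit_exp (\<alpha> * (real n * (real n - 1) / 2))"
  let ?l = "\<lambda>n. complex_of_real (lead (a1 * a3) n)"
  obtain p where p: "degree p \<le> 2 * n" "coeff p (2 * n) = (- 1) ^ n * ?l n * ?e n"
    "\<And>t. unit_exp (real n * t) * of_real (?h n t) = poly p (unit_exp t)" using ge2(1) by blast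
  obtain q where q: "degree q \<le> 2 * Suc n" "coeff q (2 * Suc n) = (- 1) ^ Suc n * ?l (Suc n) * ?e (Suc n)"
    "\<And>t. unit_exp (real (Suc n) * t) * of_real (?h (Suc n) t) = poly q (unit_exp t)" using ge2(2) by blast
  obtain r where r: "degree r \<le> 2" "coeff r 2 = - unit_exp (real (Suc n) * \<alpha>)"
    "\<And>t. unit_exp t * of_real (diag E (t + real (Suc n) * \<alpha>)) = poly r (unit_exp t)"
    using diag_poly[of "real (Suc n) * \<alpha>" E] by blast
  obtain s where s: "degree s \<le> 4" "coeff s 4 = of_real (a1 * a3) * unit_exp (2 * (real n * \<alpha>) + \<alpha>)"
    "\<And>t. unit_exp (2 * t) * of_real (offdiag (a1, a2, a3) \<alpha> (t + real n * \<alpha>)) = poly s (unit_exp t)"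
    using offdiag_poly[of a1 a3 "real n * \<alpha>" \<alpha> a2] by blast
  \<comment> \<open>Both terms of the recursion carry the same phase, so their real coefficients
    combine as in \<open>lead\<close>.\<close>
  have e1: "unit_exp (real (Suc n) * \<alpha>) * ?e (Suc n) = ?e (Suc (Suc n))"
    by (simp add: algebra_simps add_divide_distrib flip: unit_exp_add)
  have e2: "unit_exp (2 * (real n * \<alpha>) + \<alpha>) * ?e n = ?e (Suc (Suc n))"
    by (subst unit_exp_add[symmetric], rule arg_cong[of _ _ unit_exp]) (simp add: field_simps)
  show ?case
  proof (intro exI[of _ "r * q - s * p"] conjI allI)
    have "degree (r * q) \<le> 2 + 2 * Suc n" by (rule order.trans[OF degree_mult_le add_mono[OF r(1) q(1)]])
    then have "degree (r * q) \<le> 2 * Suc (Suc n)" by simp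
    moreover have "degree (s * p) \<le> 4 + 2 * n" by (rule order.trans[OF degree_mult_le add_mono[OF s(1) p(1)]])
    then have "degree (s * p) \<le> 2 * Suc (Suc n)" by simp
    ultimately show "degree (r * q - s * p) \<le> 2 * Suc (Suc n)" by (rule degree_diff_le)
    have "coeff (r * q) (2 + 2 * Suc n) = - unit_exp (real (Suc n) * \<alpha>) * ((- 1) ^ Suc n * ?l (Suc n) * ?e (Suc n))"
      unfolding coeff_mult_top[OF r(1) q(1)] q r by simp
    also have "\<dots> = (- 1) ^ n * ?l (Suc n) * (unit_exp (real (Suc n) * \<alpha>) * ?e (Suc n))" by simp
    finally have 1: "coeff (r * q) (2 * Suc (Suc n)) = (- 1) ^ n * ?l (Suc n) * ?e (Suc (Suc n))" unfolding e1 by simp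
    have idx: "4 + 2 * n = 2 * Suc (Suc n)" by simp
    have "coeff (s * p) (4 + 2 * n) = of_real (a1 * a3) * unit_exp (2 * (real n * \<alpha>) + \<alpha>) * ((- 1) ^ n * ?l n * ?e n)"
      unfolding coeff_mult_top[OF s(1) p(1)] p s by simp
    also have "\<dots> = (- 1) ^ n * (of_real (a1 * a3) * ?l n) * (unit_exp (2 * (real n * \<alpha>) + \<alpha>) * ?e n)" by simp
    finally have 2: "coeff (s * p) (2 * Suc (Suc n)) = (- 1) ^ n * (of_real (a1 * a3) * ?l n) * ?e (Suc (Suc n))"
      unfolding e2 idx .
    show "coeff (r * q - s * p) (2 * Suc (Suc n)) = (- 1) ^ Suc (Suc n) * ?l (Suc (Suc n)) * ?e (Suc (Suc n))"
      unfolding coeff_diff 1 2 by (simp add: algebra_simps)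
    fix t
    have x1: "unit_exp (real (Suc (Suc n)) * t) = unit_exp t * unit_exp (real (Suc n) * t)"
      "unit_exp (real (Suc (Suc n)) * t) = unit_exp (2 * t) * unit_exp (real n * t)"
      by (simp_all add: algebra_simps flip: unit_exp_add)
    have "unit_exp (real (Suc (Suc n)) * t) * of_real (?h (Suc (Suc n)) t)
      = unit_exp (real (Suc (Suc n)) * t) * (of_real (diag E (t + real (Suc n) * \<alpha>)) * of_real (?h (Suc n) t))
       - unit_exp (real (Suc (Suc n)) * t) * (of_real (offdiag (a1, a2, a3) \<alpha> (t + real n * \<alpha>)) * of_real (?h n t))"
      by (simp only: hdet.simps of_real_mult of_real_diff right_diff_distrib)
    also have "unit_exp (real (Suc (Suc n)) * t) * (of_real (diag E (t + real (Suc n) * \<alpha>)) * of_real (?h (Suc n) t))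
      = poly r (unit_exp t) * poly q (unit_exp t)"
      unfolding x1(1) r(3)[symmetric] q(3)[symmetric] by (simp only: mult_ac)
    also have "unit_exp (real (Suc (Suc n)) * t) * (of_real (offdiag (a1, a2, a3) \<alpha> (t + real n * \<alpha>)) * of_real (?h n t))
      = poly s (unit_exp t) * poly p (unit_exp t)"
      unfolding x1(2) s(3)[symmetric] p(3)[symmetric] by (simp only: mult_ac)
    finally show "unit_exp (real (Suc (Suc n)) * t) * of_real (?h (Suc (Suc n)) t) = poly (r * q - s * p) (unit_exp t)"
      by simp
  qed
qed

text \<open>Measured from the centre of the interval, the determinant is even in the phase by
  \<open>hdet_reflect\<close>.\<close>

lemma hdet_cos_poly:
  obtains q :: "real poly" where "degree q \<le> n"
    "\<And>y. hdet (diag E) (offdiag (a1, a2, a3) \<alpha>) \<alpha> n (y - (real n - 1) * \<alpha> / 2) = poly q (cos (2 * pi * y))"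
proof -
  let ?h = "hdet (diag E) (offdiag (a1, a2, a3) \<alpha>) \<alpha> n"
  define s where "s = (real n - 1) * \<alpha> / 2"
  obtain p where p: "degree p \<le> 2 * n"
    "\<And>t. unit_exp (real n * t) * of_real (?h t) = poly p (unit_exp t)" using hdet_poly[of n a1 a3 \<alpha> E a2] by blast
  define p' where "p' = smult (unit_exp (real n * s)) (pcompose p [:0, unit_exp (- s):])"
  show thesis
  proof (rule even_trig_poly_cos[of p' n "\<lambda>y. ?h (y - s)"])
    show "degree p' \<le> 2 * n"
      unfolding p'_def using p(1) degree_pcompose_le[of p "[:0, unit_exp (- s):]"]
        degree_smult_le[of "unit_exp (real n * s)" "pcompose p [:0, unit_exp (- s):]"]
      by simp
    show "unit_exp (real n * y) * of_real (?h (y - s)) = poly p' (unit_exp y)" for y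
    proof -
      have "unit_exp (real n * y) = unit_exp (real n * s) * unit_exp (real n * (y - s))"
        "unit_exp y * unit_exp (- s) = unit_exp (y - s)"
        by (simp_all add: algebra_simps flip: unit_exp_add)
      then show ?thesis by (simp add: p'_def poly_pcompose p(2) mult.assoc)
    qed
    show "?h (- y - s) = ?h (y - s)" for y
    proof -
      have "- (y - s) - (real n - 1) * \<alpha> = - y - s" by (simp add: s_def field_simps)
      moreover have "?h (- (y - s) - (real n - 1) * \<alpha>) = ?h (y - s)"
        by (rule hdet_reflect) (simp_all add: diag_even offdiag_reflect)
      ultimately show ?thesis by (simp only:)
    qed
  qed (use that s_def in blast)
qed

text \<open>Herman's argument: the supremum of a trigonometric polynomial dominates its top
  coefficient.\<close>

lemma lead_le_bound:
  assumes "\<And>t. \<bar>hdet (diag E) (offdiag (a1, a2, a3) \<alpha>) \<alpha> n t\<bar> \<le> M"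
  shows "\<bar>lead (a1 * a3) n\<bar> \<le> M"
proof -
  obtain p where p: "coeff p (2 * n) = (- 1) ^ n * of_real (lead (a1 * a3) n) * unit_exp (\<alpha> * (real n * (real n - 1) / 2))"
    "\<And>t. unit_exp (real n * t) * of_real (hdet (diag E) (offdiag (a1, a2, a3) \<alpha>) \<alpha> n t) = poly p (unit_exp t)"
    using hdet_poly[of n a1 a3 \<alpha> E a2] by blast
  have "cmod (coeff p (2 * n)) \<le> M"
    by (rule norm_coeff_le) (use assms in \<open>simp add: norm_mult flip: p(2)\<close>)
  then show ?thesis by (simp add: p(1) norm_mult norm_power)
qed

text \<open>\<kappa> and 1 - \<kappa> are the roots of z^2 - z + g, so the recursion reduces to the
  first-order one in \<open>step\<close>.\<close>

lemma lead_ge: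
  assumes g: "g < 1 / 4"
  defines "\<kappa> \<equiv> (1 + sqrt (1 - 4 * g)) / 2"
  shows "min 1 (1 / \<kappa>) * \<kappa> ^ n \<le> lead g n"
proof -
  have k: "1 / 2 < \<kappa>" using g by (simp add: \<kappa>_def)
  have "(sqrt (1 - 4 * g))\<^sup>2 = 1 - 4 * g" using g by simp
  then have gk: "g = \<kappa> * (1 - \<kappa>)" by (simp add: \<kappa>_def power2_eq_square field_simps)
  have step: "lead g (Suc n) = \<kappa> ^ Suc n + (1 - \<kappa>) * lead g n" for n
  proof (induction n)
    case (Suc n)
    have "lead g (Suc (Suc n)) = \<kappa> * (lead g (Suc n) - (1 - \<kappa>) * lead g n) + (1 - \<kappa>) * lead g (Suc n)"
      by (simp add: gk algebra_simps del: lead.simps(2))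
    then show ?case using Suc by simp
  qed simp
  show ?thesis
  proof (cases "\<kappa> \<le> 1")
    case True
    have "\<kappa> ^ n \<le> lead g n"
    proof (induction n)
      case (Suc n)
      moreover have "0 \<le> \<kappa> ^ n" using k by simp
      ultimately have "0 \<le> (1 - \<kappa>) * lead g n" using True by (intro mult_nonneg_nonneg) auto
      then show ?case unfolding step by simp
    qed simp
    moreover have "min 1 (1 / \<kappa>) * \<kappa> ^ n \<le> 1 * \<kappa> ^ n" using k by (intro mult_right_mono) auto
    ultimately show ?thesis by simp
  next
    case False
    \<comment> \<open>Here 1 - \<kappa> is negative, so the lower bound at n + 1 needs the upper
      bound at n.\<close>
    have "\<kappa> ^ n / \<kappa> \<le> lead g n \<and> lead g n \<le> \<kappa> ^ n"
    proof (induction n)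
      case 0
      show ?case using False by simp
    next
      case (Suc n)
      have "0 \<le> \<kappa> ^ n / \<kappa>" using k by simp
      then have "0 \<le> lead g n" using Suc by linarith
      then have "(1 - \<kappa>) * lead g n \<le> 0" using False by (intro mult_nonpos_nonneg) auto
      moreover have "(1 - \<kappa>) * \<kappa> ^ n \<le> (1 - \<kappa>) * lead g n" using Suc False by (intro mult_left_mono_neg) auto
      ultimately show ?case unfolding step using k by (simp add: algebra_simps)
    qed
    moreover have "min 1 (1 / \<kappa>) = 1 / \<kappa>" using False by (simp add: min_def field_simps)
    ultimately show ?thesis by simp
  qed
qed

section \<open>Mahler measure of the off-diagonal coefficient\<close>

text \<open>A root inside the disc is reflected at the unit circle, so that 1 - w z has no zero in
  the open disc; \<open>max 1 (cmod \<zeta>)\<close> is the Mahler measure of z - \<zeta>.\<close>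

lemma norm_diff_unit_disc:
  obtains w where "cmod w \<le> 1" "\<And>z. cmod z = 1 \<Longrightarrow> cmod (z - \<zeta>) = max 1 (cmod \<zeta>) * cmod (1 - w * z)"
proof (cases "cmod \<zeta> \<le> 1")
  case True
  show thesis
  proof (rule that[of "cnj \<zeta>"])
    fix z :: complex assume z: "cmod z = 1"
    have "z * cnj z = 1" using z complex_norm_square[of z] by simp
    then have "z - \<zeta> = z * cnj (1 - cnj \<zeta> * z)" by (simp add: algebra_simps)
    then have "cmod (z - \<zeta>) = cmod z * cmod (cnj (1 - cnj \<zeta> * z))" by (simp only: norm_mult)
    then show "cmod (z - \<zeta>) = max 1 (cmod \<zeta>) * cmod (1 - cnj \<zeta> * z)"
      using z True by (simp only: complex_mod_cnj) (simp add: max_def)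
  qed (use True in simp)
next
  case False
  show thesis
  proof (rule that[of "1 / \<zeta>"])
    fix z :: complex
    have "z - \<zeta> = - \<zeta> * (1 - 1 / \<zeta> * z)" using False by (auto simp: algebra_simps)
    then have "cmod (z - \<zeta>) = cmod (- \<zeta>) * cmod (1 - 1 / \<zeta> * z)" by (simp only: norm_mult)
    then show "cmod (z - \<zeta>) = max 1 (cmod \<zeta>) * cmod (1 - 1 / \<zeta> * z)" using False by (simp add: max_def)
  qed (use False in \<open>simp add: norm_divide divide_le_eq\<close>)
qed

lemma four_mult_less_1:
  assumes "0 \<le> a + b" "a + b < (1::real)"
  shows "4 * (a * b) < 1"
proof -
  have "4 * (a * b) = (a + b)\<^sup>2 - (a - b)\<^sup>2" by (simp add: power2_eq_square algebra_simps)
  also have "\<dots> \<le> (a + b)\<^sup>2" by simp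
  also have "\<dots> < 1" using assms by (simp add: power_less_one_iff abs_square_less_1)
  finally show ?thesis .
qed

text \<open>The Mahler measure of \<open>a\<^sub>1 + a\<^sub>2 z + a\<^sub>3 z\<^sup>2\<close> is strictly smaller than \<open>\<kappa>\<close>, the Mahler measure
  of the polynomial obtained by replacing \<open>a\<^sub>2\<close> with \<open>1\<close>.\<close>

lemma norm_c_fun_factorization:
  assumes a: "0 \<le> a1 + a3" "a1 + a3 < 1" "0 < a2" "a2 < 1"
  defines "\<kappa> \<equiv> (1 + sqrt (1 - 4 * (a1 * a3))) / 2"
  obtains m w1 w2 where "0 < m" "m < \<kappa>" "cmod w1 \<le> 1" "cmod w2 \<le> 1"
    "\<And>\<alpha> t. cmod (c_fun (a1, a2, a3) \<alpha> t)
        = m * cmod (1 - w1 * unit_exp (t + \<alpha> / 2)) * cmod (1 - w2 * unit_exp (t + \<alpha> / 2))"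
proof -
  have g: "4 * (a1 * a3) < 1" using four_mult_less_1[OF a(1,2)] .
  have k: "1 / 2 < \<kappa>" using g by (simp add: \<kappa>_def)
  have "(sqrt (1 - 4 * (a1 * a3)))\<^sup>2 = 1 - 4 * (a1 * a3)" using g by simp
  then have gk: "a1 * a3 = \<kappa> * (1 - \<kappa>)" by (simp add: \<kappa>_def power2_eq_square field_simps)
  \<comment> \<open>The product is positive, and its factors cannot both be negative since a1 + a3 <
    1 < 2 \<kappa>. With a1 + a3 \<ge> 0 this bounds both moduli by \<kappa>.\<close>
  have "(\<kappa> - a1) * (\<kappa> - a3) = \<kappa> * (1 - (a1 + a3))" using gk by (simp add: algebra_simps)
  also have "\<dots> > 0" using k a by (intro mult_pos_pos) auto
  finally have "0 < (\<kappa> - a1) * (\<kappa> - a3)" .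
  then have "a1 < \<kappa> \<and> a3 < \<kappa>" using k a by (auto simp: zero_less_mult_iff)
  then have k13: "\<bar>a1\<bar> < \<kappa>" "\<bar>a3\<bar> < \<kappa>" using a by auto
  have norm_c: "cmod (c_fun (a1, a2, a3) \<alpha> t)
      = cmod (of_real a1 + of_real a2 * unit_exp (t + \<alpha> / 2) + of_real a3 * (unit_exp (t + \<alpha> / 2))\<^sup>2)" for \<alpha> t
  proof -
    let ?z = "unit_exp (t + \<alpha> / 2)" and ?z' = "unit_exp (- (t + \<alpha> / 2))"
    have "of_real a1 + of_real a2 * ?z + of_real a3 * ?z\<^sup>2
      = ?z * (of_real a1 * ?z' + of_real a2 + of_real a3 * ?z)"
    proof -
      have "?z * (of_real a1 * ?z' + of_real a2 + of_real a3 * ?z)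
        = of_real a1 * (?z' * ?z) + of_real a2 * ?z + of_real a3 * ?z\<^sup>2"
        by (simp only: distrib_left mult_ac power2_eq_square)
      then show ?thesis by (simp only: unit_exp_minus mult_1_right)
    qed
    then show ?thesis by (simp only: c_fun_unit_exp norm_mult norm_unit_exp mult_1_left)
  qed
  show thesis
  proof (cases "a3 = 0")
    case True
    define \<zeta> where "\<zeta> = complex_of_real (- a1 / a2)"
    obtain w where w: "cmod w \<le> 1" "\<And>z. cmod z = 1 \<Longrightarrow> cmod (z - \<zeta>) = max 1 (cmod \<zeta>) * cmod (1 - w * z)"
      using norm_diff_unit_disc by blast
    show thesis
    proof (rule that[of "a2 * max 1 (cmod \<zeta>)" w 0])
      show "0 < a2 * max 1 (cmod \<zeta>)" using a by simp
      have "\<kappa> = 1" using True by (simp add: \<kappa>_def)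
      moreover have "a2 * cmod \<zeta> = a1" using a True by (simp add: \<zeta>_def norm_divide)
      ultimately show "a2 * max 1 (cmod \<zeta>) < \<kappa>" using a True by (simp add: max_def)
      fix \<alpha> t
      have "of_real a1 + of_real a2 * unit_exp (t + \<alpha> / 2) + of_real a3 * (unit_exp (t + \<alpha> / 2))\<^sup>2
        = of_real a2 * (unit_exp (t + \<alpha> / 2) - \<zeta>)"
        using a True by (simp add: \<zeta>_def field_simps)
      then show "cmod (c_fun (a1, a2, a3) \<alpha> t)
        = a2 * max 1 (cmod \<zeta>) * cmod (1 - w * unit_exp (t + \<alpha> / 2)) * cmod (1 - 0 * unit_exp (t + \<alpha> / 2))"
        unfolding norm_c using a w(2)[of "unit_exp (t + \<alpha> / 2)"] by (simp add: norm_mult)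
    qed (use w in auto)
  next
    case False
    define D where "D = a2\<^sup>2 - 4 * (a1 * a3)"
    define s where "s = csqrt (of_real D)"
    have s2: "s * s = of_real D" using power2_csqrt[of "of_real D"] by (simp add: s_def power2_eq_square)
    \<comment> \<open>\<open>x1\<close> and \<open>x2\<close> are \<open>a3\<close> times the roots.
      The Mahler measure is the largest of |a3|, |x1|, |x2| and |a1|, and each of them is less than
      \<kappa>.\<close>
    define x1 where "x1 = (- of_real a2 + s) / 2"
    define x2 where "x2 = (- of_real a2 - s) / 2"
    have x_prod: "x1 * x2 = of_real (a1 * a3)"
    proof -
      have "x1 * x2 = (of_real a2 * of_real a2 - s * s) / 4" by (simp add: x1_def x2_def algebra_simps)
      then show ?thesis unfolding s2 by (simp add: D_def power2_eq_square)
    qed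
    have x_sum: "x1 + x2 = - of_real a2" by (simp add: x1_def x2_def field_simps)
    have x_le: "cmod x1 < \<kappa> \<and> cmod x2 < \<kappa>"
    proof (cases "0 \<le> D")
      case True
      then have s: "s = of_real (sqrt D)" by (simp add: s_def csqrt_of_real_nonneg)
      have "cmod x1 \<le> (a2 + sqrt D) / 2" "cmod x2 \<le> (a2 + sqrt D) / 2"
        using norm_triangle_ineq[of "- of_real a2" s] norm_triangle_ineq4[of "- of_real a2" s] a True
        by (simp_all add: x1_def x2_def norm_divide s)
      moreover have "sqrt D < sqrt (1 - 4 * (a1 * a3))"
        using a by (intro real_sqrt_less_mono) (simp add: D_def power_less_one_iff abs_square_less_1)
      then have "(a2 + sqrt D) / 2 < \<kappa>"
        unfolding \<kappa>_def using a by (intro divide_strict_right_mono add_strict_mono) auto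
      ultimately show ?thesis by linarith
    next
      case False
      then have g0: "0 < a1 * a3" unfolding D_def using zero_le_power2[of a2] by linarith
      have s: "s = \<i> * of_real (sqrt (- D))" using False by (simp add: s_def csqrt_of_real_nonpos)
      have "(cmod x1)\<^sup>2 = a1 * a3" "(cmod x2)\<^sup>2 = a1 * a3"
        using False unfolding cmod_power2 x1_def x2_def s D_def
        by (simp_all add: power_divide field_simps)
      moreover have "a1 * a3 < \<kappa>\<^sup>2"
      proof -
        have "\<kappa> * (1 - \<kappa>) < \<kappa> * \<kappa>" using k by (intro mult_strict_left_mono) auto
        then show ?thesis by (simp add: gk power2_eq_square)
      qed
      ultimately show ?thesis using k by (auto intro: power2_less_imp_less)
    qed
    define z1 where "z1 = x1 / of_real a3"
    define z2 where "z2 = x2 / of_real a3"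
    obtain w1 where w1: "cmod w1 \<le> 1" "\<And>z. cmod z = 1 \<Longrightarrow> cmod (z - z1) = max 1 (cmod z1) * cmod (1 - w1 * z)"
      using norm_diff_unit_disc by blast
    obtain w2 where w2: "cmod w2 \<le> 1" "\<And>z. cmod z = 1 \<Longrightarrow> cmod (z - z2) = max 1 (cmod z2) * cmod (1 - w2 * z)"
      using norm_diff_unit_disc by blast
    show thesis
    proof (rule that[of "\<bar>a3\<bar> * max 1 (cmod z1) * max 1 (cmod z2)" w1 w2])
      show "0 < \<bar>a3\<bar> * max 1 (cmod z1) * max 1 (cmod z2)" using False by simp
      have m: "\<bar>a3\<bar> * cmod z1 = cmod x1" "\<bar>a3\<bar> * cmod z2 = cmod x2"
        using False by (simp_all add: z1_def z2_def norm_divide)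
      have "\<bar>a3\<bar> * (\<bar>a3\<bar> * cmod z1 * cmod z2) = cmod (x1 * x2)"
        unfolding norm_mult m[symmetric] by (simp add: algebra_simps)
      also have "\<dots> = \<bar>a3\<bar> * \<bar>a1\<bar>" unfolding x_prod norm_of_real abs_mult by (rule mult.commute)
      finally have "\<bar>a3\<bar> * cmod z1 * cmod z2 = \<bar>a1\<bar>" using False by simp
      then show "\<bar>a3\<bar> * max 1 (cmod z1) * max 1 (cmod z2) < \<kappa>"
        using x_le k13 m by (auto simp: max_def)
      fix \<alpha> t
      let ?z = "unit_exp (t + \<alpha> / 2)"
      have xz: "x1 = of_real a3 * z1" "x2 = of_real a3 * z2" using False by (simp_all add: z1_def z2_def)
      have "of_real a3 * (of_real a1 + of_real a2 * ?z + of_real a3 * ?z\<^sup>2)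
        = x1 * x2 - (x1 + x2) * (of_real a3 * ?z) + (of_real a3 * ?z) * (of_real a3 * ?z)"
        unfolding x_prod x_sum by (simp add: algebra_simps power2_eq_square)
      also have "\<dots> = of_real a3 * (of_real a3 * ((?z - z1) * (?z - z2)))"
        unfolding xz by (simp add: algebra_simps)
      finally have "of_real a1 + of_real a2 * ?z + of_real a3 * ?z\<^sup>2 = of_real a3 * ((?z - z1) * (?z - z2))"
        using False by simp
      then show "cmod (c_fun (a1, a2, a3) \<alpha> t)
        = \<bar>a3\<bar> * max 1 (cmod z1) * max 1 (cmod z2) * cmod (1 - w1 * ?z) * cmod (1 - w2 * ?z)"
        unfolding norm_c using w1(2)[of ?z] w2(2)[of ?z] by (simp add: norm_mult mult_ac)
    qed (use w1 w2 in auto)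
  qed
qed

context irrational
begin

text \<open>The products of the factors 1 - w z grow at an arbitrarily small rate. A quarter of the
  gap between ln m and ln \<kappa> for each of the two leaves half of the gap.\<close>

lemma prod_norm_c_fun_le:
  assumes a: "0 \<le> a1 + a3" "a1 + a3 < 1" "0 < a2" "a2 < 1"
  defines "\<kappa> \<equiv> (1 + sqrt (1 - 4 * (a1 * a3))) / 2"
  obtains b C where "b < ln \<kappa>" "1 \<le> C"
    "\<And>n x. (\<Prod>j<n. cmod (c_fun (a1, a2, a3) \<alpha> (x + real j * \<alpha>))) \<le> C * exp (b * real n)"
proof -
  obtain m w1 w2 where m: "0 < m" "m < \<kappa>" and w: "cmod w1 \<le> 1" "cmod w2 \<le> 1"
    and c: "\<And>\<alpha> t. cmod (c_fun (a1, a2, a3) \<alpha> t)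
        = m * cmod (1 - w1 * unit_exp (t + \<alpha> / 2)) * cmod (1 - w2 * unit_exp (t + \<alpha> / 2))"
    unfolding \<kappa>_def using norm_c_fun_factorization[OF a] by blast
  define \<eta> where "\<eta> = (ln \<kappa> - ln m) / 4"
  have \<eta>: "0 < \<eta>" using m by (simp add: \<eta>_def)
  obtain C1 where C1: "1 \<le> C1"
    "\<And>n x. (\<Prod>j<n. cmod (1 - w1 * cis (2 * pi * (x + real j * \<alpha>)))) \<le> C1 * exp (\<eta> * real n)"
    using prod_norm_1_minus_le[OF w(1) \<eta>] by blast
  obtain C2 where C2: "1 \<le> C2"
    "\<And>n x. (\<Prod>j<n. cmod (1 - w2 * cis (2 * pi * (x + real j * \<alpha>)))) \<le> C2 * exp (\<eta> * real n)"
    using prod_norm_1_minus_le[OF w(2) \<eta>] by blast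
  show thesis
  proof (rule that[of "ln m + 2 * \<eta>" "C1 * C2"])
    have "ln m < ln \<kappa>" using m by simp
    then show "ln m + 2 * \<eta> < ln \<kappa>" by (simp add: \<eta>_def diff_divide_distrib del: ln_less_cancel_iff)
    show "1 \<le> C1 * C2" using C1 C2 by (metis mult_mono' mult_1 zero_le_one)
    fix n x
    have e: "unit_exp (x + real j * \<alpha> + \<alpha> / 2) = cis (2 * pi * ((x + \<alpha> / 2) + real j * \<alpha>))" for j
      unfolding unit_exp_def by (simp add: algebra_simps)
    have "(\<Prod>j<n. cmod (c_fun (a1, a2, a3) \<alpha> (x + real j * \<alpha>)))
      = m ^ n * (\<Prod>j<n. cmod (1 - w1 * cis (2 * pi * ((x + \<alpha> / 2) + real j * \<alpha>))))
          * (\<Prod>j<n. cmod (1 - w2 * cis (2 * pi * ((x + \<alpha> / 2) + real j * \<alpha>))))"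
      unfolding c e by (simp add: prod.distrib)
    also have "\<dots> \<le> m ^ n * (C1 * exp (\<eta> * real n)) * (C2 * exp (\<eta> * real n))"
      using m C1 C2 by (intro mult_mono mult_nonneg_nonneg prod_nonneg) auto
    also have "m ^ n = exp (ln m * real n)" using m by (simp add: exp_of_nat2_mult)
    also have "exp (ln m * real n) * (C1 * exp (\<eta> * real n)) * (C2 * exp (\<eta> * real n))
      = C1 * C2 * (exp (ln m * real n) * exp (\<eta> * real n) * exp (\<eta> * real n))" by simp
    also have "\<dots> = C1 * C2 * exp ((ln m + 2 * \<eta>) * real n)"
      by (simp add: algebra_simps flip: exp_add)
    finally show "(\<Prod>j<n. cmod (c_fun (a1, a2, a3) \<alpha> (x + real j * \<alpha>))) \<le> C1 * C2 * exp ((ln m + 2 * \<eta>) * real n)" .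
  qed
qed

end

section \<open>Interpolation at orbit points\<close>

lemma prod_int_interval:
  "(\<Prod>j\<in>{a..<a + int n}. f j) = (\<Prod>k<n. f (a + int k) :: real)"
proof (induction n)
  case (Suc n)
  have "{a..<a + int (Suc n)} = insert (a + int n) {a..<a + int n}" by auto
  then show ?case using Suc by (simp add: mult.commute)
qed simp

text \<open>Lagrange products omit one node; an interval without one point is a union of two
  intervals, to which the orbit estimates apply.\<close>

lemma prod_int_interval_remove:
  fixes f :: "int \<Rightarrow> real"
  obtains n1 n2 i' where "n1 + n2 \<le> n"
    "(\<Prod>j\<in>{a..<a + int n} - {i}. f j) = (\<Prod>k<n1. f (a + int k)) * (\<Prod>k<n2. f (i' + int k))"
    "\<And>k. k < n1 \<Longrightarrow> a + int k \<in> {a..<a + int n} - {i}"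
    "\<And>k. k < n2 \<Longrightarrow> i' + int k \<in> {a..<a + int n} - {i}"
proof (cases "i \<in> {a..<a + int n}")
  case True
  define n1 where "n1 = nat (i - a)"
  define n2 where "n2 = nat (a + int n - (i + 1))"
  have i: "i = a + int n1" using True by (simp add: n1_def)
  have "{a..<a + int n} - {i} = {a..<a + int n1} \<union> {i + 1..<i + 1 + int n2}"
    using True by (auto simp: n1_def n2_def)
  then have "(\<Prod>j\<in>{a..<a + int n} - {i}. f j) = (\<Prod>j\<in>{a..<a + int n1}. f j) * (\<Prod>j\<in>{i + 1..<i + 1 + int n2}. f j)"
    by (simp add: i prod.union_disjoint)
  then show thesis
    unfolding prod_int_interval by (rule that[rotated]) (use True in \<open>auto simp: n1_def n2_def\<close>)
next
  case False
  then show thesis by (intro that[of n 0]) (auto simp: prod_int_interval)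
qed

context zero_beta
begin

text \<open>Each of the two intervals breaks into at most two runs of the orbit, so the constant for
  one run occurs four times.\<close>

lemma prod_two_intervals_le:
  assumes "0 < \<eta>"
  obtains C where "0 \<le> C"
    "\<And>a1 n1 a2 n2 i x. {a1..<a1 + int n1} \<inter> {a2..<a2 + int n2} = {} \<Longrightarrow>
      (\<Prod>j\<in>({a1..<a1 + int n1} \<union> {a2..<a2 + int n2}) - {i}. cmod (1 - unit_exp (x + of_int j * \<alpha>)))
        \<le> exp (\<eta> * real (n1 + n2) + C)"
proof -
  obtain C where C: "1 \<le> C"
    "\<And>n x. (\<Prod>j<n. cmod (1 - 1 * cis (2 * pi * (x + real j * \<alpha>)))) \<le> C * exp (\<eta> * real n)"
    using prod_norm_1_minus_le[of 1 \<eta>] assms by auto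
  let ?f = "\<lambda>x j :: int. cmod (1 - unit_exp (x + of_int j * \<alpha>))"
  have shift: "(\<Prod>k<n. ?f x (a + int k)) \<le> C * exp (\<eta> * real n)" for n a x
    using C(2)[where n = n and x = "x + of_int a * \<alpha>"] by (simp add: unit_exp_def algebra_simps)
  have one: "(\<Prod>j\<in>{a..<a + int n} - {i}. ?f x j) \<le> C\<^sup>2 * exp (\<eta> * real n)" for a n i x
  proof -
    obtain m1 m2 i' where m: "m1 + m2 \<le> n"
      "(\<Prod>j\<in>{a..<a + int n} - {i}. ?f x j) = (\<Prod>k<m1. ?f x (a + int k)) * (\<Prod>k<m2. ?f x (i' + int k))"
      using prod_int_interval_remove[where n = n and a = a and i = i and f = "?f x"] by metis
    have "(\<Prod>j\<in>{a..<a + int n} - {i}. ?f x j) \<le> (C * exp (\<eta> * real m1)) * (C * exp (\<eta> * real m2))"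
      unfolding m(2) using C by (intro mult_mono shift prod_nonneg) auto
    also have "\<dots> = C\<^sup>2 * exp (\<eta> * real (m1 + m2))"
      by (simp add: power2_eq_square algebra_simps exp_add)
    also have "\<dots> \<le> C\<^sup>2 * exp (\<eta> * real n)"
      using m(1) assms by (intro mult_left_mono) auto
    finally show ?thesis .
  qed
  show thesis
  proof (rule that[of "4 * ln C"])
    show "0 \<le> 4 * ln C" using C by simp
    fix a1 n1 a2 n2 i x
    assume dis: "{a1..<a1 + int n1} \<inter> {a2..<a2 + int n2} = {}"
    have "(\<Prod>j\<in>({a1..<a1 + int n1} \<union> {a2..<a2 + int n2}) - {i}. ?f x j)
      = (\<Prod>j\<in>{a1..<a1 + int n1} - {i}. ?f x j) * (\<Prod>j\<in>{a2..<a2 + int n2} - {i}. ?f x j)"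
      unfolding Un_Diff by (rule prod.union_disjoint) (use dis in auto)
    also have "\<dots> \<le> (C\<^sup>2 * exp (\<eta> * real n1)) * (C\<^sup>2 * exp (\<eta> * real n2))"
      by (intro mult_mono one prod_nonneg) auto
    also have "\<dots> = C ^ 4 * exp (\<eta> * real (n1 + n2))"
      by (simp add: algebra_simps exp_add flip: power_add)
    also have "C ^ 4 = exp (4 * ln C)" using C by (simp add: exp_of_nat_mult[of 4, simplified])
    also have "exp (4 * ln C) * exp (\<eta> * real (n1 + n2)) = exp (\<eta> * real (n1 + n2) + 4 * ln C)"
      by (simp add: exp_add)
    finally show "(\<Prod>j\<in>({a1..<a1 + int n1} \<union> {a2..<a2 + int n2}) - {i}. ?f x j)
      \<le> exp (\<eta> * real (n1 + n2) + 4 * ln C)" .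
  qed
qed

text \<open>The same decomposition into runs. Separation is assumed only off the omitted index,
  where the factor may vanish.\<close>

lemma prod_two_intervals_ge:
  assumes "0 < \<eta>"
  obtains C where "0 \<le> C"
    "\<And>a1 n1 a2 n2 i x \<rho>. {a1..<a1 + int n1} \<inter> {a2..<a2 + int n2} = {} \<Longrightarrow> 0 \<le> \<rho> \<Longrightarrow>
      (\<And>j. j \<in> ({a1..<a1 + int n1} \<union> {a2..<a2 + int n2}) - {i} \<Longrightarrow> exp (- \<rho>) \<le> dist_int (x + of_int j * \<alpha>)) \<Longrightarrow>
      exp (- \<eta> * real (n1 + n2) - C - C * \<rho>)
        \<le> (\<Prod>j\<in>({a1..<a1 + int n1} \<union> {a2..<a2 + int n2}) - {i}. cmod (1 - unit_exp (x + of_int j * \<alpha>)))"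
proof -
  obtain C where C: "0 \<le> C"
    "\<And>n x \<rho>. 0 \<le> \<rho> \<Longrightarrow> (\<And>j. j < n \<Longrightarrow> exp (- \<rho>) \<le> dist_int (x + real j * \<alpha>)) \<Longrightarrow>
       exp (- \<eta> * real n - C - C * \<rho>) \<le> (\<Prod>j<n. cmod (1 - cis (2 * pi * (x + real j * \<alpha>))))"
    using prod_norm_1_minus_ge[OF assms] by blast
  let ?f = "\<lambda>x j :: int. cmod (1 - unit_exp (x + of_int j * \<alpha>))"
  have arg: "x + of_int a * \<alpha> + real k * \<alpha> = x + of_int (a + int k) * \<alpha>" for x a k
    by (simp add: algebra_simps)
  have shift: "exp (- \<eta> * real n - C - C * \<rho>) \<le> (\<Prod>k<n. ?f x (a + int k))"
    if "0 \<le> \<rho>" "\<And>k. k < n \<Longrightarrow> exp (- \<rho>) \<le> dist_int (x + of_int (a + int k) * \<alpha>)" for n a x \<rho>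
    using C(2)[where n = n and x = "x + of_int a * \<alpha>", OF that(1)] that(2) unfolding arg unit_exp_def by blast
  have one: "exp (- \<eta> * real n - 2 * C - 2 * C * \<rho>) \<le> (\<Prod>j\<in>{a..<a + int n} - {i}. ?f x j)"
    if \<rho>: "0 \<le> \<rho>" and sep: "\<And>j. j \<in> {a..<a + int n} - {i} \<Longrightarrow> exp (- \<rho>) \<le> dist_int (x + of_int j * \<alpha>)" for a n i x \<rho>
  proof -
    obtain m1 m2 i' where m: "m1 + m2 \<le> n"
      "(\<Prod>j\<in>{a..<a + int n} - {i}. ?f x j) = (\<Prod>k<m1. ?f x (a + int k)) * (\<Prod>k<m2. ?f x (i' + int k))"
      "\<And>k. k < m1 \<Longrightarrow> a + int k \<in> {a..<a + int n} - {i}"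
      "\<And>k. k < m2 \<Longrightarrow> i' + int k \<in> {a..<a + int n} - {i}"
      by (rule prod_int_interval_remove[where n = n and a = a and i = i and f = "?f x"], rule that)
    have "\<eta> * real (m1 + m2) \<le> \<eta> * real n" using m(1) assms by (intro mult_left_mono) auto
    then have "exp (- \<eta> * real n - 2 * C - 2 * C * \<rho>) \<le> exp ((- \<eta> * real m1 - C - C * \<rho>) + (- \<eta> * real m2 - C - C * \<rho>))"
      by (simp add: algebra_simps)
    also have "\<dots> = exp (- \<eta> * real m1 - C - C * \<rho>) * exp (- \<eta> * real m2 - C - C * \<rho>)" by (rule exp_add)
    also have "\<dots> \<le> (\<Prod>k<m1. ?f x (a + int k)) * (\<Prod>k<m2. ?f x (i' + int k))"
      by (intro mult_mono shift \<rho> sep m(3,4) prod_nonneg) auto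
    finally show ?thesis unfolding m(2) .
  qed
  show thesis
  proof (rule that[of "4 * C"])
    show "0 \<le> 4 * C" using C by simp
    fix a1 n1 a2 n2 i x \<rho>
    assume dis: "{a1..<a1 + int n1} \<inter> {a2..<a2 + int n2} = {}" and \<rho>: "0 \<le> \<rho>"
      and sep: "\<And>j. j \<in> ({a1..<a1 + int n1} \<union> {a2..<a2 + int n2}) - {i} \<Longrightarrow> exp (- \<rho>) \<le> dist_int (x + of_int j * \<alpha>)"
    have "exp (- \<eta> * real (n1 + n2) - 4 * C - 4 * C * \<rho>)
      = exp (- \<eta> * real n1 - 2 * C - 2 * C * \<rho>) * exp (- \<eta> * real n2 - 2 * C - 2 * C * \<rho>)"
      by (simp add: algebra_simps flip: exp_add)
    also have "\<dots> \<le> (\<Prod>j\<in>{a1..<a1 + int n1} - {i}. ?f x j) * (\<Prod>j\<in>{a2..<a2 + int n2} - {i}. ?f x j)"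
      by (intro mult_mono one \<rho> sep prod_nonneg) auto
    also have "\<dots> = (\<Prod>j\<in>({a1..<a1 + int n1} \<union> {a2..<a2 + int n2}) - {i}. ?f x j)"
      unfolding Un_Diff by (rule prod.union_disjoint[symmetric]) (use dis in auto)
    finally show "exp (- \<eta> * real (n1 + n2) - 4 * C - 4 * C * \<rho>)
      \<le> (\<Prod>j\<in>({a1..<a1 + int n1} \<union> {a2..<a2 + int n2}) - {i}. ?f x j)" by simp
  qed
qed

end

text \<open>For two nodes of the interpolation, the factor in u + v sees the resonances of 2
  \<theta>, the factor in v - u the small divisors of \<alpha>.\<close>

lemma cos_diff_unit_exp:
  "\<bar>cos (2 * pi * u) - cos (2 * pi * v)\<bar> = cmod (1 - unit_exp (u + v)) * cmod (1 - unit_exp (v - u)) / 2"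
proof -
  have "cos (2 * pi * u) - cos (2 * pi * v) = 2 * sin (pi * (u + v)) * sin (pi * (v - u))"
    by (subst cos_diff_cos) (simp add: algebra_simps add_divide_distrib diff_divide_distrib)
  then show ?thesis unfolding unit_exp_def norm_1_minus_cis by (simp add: abs_mult)
qed

context zero_beta
begin

text \<open>Lagrange interpolation at N + 1 phases of one orbit. Numerators are bounded without any
  hypothesis, denominators by means of the separation exp (- \<rho>). The constant is uniform in
  couplings, energy, phase and scale.\<close>

lemma hdet_interpolation:
  assumes "0 < \<eta>"
  shows "\<exists>C\<ge>0. \<forall>a E N \<theta> \<rho> s1 n1 s2 n2 \<mu> t.
      n1 + n2 = Suc N \<longrightarrow> {s1..<s1 + int n1} \<inter> {s2..<s2 + int n2} = {} \<longrightarrow> 0 \<le> \<rho> \<longrightarrow>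
      (\<forall>i\<in>{s1..<s1 + int n1} \<union> {s2..<s2 + int n2}. \<forall>j\<in>{s1..<s1 + int n1} \<union> {s2..<s2 + int n2}. i \<noteq> j \<longrightarrow>
         exp (- \<rho>) \<le> dist_int (2 * \<theta> + of_int (i + j + int N - 1) * \<alpha>) \<and> exp (- \<rho>) \<le> dist_int (of_int (j - i) * \<alpha>)) \<longrightarrow>
      (\<forall>i\<in>{s1..<s1 + int n1} \<union> {s2..<s2 + int n2}. \<bar>hdet (diag E) (offdiag a \<alpha>) \<alpha> N (\<theta> + of_int i * \<alpha>)\<bar> \<le> \<mu>) \<longrightarrow>
      \<bar>hdet (diag E) (offdiag a \<alpha>) \<alpha> N t\<bar> \<le> real (Suc N) * \<mu> * exp (\<eta> * real (Suc N) + C + C * \<rho>)"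
proof -
  obtain C1 where C1: "0 \<le> C1"
    "\<And>a1 n1 a2 n2 i x. {a1..<a1 + int n1} \<inter> {a2..<a2 + int n2} = {} \<Longrightarrow>
      (\<Prod>j\<in>({a1..<a1 + int n1} \<union> {a2..<a2 + int n2}) - {i}. cmod (1 - unit_exp (x + of_int j * \<alpha>)))
        \<le> exp (\<eta> / 4 * real (n1 + n2) + C1)"
    using prod_two_intervals_le[of "\<eta> / 4"] assms by auto
  obtain C2 where C2: "0 \<le> C2"
    "\<And>a1 n1 a2 n2 i x \<rho>. {a1..<a1 + int n1} \<inter> {a2..<a2 + int n2} = {} \<Longrightarrow> 0 \<le> \<rho> \<Longrightarrow>
      (\<And>j. j \<in> ({a1..<a1 + int n1} \<union> {a2..<a2 + int n2}) - {i} \<Longrightarrow> exp (- \<rho>) \<le> dist_int (x + of_int j * \<alpha>)) \<Longrightarrow>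
      exp (- (\<eta> / 4) * real (n1 + n2) - C2 - C2 * \<rho>)
        \<le> (\<Prod>j\<in>({a1..<a1 + int n1} \<union> {a2..<a2 + int n2}) - {i}. cmod (1 - unit_exp (x + of_int j * \<alpha>)))"
    using prod_two_intervals_ge[of "\<eta> / 4"] assms by (auto simp del: mult_minus_left)
  show ?thesis
  proof (rule exI[of _ "2 * C1 + 2 * C2"], intro conjI allI impI)
    show "0 \<le> 2 * C1 + 2 * C2" using C1 C2 by simp
    fix a :: coupling and E \<theta> \<rho> \<mu> t :: real and N n1 n2 :: nat and s1 s2 :: int
    define A where "A = {s1..<s1 + int n1} \<union> {s2..<s2 + int n2}"
    let ?h = "hdet (diag E) (offdiag a \<alpha>) \<alpha> N"
    assume n: "n1 + n2 = Suc N" and dis: "{s1..<s1 + int n1} \<inter> {s2..<s2 + int n2} = {}" and \<rho>: "0 \<le> \<rho>"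
      and "\<forall>i\<in>{s1..<s1 + int n1} \<union> {s2..<s2 + int n2}. \<forall>j\<in>{s1..<s1 + int n1} \<union> {s2..<s2 + int n2}. i \<noteq> j \<longrightarrow>
         exp (- \<rho>) \<le> dist_int (2 * \<theta> + of_int (i + j + int N - 1) * \<alpha>) \<and> exp (- \<rho>) \<le> dist_int (of_int (j - i) * \<alpha>)"
      and "\<forall>i\<in>{s1..<s1 + int n1} \<union> {s2..<s2 + int n2}. \<bar>?h (\<theta> + of_int i * \<alpha>)\<bar> \<le> \<mu>"
    then have sep: "\<And>i j. i \<in> A \<Longrightarrow> j \<in> A \<Longrightarrow> i \<noteq> j \<Longrightarrow>
         exp (- \<rho>) \<le> dist_int (2 * \<theta> + of_int (i + j + int N - 1) * \<alpha>) \<and> exp (- \<rho>) \<le> dist_int (of_int (j - i) * \<alpha>)"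
      and small: "\<And>i. i \<in> A \<Longrightarrow> \<bar>?h (\<theta> + of_int i * \<alpha>)\<bar> \<le> \<mu>"
      unfolding A_def by simp_all
    have fin: "finite A" by (simp add: A_def)
    have card: "card A = Suc N" unfolding A_def using dis n by (simp add: card_Un_disjoint)
    \<comment> \<open>The recentred phase: twice its value is 2 \<theta> + (N - 1) \<alpha>, whence
      the shift by N - 1 in the separation hypothesis.\<close>
    define \<theta>' where "\<theta>' = \<theta> + (real N - 1) * \<alpha> / 2"
    define X where "X i = cos (2 * pi * (\<theta>' + of_int i * \<alpha>))" for i :: int
    define P where "P i x = (\<Prod>j\<in>A - {i}. cmod (1 - unit_exp (x + of_int j * \<alpha>)))" for i x
    have diff: "\<bar>cos (2 * pi * y) - X j\<bar> = cmod (1 - unit_exp ((y + \<theta>') + of_int j * \<alpha>)) * cmod (1 - unit_exp ((\<theta>' - y) + of_int j * \<alpha>)) / 2" for y j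
      unfolding X_def cos_diff_unit_exp by (simp add: algebra_simps)
    have prod_diff: "(\<Prod>j\<in>A - {i}. \<bar>cos (2 * pi * y) - X j\<bar>) = P i (y + \<theta>') * P i (\<theta>' - y) / 2 ^ card (A - {i})" for i y
      unfolding diff P_def by (simp add: prod.distrib prod_dividef)
    have P_le: "P i x \<le> exp (\<eta> / 4 * real (Suc N) + C1)" for i x
      unfolding P_def A_def n[symmetric] by (rule C1(2)[OF dis])
    have P_ge: "exp (- (\<eta> / 4) * real (Suc N) - C2 - C2 * \<rho>) \<le> P i x"
      if "\<And>j. j \<in> A - {i} \<Longrightarrow> exp (- \<rho>) \<le> dist_int (x + of_int j * \<alpha>)" for i x
      unfolding P_def A_def n[symmetric] by (rule C2(2)[OF dis \<rho>]) (use that A_def in blast)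
    have P0: "0 \<le> P i x" for i x by (auto simp: P_def intro!: prod_nonneg)
    have sep1: "exp (- \<rho>) \<le> dist_int ((\<theta>' + of_int i * \<alpha> + \<theta>') + of_int j * \<alpha>)"
      and sep2: "exp (- \<rho>) \<le> dist_int ((\<theta>' - (\<theta>' + of_int i * \<alpha>)) + of_int j * \<alpha>)"
      if "i \<in> A" "j \<in> A - {i}" for i j
    proof -
      have "(\<theta>' + of_int i * \<alpha> + \<theta>') + of_int j * \<alpha> = 2 * \<theta> + of_int (i + j + int N - 1) * \<alpha>"
        "(\<theta>' - (\<theta>' + of_int i * \<alpha>)) + of_int j * \<alpha> = of_int (j - i) * \<alpha>"
        by (simp_all add: \<theta>'_def field_simps)
      then show "exp (- \<rho>) \<le> dist_int ((\<theta>' + of_int i * \<alpha> + \<theta>') + of_int j * \<alpha>)"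
        "exp (- \<rho>) \<le> dist_int ((\<theta>' - (\<theta>' + of_int i * \<alpha>)) + of_int j * \<alpha>)"
        using sep[of i j] that by (simp_all only:) auto
    qed
    have inj: "inj_on X A"
    proof (rule inj_onI, rule ccontr)
      fix i j assume ij: "i \<in> A" "j \<in> A" "X i = X j" "i \<noteq> j"
      have "0 < cmod (1 - unit_exp x)" if "exp (- \<rho>) \<le> dist_int x" for x
        using that norm_1_minus_cis_ge[of x] exp_gt_zero[of "- \<rho>"] unfolding unit_exp_def by linarith
      then have "0 < \<bar>cos (2 * pi * (\<theta>' + of_int i * \<alpha>)) - X j\<bar>"
        unfolding diff using sep1[of i j] sep2[of i j] ij by (intro divide_pos_pos mult_pos_pos) auto
      then show False using ij(3) by (simp add: X_def)
    qed
    obtain a1 a2 a3 where a: "a = (a1, a2, a3)" by (cases a)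
    have "\<exists>q. degree q \<le> N \<and> (\<forall>y. ?h (y - (real N - 1) * \<alpha> / 2) = poly q (cos (2 * pi * y)))"
      unfolding a using hdet_cos_poly[of N E a1 a2 a3 \<alpha>] by blast
    then obtain q where q: "degree q \<le> N" "\<And>y. ?h (y - (real N - 1) * \<alpha> / 2) = poly q (cos (2 * pi * y))"
      by blast
    \<comment> \<open>Two numerator and two denominator products, each with a quarter of \<eta>; the
      powers of 2 from \<open>cos_diff_unit_exp\<close> cancel.\<close>
    define L where "L = exp (\<eta> * real (Suc N) + (2 * C1 + 2 * C2) + (2 * C1 + 2 * C2) * \<rho>)"
    have "\<bar>poly q (cos (2 * pi * y))\<bar> \<le> real (card A) * \<mu> * L" for y
    proof (rule poly_lagrange_bound[OF fin inj])
      show "degree q < card A" using q card by simp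
      fix i assume i: "i \<in> A"
      have "\<theta>' + of_int i * \<alpha> - (real N - 1) * \<alpha> / 2 = \<theta> + of_int i * \<alpha>" by (simp add: \<theta>'_def)
      then have "poly q (X i) = ?h (\<theta> + of_int i * \<alpha>)" unfolding X_def by (metis q(2))
      then show "\<bar>poly q (X i)\<bar> \<le> \<mu>" using small[OF i] by simp
      let ?D = "P i (\<theta>' + of_int i * \<alpha> + \<theta>') * P i (\<theta>' - (\<theta>' + of_int i * \<alpha>))"
      have "exp (- (\<eta> / 4) * real (Suc N) - C2 - C2 * \<rho>) * exp (- (\<eta> / 4) * real (Suc N) - C2 - C2 * \<rho>) \<le> ?D"
        by (intro mult_mono P_ge sep1 sep2 i P0) auto
      then have "L * (exp (- (\<eta> / 4) * real (Suc N) - C2 - C2 * \<rho>) * exp (- (\<eta> / 4) * real (Suc N) - C2 - C2 * \<rho>)) \<le> L * ?D"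
        by (intro mult_left_mono) (auto simp: L_def)
      moreover have "exp (\<eta> / 4 * real (Suc N) + C1) * exp (\<eta> / 4 * real (Suc N) + C1)
        \<le> L * (exp (- (\<eta> / 4) * real (Suc N) - C2 - C2 * \<rho>) * exp (- (\<eta> / 4) * real (Suc N) - C2 - C2 * \<rho>))"
        unfolding L_def exp_add[symmetric] using C1 \<rho> by (simp add: algebra_simps)
      moreover have "P i (y + \<theta>') * P i (\<theta>' - y) \<le> exp (\<eta> / 4 * real (Suc N) + C1) * exp (\<eta> / 4 * real (Suc N) + C1)"
        by (intro mult_mono P_le P0) auto
      ultimately have "P i (y + \<theta>') * P i (\<theta>' - y) \<le> L * ?D" by linarith
      then have "P i (y + \<theta>') * P i (\<theta>' - y) / 2 ^ card (A - {i}) \<le> L * ?D / 2 ^ card (A - {i})"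
        by (rule divide_right_mono) simp
      then show "(\<Prod>j\<in>A - {i}. \<bar>cos (2 * pi * y) - X j\<bar>) \<le> L * (\<Prod>j\<in>A - {i}. \<bar>X i - X j\<bar>)"
        unfolding prod_diff X_def[of i] by simp
    qed
    from this[of "t + (real N - 1) * \<alpha> / 2"] have "\<bar>?h t\<bar> \<le> real (card A) * \<mu> * L"
      unfolding q(2)[symmetric] by simp
    then show "\<bar>?h t\<bar> \<le> real (Suc N) * \<mu> * exp (\<eta> * real (Suc N) + (2 * C1 + 2 * C2) + (2 * C1 + 2 * C2) * \<rho>)"
      unfolding card L_def .
  qed
qed

end

section \<open>Almost localization\<close>

text \<open>The enumeration is increasing, so a modulus below entry j + 1 has index at most
  j.\<close>

lemma resonance_modulus_le:
  assumes x: "x \<in> resonance_moduli \<epsilon> \<alpha> \<theta>"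
    and j: "resonance_abs \<epsilon> \<alpha> \<theta> j = ereal r"
    and less: "ereal (real x) < resonance_abs \<epsilon> \<alpha> \<theta> (Suc j)"
  shows "real x \<le> r"
proof -
  define R where "R = resonance_moduli \<epsilon> \<alpha> \<theta>"
  have abs: "resonance_abs \<epsilon> \<alpha> \<theta> i = (if infinite R \<or> i < card R then ereal (real (enumerate R i)) else \<infinity>)" for i
    by (simp add: resonance_abs_def R_def Let_def)
  have jR: "infinite R \<or> j < card R" and r: "r = real (enumerate R j)"
    using j by (auto simp: abs split: if_splits)
  obtain i where i: "enumerate R i = x" "infinite R \<or> i < card R"
    using enumerate_Ex[of R x] finite_enumerate_Ex[of R x] x by (cases "finite R") (auto simp: R_def)
  have mono: "enumerate R m \<le> enumerate R n" if "m \<le> n" "infinite R \<or> n < card R" for m n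
  proof (cases "m = n")
    case False
    then have "m < n" using that by simp
    then have "enumerate R m < enumerate R n"
      by (cases "finite R") (use that in \<open>simp_all add: enumerate_mono finite_enumerate_mono\<close>)
    then show ?thesis by simp
  qed simp
  have "i \<le> j"
  proof (rule ccontr)
    assume "\<not> i \<le> j"
    then have "Suc j \<le> i" by simp
    then have "enumerate R (Suc j) \<le> x" "infinite R \<or> Suc j < card R" using mono[of "Suc j" i] i by auto
    then show False using less by (auto simp: abs)
  qed
  then have "enumerate R i \<le> enumerate R j" using jR by (rule mono)
  then show ?thesis using i(1) r by simp
qed

context irrational
begin

text \<open>Let m minimize the distance of 2 \<theta> - l \<alpha> to the integers over |l| \<le> L.
  If m is a resonance, then |m| \<le> r and it is the exception: for other l, the Diophantine bound
  on (l - m) \<alpha> and the triangle inequality leave at least half for l. If m misses the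
  exponential bound, every l is good and l0 = 0 is arbitrary.\<close>

lemma nonresonance:
  assumes "0 < \<epsilon>" and c: "0 < c" "c \<le> 1"
    and dioph: "\<And>i :: int. i \<noteq> 0 \<Longrightarrow> c * exp (- \<epsilon> * \<bar>of_int i\<bar>) \<le> dist_int (of_int i * \<alpha>)"
    and j: "resonance_abs \<epsilon> \<alpha> \<theta> j = ereal r" and less: "ereal (real L) < resonance_abs \<epsilon> \<alpha> \<theta> (Suc j)"
  obtains l0 :: int where "of_int \<bar>l0\<bar> \<le> r"
    "\<And>l. \<bar>l\<bar> \<le> int L \<Longrightarrow> l \<noteq> l0 \<Longrightarrow> c / 2 * exp (- 2 * \<epsilon> * real L) \<le> dist_int (2 * \<theta> - of_int l * \<alpha>)"
proof -
  define f where "f l = dist_int (2 * \<theta> - of_int l * \<alpha>)" for l :: int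
  let ?S = "\<lambda>k :: int. {l. \<bar>l\<bar> \<le> k}"
  have fin: "finite (?S k)" for k
    by (rule finite_subset[of _ "{-k..k}"]) auto
  have "Min (f ` ?S (int L)) \<in> f ` ?S (int L)" by (rule Min_in) (use fin in \<open>auto intro: exI[of _ 0]\<close>)
  then obtain m where m: "\<bar>m\<bar> \<le> int L" "f m = Min (f ` ?S (int L))" by auto
  then have m_min: "f m \<le> f l" if "\<bar>l\<bar> \<le> int L" for l using that fin by simp
  have r: "0 \<le> r" using j by (auto simp: resonance_abs_def Let_def split: if_splits)
  have exp_le: "exp (- 2 * \<epsilon> * real L) \<le> exp (- \<epsilon> * y)" if "y \<le> 2 * real L" for y
    using mult_left_mono[OF that, of \<epsilon>] assms by simp
  show thesis
  proof (cases "f m \<le> exp (- \<epsilon> * of_int \<bar>m\<bar>)")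
    case True
    have "f m = Min (f ` ?S \<bar>m\<bar>)"
    proof (rule Min_eqI[symmetric])
      show "f m \<in> f ` ?S \<bar>m\<bar>" by (rule imageI) simp
      show "f m \<le> y" if "y \<in> f ` ?S \<bar>m\<bar>" for y using that m_min m(1) by auto
    qed (use fin in simp)
    then have "resonance \<epsilon> \<alpha> \<theta> m" using True unfolding resonance_def f_def by simp
    then have "nat \<bar>m\<bar> \<in> resonance_moduli \<epsilon> \<alpha> \<theta>" by (simp add: resonance_moduli_def)
    moreover have "ereal (real (nat \<bar>m\<bar>)) \<le> ereal (real L)" using m(1) by simp
    then have "ereal (real (nat \<bar>m\<bar>)) < resonance_abs \<epsilon> \<alpha> \<theta> (Suc j)" using less by (rule le_less_trans)
    ultimately have "real (nat \<bar>m\<bar>) \<le> r" using resonance_modulus_le j by blast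
    then have mr: "of_int \<bar>m\<bar> \<le> r" by simp
    show thesis
    proof (rule that[OF mr])
      fix l assume l: "\<bar>l\<bar> \<le> int L" "l \<noteq> m"
      have "c * exp (- 2 * \<epsilon> * real L) \<le> c * exp (- \<epsilon> * \<bar>of_int (l - m)\<bar>)"
      proof (intro mult_left_mono exp_le)
        have "\<bar>l - m\<bar> \<le> 2 * int L" using l m by linarith
        then have "real_of_int \<bar>l - m\<bar> \<le> real_of_int (2 * int L)" by (simp only: of_int_le_iff)
        then show "\<bar>real_of_int (l - m)\<bar> \<le> 2 * real L" by simp
      qed (use c in simp)
      also have "\<dots> \<le> dist_int (of_int (l - m) * \<alpha>)" using l by (intro dioph) auto
      also have "of_int (l - m) * \<alpha> = (2 * \<theta> - of_int m * \<alpha>) - (2 * \<theta> - of_int l * \<alpha>)"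
        by (simp add: algebra_simps)
      also have "dist_int \<dots> \<le> f m + f l" unfolding f_def by (rule dist_int_diff_le)
      also have "\<dots> \<le> 2 * f l" using m_min[OF l(1)] by simp
      finally show "c / 2 * exp (- 2 * \<epsilon> * real L) \<le> dist_int (2 * \<theta> - of_int l * \<alpha>)" by (simp add: f_def)
    qed
  next
    case False
    show thesis
    proof (rule that[of 0])
      show "of_int \<bar>0\<bar> \<le> r" using r by simp
      fix l assume l: "\<bar>l\<bar> \<le> int L"
      have "c / 2 * exp (- 2 * \<epsilon> * real L) \<le> 1 * exp (- \<epsilon> * of_int \<bar>m\<bar>)"
        by (intro mult_mono exp_le) (use c m in auto)
      also have "\<dots> \<le> f l" using False m_min[OF l] by simp
      finally show "c / 2 * exp (- 2 * \<epsilon> * real L) \<le> dist_int (2 * \<theta> - of_int l * \<alpha>)" by (simp add: f_def)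
    qed
  qed
qed

end

section \<open>A priori bounds, Green's function and choice of scale\<close>

lemma norm_c_fun_le: "cmod (c_fun (a1, a2, a3) \<alpha> t) \<le> \<bar>a1\<bar> + \<bar>a2\<bar> + \<bar>a3\<bar>"
  unfolding c_fun_unit_exp
  by (rule order.trans[OF norm_triangle_ineq add_mono[OF order.trans[OF norm_triangle_ineq]]]) (simp_all add: norm_mult)

text \<open>The equation at site 0. This is what makes the later constants independent of the
  energy.\<close>

lemma energy_bound:
  assumes eq: "harper (a1, a2, a3) \<alpha> \<theta> \<phi> 0 = of_real E * \<phi> 0" and "\<phi> 0 = 1"
    and le: "\<And>m. cmod (\<phi> m) \<le> 1 + of_int \<bar>m\<bar>"
  shows "\<bar>E\<bar> \<le> 4 * (\<bar>a1\<bar> + \<bar>a2\<bar> + \<bar>a3\<bar>) + 2"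
proof -
  let ?S = "\<bar>a1\<bar> + \<bar>a2\<bar> + \<bar>a3\<bar>"
  have "\<bar>E\<bar> = cmod (harper (a1, a2, a3) \<alpha> \<theta> \<phi> 0)" using eq assms(2) by simp
  also have "\<dots> \<le> cmod (c_fun (a1, a2, a3) \<alpha> (\<theta> + of_int 0 * \<alpha>) * \<phi> (0 + 1))
     + cmod (c_tilde (a1, a2, a3) \<alpha> (\<theta> + of_int (0 - 1) * \<alpha>) * \<phi> (0 - 1))
     + cmod (of_real (2 * cos (2 * pi * (\<theta> + of_int 0 * \<alpha>))) * \<phi> 0)"
    unfolding harper_def by (rule order.trans[OF norm_triangle_ineq add_right_mono[OF norm_triangle_ineq]])
  also have "\<dots> \<le> ?S * 2 + ?S * 2 + 2 * 1"
  proof (intro add_mono)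
    show "cmod (c_fun (a1, a2, a3) \<alpha> (\<theta> + of_int 0 * \<alpha>) * \<phi> (0 + 1)) \<le> ?S * 2"
      unfolding norm_mult by (intro mult_mono norm_c_fun_le) (use le[of 1] in auto)
    show "cmod (c_tilde (a1, a2, a3) \<alpha> (\<theta> + of_int (0 - 1) * \<alpha>) * \<phi> (0 - 1)) \<le> ?S * 2"
      unfolding norm_mult norm_c_tilde by (intro mult_mono norm_c_fun_le) (use le[of "-1"] in auto)
    show "cmod (of_real (2 * cos (2 * pi * (\<theta> + of_int 0 * \<alpha>))) * \<phi> 0) \<le> 2 * 1"
      unfolding norm_mult norm_of_real using assms(2) abs_cos_le_one[of "2 * pi * (\<theta> + of_int 0 * \<alpha>)"]
      by (intro mult_mono) (auto simp: abs_mult)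
  qed
  finally show ?thesis by simp
qed

text \<open>\<open>hdet_cramer\<close> in modulus, with \<open>u\<close> sites to the left and
  \<open>w\<close> sites to the right.\<close>

lemma green_bound:
  assumes eq: "\<And>n. harper a \<alpha> \<theta> \<phi> n = of_real E * \<phi> n"
    and c: "\<And>n x. (\<Prod>j<n. cmod (c_fun a \<alpha> (x + real j * \<alpha>))) \<le> C * exp (b * real n)"
    and M: "\<And>n t. \<bar>hdet (diag E) (offdiag a \<alpha>) \<alpha> n t\<bar> \<le> M n"
    and C: "0 \<le> C"
  shows "\<bar>hdet (diag E) (offdiag a \<alpha>) \<alpha> (Suc (u + w)) (\<theta> + of_int i * \<alpha>)\<bar> * cmod (\<phi> (i + int u))
    \<le> C * exp (b * real (Suc u)) * cmod (\<phi> (i - 1)) * M w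
      + C * exp (b * real (Suc w)) * cmod (\<phi> (i + int u + int w + 1)) * M u"
proof -
  let ?h = "hdet (diag E) (offdiag a \<alpha>) \<alpha>"
  have "c_fun a \<alpha> (\<theta> + of_int m * \<alpha>) * \<phi> (m + 1) + c_tilde a \<alpha> (\<theta> + of_int (m - 1) * \<alpha>) * \<phi> (m - 1)
      = of_real (diag E (\<theta> + of_int m * \<alpha>)) * \<phi> m" for m
    using eq[of m] by (simp add: harper_def diag_def algebra_simps)
  from hdet_cramer[of "c_fun a \<alpha>" \<theta> \<alpha> \<phi> "c_tilde a \<alpha>" "diag E" "offdiag a \<alpha>", OF this c_fun_c_tilde, of u w i]
  have "\<bar>?h (Suc (u + w)) (\<theta> + of_int i * \<alpha>)\<bar> * cmod (\<phi> (i + int u))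
    = cmod ((\<Prod>j<Suc u. c_tilde a \<alpha> (\<theta> + of_int (i - 1 + int j) * \<alpha>)) * \<phi> (i - 1)
        * of_real (?h w (\<theta> + of_int (i + int u + 1) * \<alpha>))
      + (\<Prod>j<Suc w. c_fun a \<alpha> (\<theta> + of_int (i + int u + int j) * \<alpha>)) * \<phi> (i + int u + int w + 1)
        * of_real (?h u (\<theta> + of_int i * \<alpha>)))"
    by (metis norm_mult norm_of_real)
  also have "\<dots> \<le> (\<Prod>j<Suc u. cmod (c_fun a \<alpha> ((\<theta> + of_int (i - 1) * \<alpha>) + real j * \<alpha>))) * cmod (\<phi> (i - 1))
        * \<bar>?h w (\<theta> + of_int (i + int u + 1) * \<alpha>)\<bar>
      + (\<Prod>j<Suc w. cmod (c_fun a \<alpha> ((\<theta> + of_int (i + int u) * \<alpha>) + real j * \<alpha>))) * cmod (\<phi> (i + int u + int w + 1))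
        * \<bar>?h u (\<theta> + of_int i * \<alpha>)\<bar>"
  proof -
    have e: "\<theta> + of_int (y + int j) * \<alpha> = (\<theta> + of_int y * \<alpha>) + real j * \<alpha>" for y j
      by (simp add: algebra_simps)
    show ?thesis
      by (rule order.trans[OF norm_triangle_ineq]) (simp only: norm_mult norm_of_real prod_norm[symmetric] norm_c_tilde e order.refl)
  qed
  also have "\<dots> \<le> C * exp (b * real (Suc u)) * cmod (\<phi> (i - 1)) * M w
      + C * exp (b * real (Suc w)) * cmod (\<phi> (i + int u + int w + 1)) * M u"
    by (intro add_mono mult_mono c M mult_nonneg_nonneg C) auto
  finally show ?thesis .
qed

text \<open>\<open>N\<close> maximizes M n * exp (- b n) over n \<le> K. The last claim compares the
  values at \<open>K\<close> and \<open>N\<close> through the two bounds on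
  \<open>M\<close>.\<close>

lemma maximal_scale:
  fixes M :: "nat \<Rightarrow> real"
  assumes upper: "\<And>n. M n \<le> V ^ n" and lower: "\<And>n. c * \<kappa> ^ n \<le> M n"
    and pos: "0 < c" "0 < \<kappa>" "0 < V"
  obtains N where "N \<le> K" "\<And>l. l \<le> N \<Longrightarrow> M l \<le> M N * exp (- b * real (N - l))"
    "ln c + (ln \<kappa> - b) * real K \<le> (ln V - b) * real N"
proof -
  define F where "F n = M n * exp (- b * real n)" for n
  have "Max (F ` {..K}) \<in> F ` {..K}" by (rule Max_in) auto
  then obtain N where "Max (F ` {..K}) = F N" "N \<in> {..K}" by (rule imageE)
  then have N: "N \<le> K" "F N = Max (F ` {..K})" by auto
  have F_le: "F l \<le> F N" if "l \<le> K" for l unfolding N(2) using that by (intro Max_ge) auto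
  show thesis
  proof
    show "N \<le> K" by fact
    show "M l \<le> M N * exp (- b * real (N - l))" if "l \<le> N" for l
    proof -
      have "F l * exp (b * real l) \<le> F N * exp (b * real l)" using F_le[of l] N that by (intro mult_right_mono) auto
      moreover have "F l * exp (b * real l) = M l" by (simp add: F_def mult.assoc flip: exp_add)
      moreover have "F N * exp (b * real l) = M N * exp (- b * real (N - l))"
        using that by (simp add: F_def mult.assoc of_nat_diff algebra_simps flip: exp_add)
      ultimately show ?thesis by simp
    qed
    have "c * \<kappa> ^ K * exp (- b * real K) \<le> F K" unfolding F_def by (intro mult_right_mono lower) auto
    also have "\<dots> \<le> F N" by (rule F_le) simp
    also have "\<dots> \<le> V ^ N * exp (- b * real N)" unfolding F_def by (intro mult_right_mono upper) auto
    finally have "ln (c * \<kappa> ^ K * exp (- b * real K)) \<le> ln (V ^ N * exp (- b * real N))"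
      using pos by (subst ln_le_cancel_iff) auto
    then show "ln c + (ln \<kappa> - b) * real K \<le> (ln V - b) * real N"
      using pos by (simp add: ln_mult ln_realpow algebra_simps)
  qed
qed

text \<open>Take the supremum over the phase. It depends on the energy, but its upper bound does so
  only through \<open>R\<close> and its lower bound not at all.\<close>

lemma det_supremum:
  fixes a1 a2 a3 \<alpha> E R :: real
  assumes E: "\<bar>E\<bar> \<le> R"
  shows "\<exists>M. (\<forall>n t. \<bar>hdet (diag E) (offdiag (a1, a2, a3) \<alpha>) \<alpha> n t\<bar> \<le> M n)
    \<and> (\<forall>n. M n \<le> ((R + 2) + (\<bar>a1\<bar> + \<bar>a2\<bar> + \<bar>a3\<bar>)\<^sup>2 + 1) ^ n) \<and> (\<forall>n. lead (a1 * a3) n \<le> M n)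
    \<and> (\<forall>n B. (\<forall>t. \<bar>hdet (diag E) (offdiag (a1, a2, a3) \<alpha>) \<alpha> n t\<bar> \<le> B) \<longrightarrow> M n \<le> B)"
proof -
  let ?h = "hdet (diag E) (offdiag (a1, a2, a3) \<alpha>) \<alpha>"
  define M where "M n = (SUP t. \<bar>?h n t\<bar>)" for n
  have V: "\<bar>?h n t\<bar> \<le> ((R + 2) + (\<bar>a1\<bar> + \<bar>a2\<bar> + \<bar>a3\<bar>)\<^sup>2 + 1) ^ n" for n t
  proof (rule abs_hdet_le)
    fix t
    have "\<bar>2 * cos (2 * pi * t)\<bar> \<le> 2" using abs_cos_le_one[of "2 * pi * t"] by (simp add: abs_mult)
    then show "\<bar>diag E t\<bar> \<le> R + 2" unfolding diag_def using E by linarith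
    have "0 \<le> cmod (c_fun (a1, a2, a3) \<alpha> t)" by simp
    then show "\<bar>offdiag (a1, a2, a3) \<alpha> t\<bar> \<le> (\<bar>a1\<bar> + \<bar>a2\<bar> + \<bar>a3\<bar>)\<^sup>2"
      unfolding offdiag_def using norm_c_fun_le[of a1 a2 a3 \<alpha> t] by (simp add: power_mono del: c_fun.simps)
  qed
  have bdd: "bdd_above (range (\<lambda>t. \<bar>?h n t\<bar>))" for n by (rule bdd_aboveI2) (rule V)
  have le: "\<bar>?h n t\<bar> \<le> M n" for n t unfolding M_def by (rule cSUP_upper[OF _ bdd]) simp
  have least: "M n \<le> B" if "\<And>t. \<bar>?h n t\<bar> \<le> B" for n B
    unfolding M_def by (rule cSUP_least) (use that in auto)
  have "lead (a1 * a3) n \<le> M n" for n using lead_le_bound[OF le] abs_ge_self order.trans by blast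
  moreover have "M n \<le> ((R + 2) + (\<bar>a1\<bar> + \<bar>a2\<bar> + \<bar>a3\<bar>)\<^sup>2 + 1) ^ n" for n by (rule least) (rule V)
  ultimately show ?thesis using le least by (intro exI[of _ M]) auto
qed

context zero_beta
begin

text \<open>The hypotheses are what region II gives for the dual coupling, where a1 + a3 = (l1 + l3)
  / l2 and a2 = 1 / l2.\<close>

theorem almost_localized_harper:
  assumes a: "0 \<le> a1 + a3" "a1 + a3 < 1" "0 < a2" "a2 < 1"
  shows "almost_localized \<alpha> (\<lambda>\<theta>. harper (a1, a2, a3) \<alpha> \<theta>)"
proof -
  define \<kappa> where "\<kappa> = (1 + sqrt (1 - 4 * (a1 * a3))) / 2"
  have g: "a1 * a3 < 1 / 4" using four_mult_less_1[OF a(1,2)] by simp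
  have \<kappa>: "0 < \<kappa>" using g by (simp add: \<kappa>_def add_pos_pos)
  obtain b0 Cc where b0: "b0 < ln \<kappa>" and Cc: "1 \<le> Cc"
    "\<And>n x. (\<Prod>j<n. cmod (c_fun (a1, a2, a3) \<alpha> (x + real j * \<alpha>))) \<le> Cc * exp (b0 * real n)"
    unfolding \<kappa>_def using prod_norm_c_fun_le[OF a] by blast
  \<comment> \<open>\<open>b\<close> is the midpoint of \<open>b0\<close> and ln \<kappa>, at
    distance \<gamma> from both.\<close>
  define \<gamma> where "\<gamma> = (ln \<kappa> - b0) / 2"
  define b where "b = b0 + \<gamma>"
  have \<gamma>: "0 < \<gamma>" using b0 by (simp add: \<gamma>_def)
  have b_\<gamma>: "ln \<kappa> - b = \<gamma>" by (simp add: b_def \<gamma>_def field_simps)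
  define R where "R = 4 * (\<bar>a1\<bar> + \<bar>a2\<bar> + \<bar>a3\<bar>) + 2"
  define V where "V = (R + 2) + (\<bar>a1\<bar> + \<bar>a2\<bar> + \<bar>a3\<bar>)\<^sup>2 + 1"
  have V: "1 < V"
  proof -
    define S where "S = \<bar>a1\<bar> + \<bar>a2\<bar> + \<bar>a3\<bar>"
    have "0 \<le> S" "0 \<le> S\<^sup>2" by (simp_all add: S_def)
    then show ?thesis unfolding V_def R_def S_def[symmetric] by linarith
  qed
  define v where "v = ln V + \<bar>b\<bar> + 1"
  have v: "0 < v" "ln V - b \<le> v" using V by (auto simp: v_def add_nonneg_pos)
  define c1 where "c1 = min 1 (1 / \<kappa>)"
  have c1: "0 < c1" "c1 \<le> 1" using \<kappa> by (auto simp: c1_def)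
  have lead: "c1 * \<kappa> ^ n \<le> lead (a1 * a3) n" for n
    unfolding c1_def \<kappa>_def by (rule lead_ge[OF g])
  \<comment> \<open>The scale will satisfy N \<ge> s x for x = |k|: \<open>K\<close> is about x /
    10, and a further factor 2 absorbs additive constants.\<close>
  define s where "s = \<gamma> / (20 * v)"
  have s: "0 < s" using \<gamma> v by (simp add: s_def)
  \<comment> \<open>The sites of interest will be about N / 8 or more away from the ends of their
    interval, with a gain of exp (- \<gamma>) per site, hence exp (- \<delta> x) in total.\<close>
  define \<delta> where "\<delta> = \<gamma> * s / 8"
  have \<delta>: "0 < \<delta>" using \<gamma> s by (simp add: \<delta>_def)
  have "0 < \<delta> / 8" using \<delta> by simp
  from hdet_interpolation[OF this] obtain C where C: "0 \<le> C"
    and interp: "\<forall>a E N \<theta> \<rho> s1 n1 s2 n2 \<mu> t.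
      n1 + n2 = Suc N \<longrightarrow> {s1..<s1 + int n1} \<inter> {s2..<s2 + int n2} = {} \<longrightarrow> 0 \<le> \<rho> \<longrightarrow>
      (\<forall>i\<in>{s1..<s1 + int n1} \<union> {s2..<s2 + int n2}. \<forall>j\<in>{s1..<s1 + int n1} \<union> {s2..<s2 + int n2}. i \<noteq> j \<longrightarrow>
         exp (- \<rho>) \<le> dist_int (2 * \<theta> + of_int (i + j + int N - 1) * \<alpha>) \<and> exp (- \<rho>) \<le> dist_int (of_int (j - i) * \<alpha>)) \<longrightarrow>
      (\<forall>i\<in>{s1..<s1 + int n1} \<union> {s2..<s2 + int n2}. \<bar>hdet (diag E) (offdiag a \<alpha>) \<alpha> N (\<theta> + of_int i * \<alpha>)\<bar> \<le> \<mu>) \<longrightarrow>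
      \<bar>hdet (diag E) (offdiag a \<alpha>) \<alpha> N t\<bar> \<le> real (Suc N) * \<mu> * exp (\<delta> / 8 * real (Suc N) + C + C * \<rho>)"
    by (elim exE conjE) (rule that)
  \<comment> \<open>The interpolation constant multiplies \<rho>, which is 6 \<epsilon>0 x up to a
    constant; this choice keeps the loss at most \<delta> x / 8.\<close>
  define \<epsilon>0 where "\<epsilon>0 = \<delta> / (48 * (C + 1))"
  have \<epsilon>0: "0 < \<epsilon>0" using \<delta> C by (simp add: \<epsilon>0_def)
  have C\<epsilon>: "C * (6 * \<epsilon>0) \<le> \<delta> / 8"
  proof -
    have "C * (6 * \<epsilon>0) = \<delta> / 8 * (C / (C + 1))" using C by (simp add: \<epsilon>0_def field_simps)
    also have "\<dots> \<le> \<delta> / 8 * 1" using C \<delta> by (intro mult_left_mono) auto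
    finally show ?thesis by simp
  qed
  obtain c where c: "0 < c" "c \<le> 1"
    and dioph: "\<And>i :: int. i \<noteq> 0 \<Longrightarrow> c * exp (- \<epsilon>0 * \<bar>of_int i\<bar>) \<le> dist_int (of_int i * \<alpha>)"
    using subexponential_diophantine[OF \<epsilon>0] by blast
  define C' where "C' = C + C * ln (2 / c) + \<delta> / 8"
  define T where "T = 1 + 48 / \<delta>"
  have T: "1 \<le> T" using \<delta> by (simp add: T_def)
  have poly_le: "1 + 3 * x \<le> T * exp (\<delta> / 16 * x)" if "0 \<le> x" for x
  proof -
    have "1 + 3 * x \<le> T * (1 + \<delta> / 16 * x)" using \<delta> that by (simp add: T_def field_simps)
    also have "\<dots> \<le> T * exp (\<delta> / 16 * x)" using T by (intro mult_left_mono exp_ge_add_one_self) auto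
    finally show ?thesis .
  qed
  define G0 where "G0 = 4 * Cc * T\<^sup>2 * exp C'"
  have "0 \<le> ln (2 / c)" using c by (intro ln_ge_zero) (simp add: field_simps)
  then have C': "0 \<le> C'" using C \<delta> by (simp add: C'_def)
  have G0: "1 \<le> G0"
  proof -
    have "1 * 1 * 1 * 1 \<le> G0" unfolding G0_def using Cc T C' by (intro mult_mono) (auto simp: one_le_power)
    then show ?thesis by simp
  qed
  \<comment> \<open>From \<open>x0\<close> on: N \<ge> s x, the final bound is less than 1, and x
    \<ge> 1. Below \<open>x0\<close> the linear growth of \<phi> is absorbed by the second summand
    of \<open>C3\<close>.\<close>
  define x0 where "x0 = max (max (18 - 20 * ln c1 / \<gamma>) (2 * ln G0 / \<delta> + 1)) 1"
  define C3 where "C3 = G0 + T * exp (\<delta> * x0)"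
  have C3: "0 < C3" using G0 T by (simp add: C3_def add_pos_pos)
  show ?thesis
    unfolding almost_localized_def
  proof (rule exI[of _ 4], rule exI[of _ C3], rule exI[of _ \<epsilon>0], rule exI[of _ "\<delta> / 2"], intro conjI allI impI)
    fix \<theta> E \<phi> j k
    assume eq: "\<forall>n. harper (a1, a2, a3) \<alpha> \<theta> \<phi> n = complex_of_real E * \<phi> n" and \<phi>0: "\<phi> 0 = 1"
      and \<phi>_le: "\<forall>m. cmod (\<phi> m) \<le> 1 + of_int \<bar>m\<bar>"
      and lower: "ereal 4 * (1 + resonance_abs \<epsilon>0 \<alpha> \<theta> j) < ereal (of_int \<bar>k\<bar>)"
      and upper: "ereal (of_int \<bar>k\<bar>) < ereal (1 / 4) * resonance_abs \<epsilon>0 \<alpha> \<theta> (Suc j)"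
    define x where "x = real_of_int \<bar>k\<bar>"
    have x_nonneg: "0 \<le> x" by (simp add: x_def)
    show "cmod (\<phi> k) \<le> C3 * exp (- (\<delta> / 2) * of_int \<bar>k\<bar>)"
    proof (cases "x < x0")
      case True
      have "cmod (\<phi> k) \<le> 1 + 3 * x" using \<phi>_le[rule_format, of k] x_nonneg by (simp add: x_def)
      also have "\<dots> \<le> T * exp (\<delta> / 16 * x)" by (rule poly_le[OF x_nonneg])
      also have "\<dots> \<le> T * exp (\<delta> * x0 - \<delta> / 2 * x)"
      proof (intro mult_left_mono)
        have "\<delta> * x \<le> \<delta> * x0" "0 \<le> \<delta> * x" using True \<delta> x_nonneg by auto
        then show "exp (\<delta> / 16 * x) \<le> exp (\<delta> * x0 - \<delta> / 2 * x)" by simp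
      qed (use T in simp)
      also have "\<dots> = T * exp (\<delta> * x0) * exp (- (\<delta> / 2) * x)" by (simp add: mult.assoc flip: exp_add)
      also have "\<dots> \<le> C3 * exp (- (\<delta> / 2) * x)" using G0 by (intro mult_right_mono) (auto simp: C3_def)
      finally show ?thesis by (simp only: x_def)
    next
      case False
      then have x1: "18 - 20 * ln c1 / \<gamma> \<le> x" and x2: "2 * ln G0 / \<delta> + 1 \<le> x" and x3: "1 \<le> x"
        by (auto simp: x0_def)
      obtain r where r: "resonance_abs \<epsilon>0 \<alpha> \<theta> j = ereal r" "4 * (1 + r) < x"
      proof (cases "resonance_abs \<epsilon>0 \<alpha> \<theta> j")
        case (real r)
        then show thesis using that[of r] lower by (simp add: x_def one_ereal_def)
      next
        case PInf
        then show thesis using lower by (simp add: one_ereal_def)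
      next
        case MInf
        then show thesis by (auto simp: resonance_abs_def Let_def split: if_splits)
      qed
      \<comment> \<open>All indices to be tested have modulus at most 3 |k|, and this is still below
        the next resonance since C0 = 4.\<close>
      define L where "L = 3 * nat \<bar>k\<bar>"
      have L: "real L = 3 * x" by (simp add: L_def x_def)
      have Lless: "ereal (real L) < resonance_abs \<epsilon>0 \<alpha> \<theta> (Suc j)"
      proof (cases "resonance_abs \<epsilon>0 \<alpha> \<theta> (Suc j)")
        case (real r')
        then have "x < 1 / 4 * r'" using upper by (simp add: x_def)
        then show ?thesis using real L x3 by simp
      next
        case MInf
        then show ?thesis by (auto simp: resonance_abs_def Let_def split: if_splits)
      qed simp
      obtain l0 where l0: "of_int \<bar>l0\<bar> \<le> r"
        and nonres: "\<And>l. \<bar>l\<bar> \<le> int L \<Longrightarrow> l \<noteq> l0 \<Longrightarrow> c / 2 * exp (- 2 * \<epsilon>0 * real L) \<le> dist_int (2 * \<theta> - of_int l * \<alpha>)"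
        using nonresonance[OF \<epsilon>0 c dioph r(1) Lless] by blast
      have "4 * real_of_int \<bar>l0\<bar> < real_of_int \<bar>k\<bar>" using r(2) l0 by (simp add: x_def)
      then have l0k: "4 * \<bar>l0\<bar> < \<bar>k\<bar>" by linarith
      have "\<bar>E\<bar> \<le> R" unfolding R_def by (rule energy_bound[of _ _ _ \<alpha> \<theta> \<phi>]) (use eq \<phi>0 \<phi>_le in auto)
      let ?h = "hdet (diag E) (offdiag (a1, a2, a3) \<alpha>) \<alpha>"
      obtain M where M: "\<forall>n t. \<bar>?h n t\<bar> \<le> M n" and MV: "\<forall>n. M n \<le> V ^ n"
        and Mlead: "\<forall>n. lead (a1 * a3) n \<le> M n" and M_least: "\<forall>n B. (\<forall>t. \<bar>?h n t\<bar> \<le> B) \<longrightarrow> M n \<le> B"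
        using det_supremum[OF \<open>\<bar>E\<bar> \<le> R\<close>, of a1 a2 a3 \<alpha>, folded V_def] by (elim exE conjE) (rule that)
      have Mlow: "c1 * \<kappa> ^ n \<le> M n" for n using lead[of n] Mlead by (meson order.trans)
      have Mpos: "0 < M n" for n
        using less_le_trans[OF _ Mlow] c1 \<kappa> by simp
      define K where "K = nat \<bar>k\<bar> div 10"
      have K10: "10 * int K \<le> \<bar>k\<bar>" "\<bar>k\<bar> \<le> 10 * int K + 9" unfolding K_def by linarith+
      then have "x \<le> 10 * real K + 9" unfolding x_def by linarith
      then have Kx: "(x - 9) / 10 \<le> real K" by simp
      obtain N where NK: "N \<le> K" and Nmax: "\<And>l. l \<le> N \<Longrightarrow> M l \<le> M N * exp (- b * real (N - l))"
        and Nlow: "ln c1 + (ln \<kappa> - b) * real K \<le> (ln V - b) * real N"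
        using maximal_scale[of M V c1 \<kappa> K b, OF MV[THEN spec] Mlow c1(1) \<kappa>] V by auto
      have Nx: "s * x \<le> real N"
      proof -
        have "\<gamma> * ((x - 9) / 10) \<le> \<gamma> * real K" using Kx \<gamma> by (intro mult_left_mono) auto
        then have "\<gamma> * ((x - 9) / 10) + ln c1 \<le> (ln V - b) * real N" using Nlow b_\<gamma> by simp
        also have "\<dots> \<le> v * real N" using v by (intro mult_right_mono) auto
        finally have 1: "\<gamma> * ((x - 9) / 10) + ln c1 \<le> v * real N" .
        have "18 * \<gamma> - 20 * ln c1 \<le> \<gamma> * x" using x1 \<gamma> by (simp add: field_simps)
        then have "\<gamma> * x / 20 \<le> \<gamma> * ((x - 9) / 10) + ln c1" by (simp add: field_simps)
        then have "\<gamma> * x / 20 \<le> v * real N" using 1 by linarith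
        then show ?thesis using v by (simp add: s_def field_simps)
      qed
      have "0 < real N" using Nx s x3 by (smt (verit) mult_pos_pos)
      then have N1: "1 \<le> int N" by simp
      have N10: "10 * int N \<le> \<bar>k\<bar>" using NK K10 by linarith
      then have "10 * real N \<le> x" unfolding x_def by linarith
      then have Nx1: "real (Suc N) \<le> x + 1" using x_nonneg by simp
      define m where "m = N div 8"
      have m: "8 * int m \<le> int N" "int N \<le> 8 * int m + 7" unfolding m_def by linarith+
      have mx: "s * x / 8 \<le> real (Suc m)" using Nx m by linarith
      \<comment> \<open>A node i stands for the interval from i to i + N - 1. The 2 m + 1 nodes in
        \<open>A1\<close> give intervals around 0, the N - 2 m nodes in \<open>A2\<close> intervals
        around k, with at least \<open>m\<close> sites left on either side. Together there are N + 1
        nodes.\<close>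
      define n1 where "n1 = 2 * m + 1"
      define n2 where "n2 = N - 2 * m"
      \<comment> \<open>For distinct i, j in \<open>A1\<close> the index - (i + j + N - 1) is
        negative in the first case and positive in the second, so it differs from \<open>l0\<close>.
        All other pairs give indices of modulus greater than |k| / 4 > |l0|.\<close>
      define s1 where "s1 = (if 0 \<le> l0 then - 3 * int m else int m - int N + 1)"
      define s2 where "s2 = k - int N + 1 + int m"
      define A1 where "A1 = {s1..<s1 + int n1}"
      define A2 where "A2 = {s2..<s2 + int n2}"
      have n12: "n1 + n2 = Suc N" using m by (simp add: n1_def n2_def)
      have n2: "int n2 = int N - 2 * int m" using m by (simp add: n2_def)
      have A1: "int m \<le> - i \<and> - i \<le> int N - 1 - int m" if "i \<in> A1" for i
        using that m N1 by (auto simp: A1_def s1_def n1_def split: if_splits)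
      have A1_side: "if 0 \<le> l0 then - 3 * int m \<le> i else i \<le> 3 * int m - int N + 1" if "i \<in> A1" for i
        using that m N1 by (auto simp: A1_def s1_def n1_def split: if_splits)
      have A2: "int m \<le> k - i \<and> k - i \<le> int N - 1 - int m" if "i \<in> A2" for i
        using that m N1 n2 by (auto simp: A2_def s2_def)
      have dis: "A1 \<inter> A2 = {}"
      proof -
        have False if "i \<in> A1" "i \<in> A2" for i using A1[OF that(1)] A2[OF that(2)] N10 N1 by linarith
        then show ?thesis by blast
      qed
      \<comment> \<open>Chosen so that exp (- \<rho>) is exactly the bound in \<open>nonres\<close>
        with L = 3 x.\<close>
      define \<rho> where "\<rho> = 6 * \<epsilon>0 * x + ln (2 / c)"
      have \<rho>: "0 \<le> \<rho>" using \<epsilon>0 x_nonneg \<open>0 \<le> ln (2 / c)\<close> by (simp add: \<rho>_def)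
      have exp_\<rho>: "exp (- \<rho>) = c / 2 * exp (- 2 * \<epsilon>0 * real L)"
      proof -
        have "exp (- \<rho>) = exp (- ln (2 / c)) * exp (- 2 * \<epsilon>0 * real L)"
          unfolding \<rho>_def L by (simp flip: exp_add)
        also have "exp (- ln (2 / c)) = c / 2" using c by (simp add: exp_minus)
        finally show ?thesis .
      qed
      have sep: "exp (- \<rho>) \<le> dist_int (2 * \<theta> + of_int (i + j + int N - 1) * \<alpha>) \<and> exp (- \<rho>) \<le> dist_int (of_int (j - i) * \<alpha>)"
        if ij: "i \<in> A1 \<union> A2" "j \<in> A1 \<union> A2" "i \<noteq> j" for i j
      proof
        let ?l = "- (i + j + int N - 1)"
        have Lk: "int L = 3 * \<bar>k\<bar>" by (simp add: L_def)
        have "\<bar>?l\<bar> \<le> int L \<and> ?l \<noteq> l0"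
        proof (cases "i \<in> A1 \<and> j \<in> A1")
          case True
          then show ?thesis using A1[of i] A1[of j] A1_side[of i] A1_side[of j] ij(3) m N1 N10 Lk
            by (cases "0 \<le> l0") auto
        next
          case False
          then consider "i \<in> A1" "j \<in> A2" | "i \<in> A2" "j \<in> A1" | "i \<in> A2" "j \<in> A2" using ij by blast
          then show ?thesis
          proof cases
            case 1
            then show ?thesis using A1[of i] A2[of j] l0k N1 N10 Lk by linarith
          next
            case 2
            then show ?thesis using A2[of i] A1[of j] l0k N1 N10 Lk by linarith
          next
            case 3
            then show ?thesis using A2[of i] A2[of j] l0k N1 N10 Lk by linarith
          qed
        qed
        then have "exp (- \<rho>) \<le> dist_int (2 * \<theta> - of_int ?l * \<alpha>)" unfolding exp_\<rho> by (intro nonres) auto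
        then show "exp (- \<rho>) \<le> dist_int (2 * \<theta> + of_int (i + j + int N - 1) * \<alpha>)"
          by (simp only: of_int_minus mult_minus_left diff_minus_eq_add)
        have "\<bar>j - i\<bar> \<le> int L" using ij A1[of i] A2[of j] A2[of i] A1[of j] N1 N10 Lk by auto
        then have "\<bar>real_of_int (j - i)\<bar> \<le> 2 * real L"
        proof -
          have "real_of_int \<bar>j - i\<bar> \<le> real_of_int (int L)" using \<open>\<bar>j - i\<bar> \<le> int L\<close> by (simp only: of_int_le_iff)
          then show ?thesis by simp
        qed
        then have "\<epsilon>0 * \<bar>real_of_int (j - i)\<bar> \<le> \<epsilon>0 * (2 * real L)" using \<epsilon>0 by (intro mult_left_mono) auto
        then have "c / 2 * exp (- 2 * \<epsilon>0 * real L) \<le> c * exp (- \<epsilon>0 * \<bar>of_int (j - i)\<bar>)"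
          using c by (intro mult_mono) auto
        also have "\<dots> \<le> dist_int (of_int (j - i) * \<alpha>)" using ij by (intro dioph) auto
        finally show "exp (- \<rho>) \<le> dist_int (of_int (j - i) * \<alpha>)" unfolding exp_\<rho> .
      qed
      \<comment> \<open>The loss in the interpolation; its factor 2 turns failure at all nodes into
        M N \<le> M N / 2.\<close>
      define D where "D = 2 * (x + 1) * exp (\<delta> / 4 * x + C')"
      have D: "0 < D" using x_nonneg by (simp add: D_def)
      have "\<exists>i\<in>A1 \<union> A2. M N / D < \<bar>?h N (\<theta> + of_int i * \<alpha>)\<bar>"
      proof (rule ccontr)
        assume "\<not> ?thesis"
        then have small: "\<bar>?h N (\<theta> + of_int i * \<alpha>)\<bar> \<le> M N / D" if "i \<in> A1 \<union> A2" for i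
          using that by (auto simp: not_less)
        have "M N \<le> M N / 2"
        proof (rule M_least[rule_format])
          fix t
          have "\<bar>?h N t\<bar> \<le> real (Suc N) * (M N / D) * exp (\<delta> / 8 * real (Suc N) + C + C * \<rho>)"
          proof (rule interp[THEN spec, THEN spec, THEN spec, THEN spec, THEN spec, THEN spec, THEN spec, THEN spec, THEN spec, THEN spec, THEN spec, THEN mp, THEN mp, THEN mp, THEN mp, THEN mp, OF n12 dis[unfolded A1_def A2_def] \<rho>])
            show "\<forall>i\<in>{s1..<s1 + int n1} \<union> {s2..<s2 + int n2}. \<forall>j\<in>{s1..<s1 + int n1} \<union> {s2..<s2 + int n2}. i \<noteq> j \<longrightarrow>
              exp (- \<rho>) \<le> dist_int (2 * \<theta> + of_int (i + j + int N - 1) * \<alpha>) \<and> exp (- \<rho>) \<le> dist_int (of_int (j - i) * \<alpha>)"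
              using sep unfolding A1_def A2_def by blast
            show "\<forall>i\<in>{s1..<s1 + int n1} \<union> {s2..<s2 + int n2}. \<bar>?h N (\<theta> + of_int i * \<alpha>)\<bar> \<le> M N / D"
              using small unfolding A1_def A2_def by blast
          qed
          also have "\<dots> \<le> (x + 1) * (M N / D) * exp (\<delta> / 4 * x + C')"
          proof (intro mult_mono)
            have "\<delta> / 8 * real (Suc N) \<le> \<delta> / 8 * (x + 1)" using Nx1 \<delta> by (intro mult_left_mono) auto
            moreover have "C * (6 * \<epsilon>0) * x \<le> \<delta> / 8 * x" using C\<epsilon> x_nonneg by (intro mult_right_mono) auto
            ultimately show "exp (\<delta> / 8 * real (Suc N) + C + C * \<rho>) \<le> exp (\<delta> / 4 * x + C')"
            proof -
              have "C * \<rho> = C * (6 * \<epsilon>0) * x + C * ln (2 / c)" by (simp add: \<rho>_def algebra_simps)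
              moreover have "\<delta> / 8 * (x + 1) + \<delta> / 8 * x = \<delta> / 4 * x + \<delta> / 8" by (simp add: field_simps)
              ultimately have "\<delta> / 8 * real (Suc N) + C + C * \<rho> \<le> \<delta> / 4 * x + C'"
                using \<open>\<delta> / 8 * real (Suc N) \<le> \<delta> / 8 * (x + 1)\<close> \<open>C * (6 * \<epsilon>0) * x \<le> \<delta> / 8 * x\<close>
                unfolding C'_def by linarith
              then show ?thesis by simp
            qed
          qed (use Nx1 D Mpos[of N] x_nonneg in auto)
          also have "\<dots> = M N / 2"
          proof -
            have "y * (M N / (2 * y * e)) * e = M N / 2" if "y \<noteq> 0" "e \<noteq> 0" for y e :: real
              using that by (simp add: field_simps)
            moreover have "x + 1 \<noteq> 0" "exp (\<delta> / 4 * x + C') \<noteq> 0" using x_nonneg by simp_all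
            ultimately show ?thesis unfolding D_def by blast
          qed
          finally show "\<bar>?h N t\<bar> \<le> M N / 2" .
        qed
        then show False using Mpos[of N] by simp
      qed
      then obtain i where i: "i \<in> A1 \<union> A2" and large: "M N / D < \<bar>?h N (\<theta> + of_int i * \<alpha>)\<bar>" by blast
      \<comment> \<open>At the ends of the interval \<phi> is bounded only linearly, but multiplied
        by exp (- \<delta> x). The losses, \<delta> / 4 from \<open>D\<close> and twice \<delta> /
        16 from polynomial factors, leave 5 \<delta> / 8.\<close>
      have decay: "cmod (\<phi> p) \<le> G0 * exp (- (5 / 8 * \<delta>) * x)"
        if p: "int m \<le> p - i" "p - i \<le> int N - 1 - int m" and ix: "\<bar>i - 1\<bar> \<le> 3 * \<bar>k\<bar>" "\<bar>i + int N\<bar> \<le> 3 * \<bar>k\<bar>" for p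
      proof -
        define u where "u = nat (p - i)"
        define w where "w = N - 1 - u"
        have u: "int u = p - i" using p by (simp add: u_def)
        have w: "int w = int N - 1 - int u" using p u by (simp add: w_def)
        have uw: "Suc (u + w) = N" and mu: "m \<le> u" and mw: "m \<le> w" using u w p by linarith+
        have \<phi>b: "cmod (\<phi> (i - 1)) \<le> 1 + 3 * x" "cmod (\<phi> (i + int N)) \<le> 1 + 3 * x"
          using \<phi>_le[rule_format, of "i - 1"] \<phi>_le[rule_format, of "i + int N"] ix unfolding x_def by linarith+
        \<comment> \<open>The off-diagonal product over n + 1 = N - l sites grows at rate
          \<open>b0\<close>, while \<open>M l\<close> is smaller than \<open>M N\<close> at rate b =
          b0 + \<gamma>; the difference \<gamma> is the decay.\<close>
        have Mstep: "exp (b0 * real (Suc n)) * M l \<le> M N * exp (- \<delta> * x)" if "n + l + 1 = N" "m \<le> n" for n l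
        proof -
          have "N - l = Suc n" "l \<le> N" using that by auto
          then have "exp (b0 * real (Suc n)) * M l \<le> exp (b0 * real (Suc n)) * (M N * exp (- b * real (Suc n)))"
            using Nmax[of l] by (intro mult_left_mono) auto
          also have "\<dots> = M N * exp (- \<gamma> * real (Suc n))"
            unfolding b_def by (simp add: algebra_simps flip: exp_add)
          also have "\<dots> \<le> M N * exp (- \<delta> * x)"
          proof -
            have "s * x / 8 \<le> real (Suc n)" using mx that by simp
            then have "\<gamma> * (s * x / 8) \<le> \<gamma> * real (Suc n)" using \<gamma> by (intro mult_left_mono) auto
            then show ?thesis using Mpos[of N] by (simp add: \<delta>_def)
          qed
          finally show ?thesis .
        qed
        have "M N / D * cmod (\<phi> p) \<le> \<bar>?h N (\<theta> + of_int i * \<alpha>)\<bar> * cmod (\<phi> p)"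
          using large by (intro mult_right_mono) auto
        also have "\<dots> \<le> Cc * exp (b0 * real (Suc u)) * cmod (\<phi> (i - 1)) * M w
            + Cc * exp (b0 * real (Suc w)) * cmod (\<phi> (i + int N)) * M u"
        proof -
          have idx: "i + int u = p" "p + int w + 1 = i + int N" using u w by simp_all
          have "0 \<le> Cc" using Cc by simp
          from green_bound[OF eq[rule_format] Cc(2) M[rule_format] this, of u w i]
          show ?thesis unfolding uw idx .
        qed
        also have "\<dots> = Cc * cmod (\<phi> (i - 1)) * (exp (b0 * real (Suc u)) * M w)
            + Cc * cmod (\<phi> (i + int N)) * (exp (b0 * real (Suc w)) * M u)" by simp
        also have "\<dots> \<le> Cc * (1 + 3 * x) * (M N * exp (- \<delta> * x)) + Cc * (1 + 3 * x) * (M N * exp (- \<delta> * x))"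
          using Cc uw mu mw x_nonneg less_imp_le[OF Mpos] by (intro add_mono mult_mono \<phi>b Mstep mult_nonneg_nonneg) auto
        also have "\<dots> = M N * (2 * Cc * (1 + 3 * x) * exp (- \<delta> * x))" by (simp add: mult_ac)
        finally have "M N * (cmod (\<phi> p) / D) \<le> M N * (2 * Cc * (1 + 3 * x) * exp (- \<delta> * x))" by simp
        then have "cmod (\<phi> p) / D \<le> 2 * Cc * (1 + 3 * x) * exp (- \<delta> * x)"
          using Mpos[of N] by (simp only: mult_le_cancel_left_pos)
        then have "cmod (\<phi> p) \<le> 2 * Cc * (1 + 3 * x) * exp (- \<delta> * x) * D"
          using D by (simp only: pos_divide_le_eq)
        then have "cmod (\<phi> p) \<le> D * (2 * Cc * (1 + 3 * x) * exp (- \<delta> * x))" by (simp only: mult.commute)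
        also have "\<dots> = 4 * Cc * exp C' * ((x + 1) * (1 + 3 * x)) * (exp (\<delta> / 4 * x) * exp (- \<delta> * x))"
          by (simp add: D_def exp_add)
        also have "\<dots> \<le> 4 * Cc * exp C' * ((T * exp (\<delta> / 16 * x)) * (T * exp (\<delta> / 16 * x))) * (exp (\<delta> / 4 * x) * exp (- \<delta> * x))"
          using Cc T x_nonneg poly_le[OF x_nonneg] by (intro mult_mono mult_nonneg_nonneg) auto
        also have "\<dots> = G0 * (exp (\<delta> / 16 * x) * exp (\<delta> / 16 * x) * exp (\<delta> / 4 * x) * exp (- \<delta> * x))"
          by (simp add: G0_def power2_eq_square)
        also have "\<dots> = G0 * exp (- (5 / 8 * \<delta>) * x)"
          unfolding exp_add[symmetric] by (simp add: field_simps)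
        finally show ?thesis .
      qed
      have "i \<notin> A1"
      proof
        assume i1: "i \<in> A1"
        have "cmod (\<phi> 0) \<le> G0 * exp (- (5 / 8 * \<delta>) * x)"
          by (rule decay) (use A1[OF i1] N1 N10 in linarith)+
        moreover have "ln G0 < 5 / 8 * \<delta> * x"
        proof -
          have "2 * ln G0 + \<delta> \<le> \<delta> * x" using x2 \<delta> by (simp add: field_simps)
          moreover have "0 \<le> ln G0" using G0 by simp
          ultimately show ?thesis using \<delta> by linarith
        qed
        then have "G0 < exp (5 / 8 * \<delta> * x)" using G0 by (metis exp_less_mono exp_ln less_le_trans zero_less_one)
        then have "G0 * exp (- (5 / 8 * \<delta>) * x) < 1" by (simp add: exp_minus field_simps)
        ultimately show False using \<phi>0 by simp
      qed
      then have i2: "i \<in> A2" using i by simp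
      have "cmod (\<phi> k) \<le> G0 * exp (- (5 / 8 * \<delta>) * x)"
        by (rule decay) (use A2[OF i2] N1 N10 in linarith)+
      also have "\<dots> \<le> C3 * exp (- (\<delta> / 2) * x)"
        using G0 T \<delta> x_nonneg by (intro mult_mono) (auto simp: C3_def)
      finally show ?thesis by (simp only: x_def)
    qed
  qed (use C3 \<epsilon>0 \<delta> in auto)
qed

end

theorem theorem3p1:
  fixes \<alpha> :: real and l :: coupling
  assumes "\<alpha> \<notin> \<rat>"
    and "beta_exponent \<alpha> = 0"
    and "region_II l"
  shows "almost_localized \<alpha> (\<lambda>\<theta>. harper (dual_coupling l) \<alpha> \<theta>)"
proof -
  obtain l1 l2 l3 where l: "l = (l1, l2, l3)" by (cases l)
  interpret zero_beta \<alpha> by unfold_locales (use assms in auto)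
  have l2: "0 \<le> l1 + l3" "l1 + l3 < l2" "1 < l2" using assms(3) by (auto simp: l)
  have "almost_localized \<alpha> (\<lambda>\<theta>. harper (l3 / l2, 1 / l2, l1 / l2) \<alpha> \<theta>)"
  proof (rule almost_localized_harper)
    show "0 \<le> l3 / l2 + l1 / l2" "l3 / l2 + l1 / l2 < 1"
      using l2 by (simp_all add: add.commute flip: add_divide_distrib)
  qed (use l2 in auto)
  then show ?thesis by (simp add: l)
qed

end
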